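(* The $(\Gamma,\omega)$-algebra $\mathrm{U}_{q,\Xi}(A)$ (defined in the context) is a Hopf $(\Gamma,\omega)$-algebra, with co-multiplication $\Delta:\mathrm{U}_{q,\Xi}(A)\to\mathrm{U}_{q,\Xi}(A)\otimes\mathrm{U}_{q,\Xi}(A)$, co-unit $\varepsilon:\mathrm{U}_{q,\Xi}(A)\to\mathbb{C}(q)$ and antipode $S:\mathrm{U}_{q,\Xi}(A)\to\mathrm{U}_{q,\Xi}(A)$ respectively defined, for all $i\in I$, by $$\Delta(e_i)=e_i\otimes k_i+1\otimes e_i,\quad \Delta(f_i)=f_i\otimes1+k_i^{-1}\otimes f_i,\quad \Delta(k_i^{\pm1})=k_i^{\pm1}\otimes k_i^{\pm1},$$ $$\varepsilon(e_i)=0,\quad\varepsilon(f_i)=0,\quad\varepsilon(k_i^{\pm1})=1,$$ $$S(e_i)=-e_ik_i^{-1},\quad S(f_i)=-k_if_i,\quad S(k_i^{\pm1})=k_i^{\mp1}.$$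
   Context: $\Gamma$ is an additive abelian group with commutative factor $\omega:\Gamma\times\Gamma\to\mathbb{C}^*$: $\omega(\alpha,\beta)=\omega(\beta,\alpha)^{-1}$ and $\omega$ is multiplicative in each argument. A $(\Gamma,\omega)$-algebra is a $\Gamma$-graded unital associative algebra; $d(x)$ is the degree of a homogeneous $x$. The tensor product of two $(\Gamma,\omega)$-algebras has multiplication $(a\otimes b)(c\otimes d')=\omega(d(b),d(c))\,ac\otimes bd'$. A Hopf $(\Gamma,\omega)$-algebra is a $(\Gamma,\omega)$-algebra $H$ (multiplication $\mu$) with degree $0$ algebra homomorphisms $\Delta:H\to H\otimes H$ (coassociative) and $\varepsilon$ (co-unit for $\Delta$), and a degree $0$ linear map $S$ with $S(xy)=\omega(d(x),d(y))S(y)S(x)$ and $\mu(S\otimes\mathrm{id})\Delta(x)=\mu(\mathrm{id}\otimes S)\Delta(x)=\varepsilon(x)1$. $A=(A_{ij})_{i,j\in I}$ is a Cartan matrix of finite type with $I=\{1,\dots,\ell\}$, or of untwisted affine type with $I=\{0,1,\dots,\ell\}$. $\Xi=(\xi_i)_{i\in I}$ is a sequence in $\Gamma$ with $\omega(\xi_i,\xi_i)=1$ for all $i$; in the affine case $\xi_0=-\sum_{i=1}^\ell k_i\xi_i$, where $\sum_{i=1}^\ell k_i\Upsilon_i$ is the highest root of the underlying finite root system with simple roots $\Upsilon_1,\dots,\Upsilon_\ell$. The $d_i$ are the smallest positive even integers such that $(d_iA_{ij})$ is a symmetric integer matrix, and $q_i=q^{d_i/2}$. $[n]_q=\frac{q^n-q^{-n}}{q-q^{-1}}$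 and $\begin{bmatrix}m\\ r\end{bmatrix}_q=\frac{[m]_q!}{[m-r]_q![r]_q!}$. $\mathrm{U}_{q,\Xi}(A)$ is the unital associative $(\Gamma,\omega)$-algebra over $\mathbb{C}(q)$ generated by homogeneous elements $e_i,f_i,k_i^{\pm1}$ ($i\in I$) of degrees $d(e_i)=\xi_i$, $d(f_i)=-\xi_i$, $d(k_i^{\pm1})=0$, subject to $$k_ik_j=k_jk_i,\quad k_ik_i^{-1}=1,\quad k_ie_jk_i^{-1}=q_i^{A_{ij}}e_j,\quad k_if_jk_i^{-1}=q_i^{-A_{ij}}f_j,$$ $$e_if_j-\omega(\xi_j,\xi_i)f_je_i=\delta_{ij}\frac{k_i-k_i^{-1}}{q_i-q_i^{-1}}\quad\text{for all }i,j,$$ $$\sum_{r=0}^{1-A_{ij}}(-\omega(\xi_i,\xi_j))^r\begin{bmatrix}1-A_{ij}\\ r\end{bmatrix}_{q_i}e_i^{1-A_{ij}-r}e_je_i^r=0,\quad\sum_{r=0}^{1-A_{ij}}(-\omega(\xi_i,\xi_j))^r\begin{bmatrix}1-A_{ij}\\ r\end{bmatrix}_{q_i}f_i^{1-A_{ij}-r}f_jf_i^r=0\quad(i\neq j).$$ *)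

theory Defs
  imports
    "HOL-Library.Poly_Mapping"
    "HOL-Library.FuncSet"
    "HOL-Computational_Algebra.Polynomial"
    "HOL-Computational_Algebra.Fraction_Field"
    "HOL-Algebra.Module"
    "HOL-Algebra.QuotRing"
begin

section \<open>The ground field \<open>\<complex>(q)\<close>\<close>

type_synonym cq = "complex poly fract"

definition cq_of :: "complex \<Rightarrow> cq" where
  "cq_of c = Fract [:c:] 1"

definition qvar :: cq where
  "qvar = Fract [:0, 1:] 1"

definition Cq :: "cq ring" where
  "Cq = \<lparr>carrier = UNIV, mult = (*), one = 1, zero = 0, add = (+)\<rparr>"

definition qint :: "cq \<Rightarrow> nat \<Rightarrow> cq" where
  "qint a n = (a ^ n - inverse a ^ n) / (a - inverse a)"

definition qfact :: "cq \<Rightarrow> nat \<Rightarrow> cq" where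
  "qfact a n = (\<Prod>m = 1..n. qint a m)"

definition qbinom :: "cq \<Rightarrow> nat \<Rightarrow> nat \<Rightarrow> cq" where
  "qbinom a m r = qfact a m / (qfact a (m - r) * qfact a r)"


section \<open>Commutative factors and \<open>(\<Gamma>, \<omega>)\<close>-algebras\<close>

definition commutative_factor :: "('g::ab_group_add \<Rightarrow> 'g \<Rightarrow> complex) \<Rightarrow> bool" where
  "commutative_factor \<omega> \<longleftrightarrow>
     (\<forall>\<alpha> \<beta>. \<omega> \<alpha> \<beta> \<noteq> 0) \<and>
     (\<forall>\<alpha> \<beta>. \<omega> \<alpha> \<beta> = inverse (\<omega> \<beta> \<alpha>)) \<and>
     (\<forall>\<alpha> \<beta> \<gamma>. \<omega> (\<alpha> + \<beta>) \<gamma> = \<omega> \<alpha> \<gamma> * \<omega> \<beta> \<gamma>) \<and>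
     (\<forall>\<alpha> \<beta> \<gamma>. \<omega> \<alpha> (\<beta> + \<gamma>) = \<omega> \<alpha> \<beta> * \<omega> \<alpha> \<gamma>)"

record ('a, 'g) graded_algebra = "(cq, 'a) module" +
  hom_part :: "'g \<Rightarrow> 'a set"

text \<open>
  \<open>hom_decomp H x f\<close>: \<open>f\<close> is a decomposition of \<open>x\<close> as a (finite) sum of homogeneous elements,
  \<open>f \<gamma>\<close> having degree \<open>\<gamma>\<close>.
\<close>

definition hom_decomp :: "('a, 'g) graded_algebra \<Rightarrow> 'a \<Rightarrow> ('g \<Rightarrow> 'a) \<Rightarrow> bool" where
  "hom_decomp H x f \<longleftrightarrow>
     (\<forall>\<gamma>. f \<gamma> \<in> hom_part H \<gamma>) \<and>
     finite {\<gamma>. f \<gamma> \<noteq> \<zero>\<^bsub>H\<^esub>} \<and>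
     x = (\<Oplus>\<^bsub>H\<^esub>\<gamma> \<in> {\<gamma>. f \<gamma> \<noteq> \<zero>\<^bsub>H\<^esub>}. f \<gamma>)"

definition hom_comp :: "('a, 'g) graded_algebra \<Rightarrow> 'a \<Rightarrow> 'g \<Rightarrow> 'a" where
  "hom_comp H x = (THE f. hom_decomp H x f)"

definition hom_supp :: "('a, 'g) graded_algebra \<Rightarrow> 'a \<Rightarrow> 'g set" where
  "hom_supp H x = {\<gamma>. hom_comp H x \<gamma> \<noteq> \<zero>\<^bsub>H\<^esub>}"

text \<open>
  A \<open>(\<Gamma>, \<omega>)\<close>-algebra is a \<open>\<Gamma>\<close>-graded unital associative algebra; the commutative factor
  only enters the tensor product and the antipode.
  (The locale \<^locale>\<open>algebra\<close> of the library asks for commutativity.)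
\<close>

locale gamma_algebra = module Cq H + ring H
  for H :: "('a, 'g::ab_group_add) graded_algebra" (structure) +
  assumes smult_mult_left:
      "x \<in> carrier H \<Longrightarrow> y \<in> carrier H \<Longrightarrow> (c \<odot> x) \<otimes> y = c \<odot> (x \<otimes> y)"
    and smult_mult_right:
      "x \<in> carrier H \<Longrightarrow> y \<in> carrier H \<Longrightarrow> x \<otimes> (c \<odot> y) = c \<odot> (x \<otimes> y)"
    and hom_part_submodule: "submodule (hom_part H \<gamma>) Cq H"
    and one_hom_part: "\<one> \<in> hom_part H 0"
    and mult_hom_part:
      "x \<in> hom_part H \<alpha> \<Longrightarrow> y \<in> hom_part H \<beta> \<Longrightarrow> x \<otimes> y \<in> hom_part H (\<alpha> + \<beta>)"
    and direct_sum: "x \<in> carrier H \<Longrightarrow> \<exists>!f. hom_decomp H x f"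

text \<open>Linear maps, resp. algebra homomorphisms, of degree \<open>0\<close>.\<close>

definition gamma_linear ::
  "('a, 'g) graded_algebra \<Rightarrow> ('b, 'g) graded_algebra \<Rightarrow> ('a \<Rightarrow> 'b) \<Rightarrow> bool" where
  "gamma_linear H P f \<longleftrightarrow>
     f \<in> carrier H \<rightarrow> carrier P \<and>
     (\<forall>x \<in> carrier H. \<forall>y \<in> carrier H. f (x \<oplus>\<^bsub>H\<^esub> y) = f x \<oplus>\<^bsub>P\<^esub> f y) \<and>
     (\<forall>c. \<forall>x \<in> carrier H. f (c \<odot>\<^bsub>H\<^esub> x) = c \<odot>\<^bsub>P\<^esub> f x) \<and>
     (\<forall>\<gamma>. \<forall>x \<in> hom_part H \<gamma>. f x \<in> hom_part P \<gamma>)"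

definition gamma_hom ::
  "('a, 'g) graded_algebra \<Rightarrow> ('b, 'g) graded_algebra \<Rightarrow> ('a \<Rightarrow> 'b) \<Rightarrow> bool" where
  "gamma_hom H P f \<longleftrightarrow>
     gamma_linear H P f \<and>
     (\<forall>x \<in> carrier H. \<forall>y \<in> carrier H. f (x \<otimes>\<^bsub>H\<^esub> y) = f x \<otimes>\<^bsub>P\<^esub> f y) \<and>
     f \<one>\<^bsub>H\<^esub> = \<one>\<^bsub>P\<^esub>"

definition Cq_alg :: "(cq, 'g::ab_group_add) graded_algebra" where
  "Cq_alg = \<lparr>carrier = UNIV, mult = (*), one = 1, zero = 0, add = (+), smult = (*),
     hom_part = (\<lambda>\<gamma>. if \<gamma> = 0 then UNIV else {0})\<rparr>"


section \<open>Tensor products\<close>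

text \<open>
  \<open>M \<otimes> N\<close> is the vector space of formal linear combinations of pairs in
  \<open>carrier M \<times> carrier N\<close>, modulo the subspace \<open>tensor_null M N\<close> spanned by the bilinearity
  relations. The relations are given with an arbitrary coefficient \<open>c\<close>, so that closure
  under addition suffices. Elements of \<open>M \<otimes> N\<close> are the cosets.
\<close>

definition tensor_free ::
  "('a, 'g) graded_algebra \<Rightarrow> ('b, 'g) graded_algebra \<Rightarrow> ('a \<times> 'b \<Rightarrow>\<^sub>0 cq) set" where
  "tensor_free M N = {p. Poly_Mapping.keys p \<subseteq> carrier M \<times> carrier N}"

inductive_set tensor_null ::
  "('a, 'g) graded_algebra \<Rightarrow> ('b, 'g) graded_algebra \<Rightarrow> ('a \<times> 'b \<Rightarrow>\<^sub>0 cq) set"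
  for M N where
  zero: "0 \<in> tensor_null M N"
| add: "p \<in> tensor_null M N \<Longrightarrow> p' \<in> tensor_null M N \<Longrightarrow> p + p' \<in> tensor_null M N"
| add_left: "x \<in> carrier M \<Longrightarrow> x' \<in> carrier M \<Longrightarrow> y \<in> carrier N \<Longrightarrow>
    Poly_Mapping.single (x \<oplus>\<^bsub>M\<^esub> x', y) c - Poly_Mapping.single (x, y) c
      - Poly_Mapping.single (x', y) c \<in> tensor_null M N"
| add_right: "x \<in> carrier M \<Longrightarrow> y \<in> carrier N \<Longrightarrow> y' \<in> carrier N \<Longrightarrow>
    Poly_Mapping.single (x, y \<oplus>\<^bsub>N\<^esub> y') c - Poly_Mapping.single (x, y) c
      - Poly_Mapping.single (x, y') c \<in> tensor_null M N"
| smult_left: "x \<in> carrier M \<Longrightarrow> y \<in> carrier N \<Longrightarrow>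
    Poly_Mapping.single (s \<odot>\<^bsub>M\<^esub> x, y) c - Poly_Mapping.single (x, y) (s * c) \<in> tensor_null M N"
| smult_right: "x \<in> carrier M \<Longrightarrow> y \<in> carrier N \<Longrightarrow>
    Poly_Mapping.single (x, s \<odot>\<^bsub>N\<^esub> y) c - Poly_Mapping.single (x, y) (s * c) \<in> tensor_null M N"

definition tensor_class ::
  "('a, 'g) graded_algebra \<Rightarrow> ('b, 'g) graded_algebra \<Rightarrow> ('a \<times> 'b \<Rightarrow>\<^sub>0 cq) \<Rightarrow>
   ('a \<times> 'b \<Rightarrow>\<^sub>0 cq) set" where
  "tensor_class M N p = (\<lambda>n. p + n) ` tensor_null M N"

definition tensor_rep :: "('a \<times> 'b \<Rightarrow>\<^sub>0 cq) set \<Rightarrow> ('a \<times> 'b \<Rightarrow>\<^sub>0 cq)" where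
  "tensor_rep X = (SOME p. p \<in> X)"

definition pure_tensor ::
  "('a, 'g) graded_algebra \<Rightarrow> ('b, 'g) graded_algebra \<Rightarrow> 'a \<Rightarrow> 'b \<Rightarrow> ('a \<times> 'b \<Rightarrow>\<^sub>0 cq) set" where
  "pure_tensor M N x y = tensor_class M N (Poly_Mapping.single (x, y) 1)"

text \<open>
  The multiplication is the bilinear one determined by
  \<open>(a \<otimes> b) (c \<otimes> d) = \<omega>(deg b, deg c) ac \<otimes> bd\<close> for \<open>b\<close>, \<open>c\<close> homogeneous: for arbitrary \<open>b\<close>, \<open>c\<close>
  with homogeneous components \<open>b\<^sub>\<beta>\<close>, \<open>c\<^sub>\<gamma>\<close> the right hand side is
  \<open>\<Sum>\<beta> \<gamma>. \<omega>(\<beta>, \<gamma>) ac\<^sub>\<gamma> \<otimes> b\<^sub>\<beta>d\<close>.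
\<close>

definition tensor_mult ::
  "('g \<Rightarrow> 'g \<Rightarrow> complex) \<Rightarrow> ('a, 'g) graded_algebra \<Rightarrow> ('b, 'g) graded_algebra \<Rightarrow>
   ('a \<times> 'b \<Rightarrow>\<^sub>0 cq) set \<Rightarrow> ('a \<times> 'b \<Rightarrow>\<^sub>0 cq) set \<Rightarrow> ('a \<times> 'b \<Rightarrow>\<^sub>0 cq) set" where
  "tensor_mult \<omega> M N X Y =
     (let p = tensor_rep X; p' = tensor_rep Y in
      tensor_class M N
        (\<Sum>(a, b) \<in> Poly_Mapping.keys p. \<Sum>(c, d) \<in> Poly_Mapping.keys p'.
          \<Sum>\<beta> \<in> hom_supp N b. \<Sum>\<gamma> \<in> hom_supp M c.
            Poly_Mapping.single (a \<otimes>\<^bsub>M\<^esub> hom_comp M c \<gamma>, hom_comp N b \<beta> \<otimes>\<^bsub>N\<^esub> d)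
              (Poly_Mapping.lookup p (a, b) * Poly_Mapping.lookup p' (c, d) * cq_of (\<omega> \<beta> \<gamma>))))"

definition tensor_alg ::
  "('g::ab_group_add \<Rightarrow> 'g \<Rightarrow> complex) \<Rightarrow>
   ('a, 'g) graded_algebra \<Rightarrow> ('b, 'g) graded_algebra \<Rightarrow>
   (('a \<times> 'b \<Rightarrow>\<^sub>0 cq) set, 'g) graded_algebra" where
  "tensor_alg \<omega> M N =
    \<lparr>carrier = tensor_class M N ` tensor_free M N,
     mult = tensor_mult \<omega> M N,
     one = pure_tensor M N \<one>\<^bsub>M\<^esub> \<one>\<^bsub>N\<^esub>,
     zero = tensor_class M N 0,
     add = (\<lambda>X Y. tensor_class M N (tensor_rep X + tensor_rep Y)),
     smult = (\<lambda>c X. tensor_class M N (Poly_Mapping.map ((*) c) (tensor_rep X))),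
     hom_part = (\<lambda>\<gamma>. tensor_class M N `
       {p. \<forall>(x, y) \<in> Poly_Mapping.keys p.
             \<exists>\<alpha> \<beta>. x \<in> hom_part M \<alpha> \<and> y \<in> hom_part N \<beta> \<and> \<alpha> + \<beta> = \<gamma>})\<rparr>"

text \<open>The linear map \<open>M \<otimes> N \<rightarrow> P\<close> induced by a bilinear map \<open>B\<close>.\<close>

definition tensor_lift ::
  "('c, 'g) graded_algebra \<Rightarrow> ('a \<Rightarrow> 'b \<Rightarrow> 'c) \<Rightarrow> ('a \<times> 'b \<Rightarrow>\<^sub>0 cq) set \<Rightarrow> 'c" where
  "tensor_lift P B X =
     (let p = tensor_rep X in
      \<Oplus>\<^bsub>P\<^esub>z \<in> Poly_Mapping.keys p. Poly_Mapping.lookup p z \<odot>\<^bsub>P\<^esub> B (fst z) (snd z))"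

text \<open>
  \<open>f \<otimes> g\<close>, with values in \<open>P \<otimes> P'\<close>. No sign occurs since only maps of degree \<open>0\<close> are used.
\<close>

definition tensor_map ::
  "('g::ab_group_add \<Rightarrow> 'g \<Rightarrow> complex) \<Rightarrow>
   ('c, 'g) graded_algebra \<Rightarrow> ('d, 'g) graded_algebra \<Rightarrow> ('a \<Rightarrow> 'c) \<Rightarrow> ('b \<Rightarrow> 'd) \<Rightarrow>
   ('a \<times> 'b \<Rightarrow>\<^sub>0 cq) set \<Rightarrow> ('c \<times> 'd \<Rightarrow>\<^sub>0 cq) set" where
  "tensor_map \<omega> P P' f g =
     tensor_lift (tensor_alg \<omega> P P') (\<lambda>x y. pure_tensor P P' (f x) (g y))"

text \<open>The canonical map \<open>(M \<otimes> N) \<otimes> P \<rightarrow> M \<otimes> (N \<otimes> P)\<close>.\<close>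

definition tensor_assoc ::
  "('g::ab_group_add \<Rightarrow> 'g \<Rightarrow> complex) \<Rightarrow>
   ('a, 'g) graded_algebra \<Rightarrow> ('b, 'g) graded_algebra \<Rightarrow> ('c, 'g) graded_algebra \<Rightarrow>
   (('a \<times> 'b \<Rightarrow>\<^sub>0 cq) set \<times> 'c \<Rightarrow>\<^sub>0 cq) set \<Rightarrow> ('a \<times> ('b \<times> 'c \<Rightarrow>\<^sub>0 cq) set \<Rightarrow>\<^sub>0 cq) set" where
  "tensor_assoc \<omega> M N P =
     (let NP = tensor_alg \<omega> N P; T = tensor_alg \<omega> M NP in
      tensor_lift T (\<lambda>X z. tensor_lift T (\<lambda>x y. pure_tensor M NP x (pure_tensor N P y z)) X))"


section \<open>Hopf \<open>(\<Gamma>, \<omega>)\<close>-algebras\<close>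

locale hopf_gamma_algebra = gamma_algebra H
  for \<omega> :: "'g::ab_group_add \<Rightarrow> 'g \<Rightarrow> complex"
    and H :: "('a, 'g) graded_algebra" (structure)
    and \<Delta> :: "'a \<Rightarrow> ('a \<times> 'a \<Rightarrow>\<^sub>0 cq) set"
    and \<epsilon> :: "'a \<Rightarrow> cq"
    and S :: "'a \<Rightarrow> 'a" +
  assumes comult_hom: "gamma_hom H (tensor_alg \<omega> H H) \<Delta>"
    and coassoc: "x \<in> carrier H \<Longrightarrow>
      tensor_assoc \<omega> H H H (tensor_map \<omega> (tensor_alg \<omega> H H) H \<Delta> id (\<Delta> x))
        = tensor_map \<omega> H (tensor_alg \<omega> H H) id \<Delta> (\<Delta> x)"
    and counit_hom: "gamma_hom H Cq_alg \<epsilon>"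
    and counit_left: "x \<in> carrier H \<Longrightarrow>
      tensor_lift H (\<lambda>c y. c \<odot> y) (tensor_map \<omega> Cq_alg H \<epsilon> id (\<Delta> x)) = x"
    and counit_right: "x \<in> carrier H \<Longrightarrow>
      tensor_lift H (\<lambda>y c. c \<odot> y) (tensor_map \<omega> H Cq_alg id \<epsilon> (\<Delta> x)) = x"
    and antipode_linear: "gamma_linear H H S"
    and antipode_mult: "x \<in> hom_part H \<alpha> \<Longrightarrow> y \<in> hom_part H \<beta> \<Longrightarrow>
      S (x \<otimes> y) = cq_of (\<omega> \<alpha> \<beta>) \<odot> (S y \<otimes> S x)"
    and antipode_left: "x \<in> carrier H \<Longrightarrow>
      tensor_lift H (\<lambda>y z. y \<otimes> z) (tensor_map \<omega> H H S id (\<Delta> x)) = \<epsilon> x \<odot> \<one>"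
    and antipode_right: "x \<in> carrier H \<Longrightarrow>
      tensor_lift H (\<lambda>y z. y \<otimes> z) (tensor_map \<omega> H H id S (\<Delta> x)) = \<epsilon> x \<odot> \<one>"


section \<open>Cartan matrices\<close>

definition gen_cartan_matrix :: "nat set \<Rightarrow> (nat \<Rightarrow> nat \<Rightarrow> int) \<Rightarrow> bool" where
  "gen_cartan_matrix I A \<longleftrightarrow>
     (\<forall>i \<in> I. A i i = 2) \<and>
     (\<forall>i \<in> I. \<forall>j \<in> I. i \<noteq> j \<longrightarrow> A i j \<le> 0) \<and>
     (\<forall>i \<in> I. \<forall>j \<in> I. A i j = 0 \<longrightarrow> A j i = 0)"

definition symmetrizes :: "nat set \<Rightarrow> (nat \<Rightarrow> nat \<Rightarrow> int) \<Rightarrow> (nat \<Rightarrow> nat) \<Rightarrow> bool" where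
  "symmetrizes I A b \<longleftrightarrow>
     (\<forall>i \<in> I. b i > 0) \<and> (\<forall>i \<in> I. \<forall>j \<in> I. int (b i) * A i j = int (b j) * A j i)"

text \<open>Finite type: some symmetrization \<open>(b\<^sub>iA\<^sub>i\<^sub>j)\<close> is positive definite.\<close>

definition cartan_matrix_finite :: "nat set \<Rightarrow> (nat \<Rightarrow> nat \<Rightarrow> int) \<Rightarrow> bool" where
  "cartan_matrix_finite I A \<longleftrightarrow>
     finite I \<and> gen_cartan_matrix I A \<and>
     (\<exists>b. symmetrizes I A b \<and>
       (\<forall>x :: nat \<Rightarrow> real. (\<exists>i \<in> I. x i \<noteq> 0) \<longrightarrow>
         (\<Sum>i\<in>I. \<Sum>j\<in>I. real (b i) * of_int (A i j) * x i * x j) > 0))"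

definition indecomposable :: "nat set \<Rightarrow> (nat \<Rightarrow> nat \<Rightarrow> int) \<Rightarrow> bool" where
  "indecomposable I A \<longleftrightarrow>
     I \<noteq> {} \<and> (\<forall>J. J \<noteq> {} \<and> J \<subset> I \<longrightarrow> (\<exists>i \<in> J. \<exists>j \<in> I - J. A i j \<noteq> 0))"

text \<open>
  The root system of a Cartan matrix of finite type: the orbit of the simple roots under the
  Weyl group. A root is given by its coordinates with respect to the simple roots; the simple
  reflections are \<open>s\<^sub>i \<beta> = \<beta> - \<langle>\<beta>, \<Upsilon>\<^sub>i\<^sup>\<or>\<rangle>\<Upsilon>\<^sub>i\<close>, with \<open>\<langle>\<Upsilon>\<^sub>j, \<Upsilon>\<^sub>i\<^sup>\<or>\<rangle> = A\<^sub>i\<^sub>j\<close>.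
\<close>

inductive_set roots :: "nat set \<Rightarrow> (nat \<Rightarrow> nat \<Rightarrow> int) \<Rightarrow> (nat \<Rightarrow> int) set"
  for I A where
  simple: "i \<in> I \<Longrightarrow> (\<lambda>j. if j = i then 1 else 0) \<in> roots I A"
| reflect: "\<beta> \<in> roots I A \<Longrightarrow> i \<in> I \<Longrightarrow> \<beta>(i := \<beta> i - (\<Sum>j\<in>I. A i j * \<beta> j)) \<in> roots I A"

definition highest_root :: "nat set \<Rightarrow> (nat \<Rightarrow> nat \<Rightarrow> int) \<Rightarrow> (nat \<Rightarrow> int) \<Rightarrow> bool" where
  "highest_root I A \<theta> \<longleftrightarrow> \<theta> \<in> roots I A \<and> (\<forall>\<beta> \<in> roots I A. \<forall>i. \<beta> i \<le> \<theta> i)"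

text \<open>
  The untwisted affine matrix on \<open>{0..l}\<close>: the matrix \<open>A\<^sub>i\<^sub>j = 2(\<alpha>\<^sub>i, \<alpha>\<^sub>j)/(\<alpha>\<^sub>i, \<alpha>\<^sub>i)\<close> obtained from
  an indecomposable matrix of finite type on \<open>{1..l}\<close> by adjoining \<open>\<alpha>\<^sub>0 = -\<theta>\<close>, where
  \<open>\<theta> = \<Sum>i. k\<^sub>i\<Upsilon>\<^sub>i\<close> is the highest root and \<open>2(\<Upsilon>\<^sub>i, \<Upsilon>\<^sub>j) = b\<^sub>iA\<^sub>i\<^sub>j\<close> (\<open>b\<close> is unique up to a factor).
  The last clause is \<open>A\<^sub>0\<^sub>j (\<theta>, \<theta>) = -2(\<theta>, \<Upsilon>\<^sub>j)\<close>.
\<close>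

definition cartan_matrix_untwisted_affine ::
  "nat \<Rightarrow> (nat \<Rightarrow> nat \<Rightarrow> int) \<Rightarrow> (nat \<Rightarrow> int) \<Rightarrow> bool" where
  "cartan_matrix_untwisted_affine l A k \<longleftrightarrow>
     cartan_matrix_finite {1..l} A \<and> indecomposable {1..l} A \<and> highest_root {1..l} A k \<and>
     gen_cartan_matrix {0..l} A \<and>
     (\<forall>i \<in> {1..l}. A i 0 = - (\<Sum>j=1..l. A i j * k j)) \<and>
     (\<exists>b. symmetrizes {1..l} A b \<and>
       (\<forall>j \<in> {1..l}.
         A 0 j * (\<Sum>i=1..l. \<Sum>m=1..l. int (b i) * A i m * k i * k m)
           = - 2 * (\<Sum>i=1..l. int (b i) * A i j * k i)))"

text \<open>
  The smallest positive even integers symmetrizing \<open>A\<close>; a componentwise minimum exists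
  since the solutions are, on each indecomposable block, the multiples of a single one.
\<close>

definition least_even_symmetrizer ::
  "nat set \<Rightarrow> (nat \<Rightarrow> nat \<Rightarrow> int) \<Rightarrow> (nat \<Rightarrow> nat) \<Rightarrow> bool" where
  "least_even_symmetrizer I A d \<longleftrightarrow>
     symmetrizes I A d \<and> (\<forall>i \<in> I. even (d i)) \<and>
     (\<forall>d'. symmetrizes I A d' \<and> (\<forall>i \<in> I. even (d' i)) \<longrightarrow> (\<forall>i \<in> I. d i \<le> d' i))"


section \<open>Free algebras and presentations\<close>

datatype 'x fword = FWord (letters: "'x list")

instantiation fword :: (type) monoid_add
begin

definition zero_fword :: "'a fword" where
  "0 = FWord []"

definition plus_fword :: "'a fword \<Rightarrow> 'a fword \<Rightarrow> 'a fword" where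
  "u + v = FWord (letters u @ letters v)"

instance
  by standard (simp_all add: zero_fword_def plus_fword_def)

end

text \<open>
  The free algebra on the letters in \<open>X\<close> as monoid algebra of the free monoid, so that
  \<^typ>\<open>'x fword \<Rightarrow>\<^sub>0 cq\<close> is a \<^class>\<open>ring_1\<close> under convolution. The letter \<open>x\<close> has degree \<open>deg x\<close>.
\<close>

type_synonym 'x free = "'x fword \<Rightarrow>\<^sub>0 cq"

definition scal :: "cq \<Rightarrow> 'x free" where
  "scal c = Poly_Mapping.single 0 c"

definition letter :: "'x \<Rightarrow> 'x free" where
  "letter x = Poly_Mapping.single (FWord [x]) 1"

definition free_carrier :: "'x set \<Rightarrow> 'x free set" where
  "free_carrier X = {p. \<forall>w \<in> Poly_Mapping.keys p. set (letters w) \<subseteq> X}"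

definition free_algebra :: "'x set \<Rightarrow> ('x \<Rightarrow> 'g::ab_group_add) \<Rightarrow> ('x free, 'g) graded_algebra" where
  "free_algebra X deg =
    \<lparr>carrier = free_carrier X, mult = (*), one = 1, zero = 0, add = (+),
     smult = (\<lambda>c p. scal c * p),
     hom_part = (\<lambda>\<gamma>. {p \<in> free_carrier X.
       \<forall>w \<in> Poly_Mapping.keys p. sum_list (map deg (letters w)) = \<gamma>})\<rparr>"

text \<open>The quotient by a two-sided ideal generated by homogeneous elements.\<close>

definition quot_algebra ::
  "('a, 'g) graded_algebra \<Rightarrow> 'a set \<Rightarrow> ('a set, 'g) graded_algebra" where
  "quot_algebra H J =
    \<lparr>carrier = carrier (H Quot J), mult = mult (H Quot J), one = one (H Quot J),
     zero = zero (H Quot J), add = add (H Quot J),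
     smult = (\<lambda>c X. \<Union>x\<in>X. J +>\<^bsub>H\<^esub> (c \<odot>\<^bsub>H\<^esub> x)),
     hom_part = (\<lambda>\<gamma>. (\<lambda>x. J +>\<^bsub>H\<^esub> x) ` hom_part H \<gamma>)\<rparr>"


section \<open>The algebra \<open>U\<^sub>q\<^sub>,\<^sub>\<Xi>(A)\<close>\<close>

datatype uq_gen = GenE nat | GenF nat | GenK nat | GenKinv nat

definition uq_gens :: "nat set \<Rightarrow> uq_gen set" where
  "uq_gens I = GenE ` I \<union> GenF ` I \<union> GenK ` I \<union> GenKinv ` I"

fun uq_deg :: "(nat \<Rightarrow> 'g::ab_group_add) \<Rightarrow> uq_gen \<Rightarrow> 'g" where
  "uq_deg \<xi> (GenE i) = \<xi> i"
| "uq_deg \<xi> (GenF i) = - \<xi> i"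
| "uq_deg \<xi> (GenK i) = 0"
| "uq_deg \<xi> (GenKinv i) = 0"

definition q_sub :: "(nat \<Rightarrow> nat) \<Rightarrow> nat \<Rightarrow> cq" where
  "q_sub d i = qvar ^ (d i div 2)"

definition serre ::
  "('g \<Rightarrow> 'g \<Rightarrow> complex) \<Rightarrow> (nat \<Rightarrow> 'g) \<Rightarrow> (nat \<Rightarrow> nat) \<Rightarrow> (nat \<Rightarrow> nat \<Rightarrow> int) \<Rightarrow>
   (nat \<Rightarrow> uq_gen) \<Rightarrow> nat \<Rightarrow> nat \<Rightarrow> uq_gen free" where
  "serre \<omega> \<xi> d A g i j =
     (let m = nat (1 - A i j) in
      \<Sum>r = 0..m. scal (cq_of ((- \<omega> (\<xi> i) (\<xi> j)) ^ r) * qbinom (q_sub d i) m r)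
        * letter (g i) ^ (m - r) * letter (g j) * letter (g i) ^ r)"

text \<open>Each defining relation \<open>a = b\<close> is recorded as the element \<open>a - b\<close>.\<close>

definition uq_relations ::
  "('g \<Rightarrow> 'g \<Rightarrow> complex) \<Rightarrow> (nat \<Rightarrow> 'g) \<Rightarrow> nat set \<Rightarrow> (nat \<Rightarrow> nat) \<Rightarrow> (nat \<Rightarrow> nat \<Rightarrow> int) \<Rightarrow>
   uq_gen free set" where
  "uq_relations \<omega> \<xi> I d A =
     (let e = (\<lambda>i. letter (GenE i)); f = (\<lambda>i. letter (GenF i));
          k = (\<lambda>i. letter (GenK i)); k' = (\<lambda>i. letter (GenKinv i)) in
      {k i * k j - k j * k i | i j. i \<in> I \<and> j \<in> I} \<union>
      {k i * k' i - 1 | i. i \<in> I} \<union>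
      {k' i * k i - 1 | i. i \<in> I} \<union>
      {k i * e j * k' i - scal (q_sub d i powi A i j) * e j | i j. i \<in> I \<and> j \<in> I} \<union>
      {k i * f j * k' i - scal (q_sub d i powi (- A i j)) * f j | i j. i \<in> I \<and> j \<in> I} \<union>
      {e i * f j - scal (cq_of (\<omega> (\<xi> j) (\<xi> i))) * f j * e i
         - (if i = j
            then scal (inverse (q_sub d i - inverse (q_sub d i))) * (k i - k' i) else 0)
         | i j. i \<in> I \<and> j \<in> I} \<union>
      {serre \<omega> \<xi> d A GenE i j | i j. i \<in> I \<and> j \<in> I \<and> i \<noteq> j} \<union>
      {serre \<omega> \<xi> d A GenF i j | i j. i \<in> I \<and> j \<in> I \<and> i \<noteq> j})"

definition uq_ideal ::
  "('g::ab_group_add \<Rightarrow> 'g \<Rightarrow> complex) \<Rightarrow> (nat \<Rightarrow> 'g) \<Rightarrow> nat set \<Rightarrow> (nat \<Rightarrow> nat) \<Rightarrow>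
   (nat \<Rightarrow> nat \<Rightarrow> int) \<Rightarrow> uq_gen free set" where
  "uq_ideal \<omega> \<xi> I d A =
     Idl\<^bsub>free_algebra (uq_gens I) (uq_deg \<xi>)\<^esub> (uq_relations \<omega> \<xi> I d A)"

definition Uq ::
  "('g::ab_group_add \<Rightarrow> 'g \<Rightarrow> complex) \<Rightarrow> (nat \<Rightarrow> 'g) \<Rightarrow> nat set \<Rightarrow> (nat \<Rightarrow> nat) \<Rightarrow>
   (nat \<Rightarrow> nat \<Rightarrow> int) \<Rightarrow> (uq_gen free set, 'g) graded_algebra" where
  "Uq \<omega> \<xi> I d A =
     quot_algebra (free_algebra (uq_gens I) (uq_deg \<xi>)) (uq_ideal \<omega> \<xi> I d A)"

text \<open>The image in \<open>U\<^sub>q\<^sub>,\<^sub>\<Xi>(A)\<close> of a generator.\<close>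

definition uq_elem ::
  "('g::ab_group_add \<Rightarrow> 'g \<Rightarrow> complex) \<Rightarrow> (nat \<Rightarrow> 'g) \<Rightarrow> nat set \<Rightarrow> (nat \<Rightarrow> nat) \<Rightarrow>
   (nat \<Rightarrow> nat \<Rightarrow> int) \<Rightarrow> uq_gen \<Rightarrow> uq_gen free set" where
  "uq_elem \<omega> \<xi> I d A g =
     uq_ideal \<omega> \<xi> I d A +>\<^bsub>free_algebra (uq_gens I) (uq_deg \<xi>)\<^esub> letter g"

end

theory Submission
  imports Defs
begin

text \<open>
  A homomorphism out of \<open>U\<^sub>q\<^sub>,\<^sub>\<Xi>(A)\<close> is given by images of the generators that satisfy the defining
  relations, so \<open>\<Delta>\<close>, \<open>\<epsilon>\<close> and \<open>S\<close> exist as soon as the proposed images do so in \<open>U \<otimes> U\<close>, in \<open>\<complex>(q)\<close> and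
  in the opposite algebra with product \<open>x \<circ> y = \<omega>(d(x), d(y)) y x\<close>, respectively. Only the Serre relations
  for \<open>\<Delta>\<close> require an idea. By the \<open>q\<close>-binomial theorem, the Serre element of \<open>x\<close> and \<open>u\<close> is obtained by
  applying to \<open>u\<close> the commuting operators \<open>L\<^sub>x - \<omega> p\<^sup>b R\<^sub>x\<close> with \<open>b = -A\<^sub>i\<^sub>j, -A\<^sub>i\<^sub>j - 2, \<dots>, A\<^sub>i\<^sub>j\<close>, where
  \<open>p = q\<^sub>i\<close> and \<open>\<omega> = \<omega>(\<xi>\<^sub>i, \<xi>\<^sub>j)\<close>. Write \<open>\<Delta>(e\<^sub>i) = x + y\<close> and \<open>\<Delta>(e\<^sub>j) = u + v\<close> with \<open>x\<close>, \<open>u\<close> the summands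
  \<open>e \<otimes> k\<close> and \<open>y\<close>, \<open>v\<close> the summands \<open>1 \<otimes> e\<close>. Applying the factors to \<open>u\<close> from the top exponent down, the
  contribution of \<open>y\<close> cancels in every step; applying them to \<open>v\<close> from the bottom exponent up, that of \<open>x\<close>
  does. Hence no mixed terms occur, and the Serre element of \<open>x + y\<close> and \<open>u + v\<close> is the sum of those of
  \<open>x\<close>, \<open>u\<close> and of \<open>y\<close>, \<open>v\<close>, which both vanish. Since \<open>\<Delta>\<close>, \<open>\<epsilon>\<close> are homomorphisms and \<open>S\<close> is a twisted
  antihomomorphism, the Hopf axioms and uniqueness need to be checked on generators only.
\<close>

section \<open>Linear maps and homogeneous components\<close>

text \<open>Elements of a tensor product are classes, and its operations pick representatives and
  homogeneous components. Nothing can be computed before these operations are recognised as lifts of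
  multilinear maps, and the canonical maps between tensor products must be multiplicative before two
  sides of an axiom can be compared on generators. The summand \<open>e \<otimes> k\<close> of the
  comultiplication and the antipode value \<open>- e k'\<close> have the form \<open>e g\<close>, up
  to a scalar, where \<open>g\<close> commutes with the \<open>e\<close>'s up to scalars. All
  monomials of a Serre sum then collect the same scalar, so these Serre elements vanish along with
  that of the \<open>e\<close>'s. The opposite product reverses each monomial, and the symmetry of
  the quantum binomials restores the sum up to sign. The antipode identities do not compare
  homomorphisms: applying \<open>\<Delta>\<close>, then \<open>S \<otimes> id\<close>, then the
  product is not multiplicative. They pass to a product with a generator because the pair belonging
  to the generator stands inside and collapses to a scalar; the factor from \<open>\<omega>\<close>
  disappears since the counit vanishes in non-zero degrees.\<close>

lemma Cq_simps [simp]: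
  "carrier Cq = UNIV" "mult Cq = (*)" "one Cq = 1" "zero Cq = 0" "add Cq = (+)"
  by (simp_all add: Cq_def)

lemma cring_Cq: "cring Cq"
proof (rule cringI)
  show "abelian_group Cq"
  proof (rule abelian_groupI)
    fix x :: cq
    show "\<exists>y\<in>carrier Cq. y \<oplus>\<^bsub>Cq\<^esub> x = \<zero>\<^bsub>Cq\<^esub>" by (intro bexI[of _ "- x"]) auto
  qed auto
  show "comm_monoid Cq" by (rule comm_monoidI) auto
qed (auto simp: algebra_simps)

text \<open>The linear part is separated from \<open>gamma_algebra\<close> because a tensor product
  is known to be a module long before its multiplication is known to be associative or even
  bilinear.\<close>

locale cq_module = module Cq M for M :: "('a, 'g::ab_group_add) graded_algebra" (structure)
begin

lemma smult_add: "x \<in> carrier M \<Longrightarrow> (c + d) \<odot> x = c \<odot> x \<oplus> d \<odot> x"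
  using smult_l_distr[of c d x] by simp

lemma smult_smult: "x \<in> carrier M \<Longrightarrow> c \<odot> (d \<odot> x) = (c * d) \<odot> x"
  using smult_assoc1[of c d x] by simp

lemma smult_1 [simp]: "x \<in> carrier M \<Longrightarrow> 1 \<odot> x = x"
  using smult_one[of x] by simp

lemma smult_0 [simp]: "x \<in> carrier M \<Longrightarrow> 0 \<odot> x = \<zero>"
  using smult_l_null[of x] by simp

lemma smult_zero [simp]: "c \<odot> \<zero> = \<zero>"
  using smult_r_null[of c] by simp

lemma smult_minus_left: "x \<in> carrier M \<Longrightarrow> (- c) \<odot> x = \<ominus> (c \<odot> x)"
  by (metis (no_types) M.add.inv_closed M.minus_equality add.commute ab_left_minus smult_0 smult_add
      smult_closed Cq_simps(1) UNIV_I)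

lemma smult_minus_right: "x \<in> carrier M \<Longrightarrow> c \<odot> (\<ominus> x) = \<ominus> (c \<odot> x)"
  using smult_r_minus[of c x] by simp

lemma smult_minus_one: "x \<in> carrier M \<Longrightarrow> \<ominus> x = (- 1) \<odot> x"
  by (simp add: smult_minus_left)

lemma smult_add_right:
  "x \<in> carrier M \<Longrightarrow> y \<in> carrier M \<Longrightarrow> c \<odot> (x \<oplus> y) = c \<odot> x \<oplus> c \<odot> y"
  using smult_r_distr[of c x y] by simp

lemma diff_eq_zero_iff: "x \<in> carrier M \<Longrightarrow> y \<in> carrier M \<Longrightarrow> x \<ominus> y = \<zero> \<longleftrightarrow> x = y"
  by (metis M.add.inv_closed M.add.inv_solve_right M.l_zero M.zero_closed a_minus_def)

text \<open>Sums over the supports of different elements are compared by extending them to a common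
  finite index set.\<close>

lemma finsum_superset:
  assumes "finite B" "A \<subseteq> B" "\<And>x. x \<in> B - A \<Longrightarrow> f x = \<zero>" "f \<in> B \<rightarrow> carrier M"
  shows "finsum M f A = finsum M f B"
  using assms by (intro M.add.finprod_mono_neutral_cong_left) auto

lemma finsum_induct:
  assumes "finite A" "\<And>x. x \<in> A \<Longrightarrow> f x \<in> carrier M" "Q \<zero>"
    "\<And>x. x \<in> A \<Longrightarrow> Q (f x)"
    "\<And>x y. x \<in> carrier M \<Longrightarrow> y \<in> carrier M \<Longrightarrow> Q x \<Longrightarrow> Q y \<Longrightarrow> Q (x \<oplus> y)"
  shows "Q (finsum M f A)"
  using assms(1,2,4)
proof (induction A rule: finite_induct)
  case (insert a A)
  then have "f \<in> A \<rightarrow> carrier M" by auto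
  with insert assms(5) show ?case
    by (simp add: M.finsum_insert)
qed (simp add: assms(3))

end

text \<open>The degree condition of \<open>gamma_linear\<close> is dropped: multiplication by a
  fixed element and tensoring with a fixed element shift degrees, yet have to be treated as linear
  maps.\<close>

definition cq_linear ::
  "('a, 'g) graded_algebra \<Rightarrow> ('b, 'g) graded_algebra \<Rightarrow> ('a \<Rightarrow> 'b) \<Rightarrow> bool" where
  "cq_linear M P f \<longleftrightarrow>
     f \<in> carrier M \<rightarrow> carrier P \<and>
     (\<forall>x \<in> carrier M. \<forall>y \<in> carrier M. f (x \<oplus>\<^bsub>M\<^esub> y) = f x \<oplus>\<^bsub>P\<^esub> f y) \<and>
     (\<forall>c. \<forall>x \<in> carrier M. f (c \<odot>\<^bsub>M\<^esub> x) = c \<odot>\<^bsub>P\<^esub> f x)"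

lemma cq_linearI:
  assumes "\<And>x. x \<in> carrier M \<Longrightarrow> f x \<in> carrier P"
    "\<And>x y. x \<in> carrier M \<Longrightarrow> y \<in> carrier M \<Longrightarrow> f (x \<oplus>\<^bsub>M\<^esub> y) = f x \<oplus>\<^bsub>P\<^esub> f y"
    "\<And>c x. x \<in> carrier M \<Longrightarrow> f (c \<odot>\<^bsub>M\<^esub> x) = c \<odot>\<^bsub>P\<^esub> f x"
  shows "cq_linear M P f"
  using assms by (auto simp: cq_linear_def)

lemma
  assumes "cq_linear M P f"
  shows cq_linear_closed: "x \<in> carrier M \<Longrightarrow> f x \<in> carrier P"
    and cq_linear_add: "x \<in> carrier M \<Longrightarrow> y \<in> carrier M \<Longrightarrow> f (x \<oplus>\<^bsub>M\<^esub> y) = f x \<oplus>\<^bsub>P\<^esub> f y"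
    and cq_linear_smult: "x \<in> carrier M \<Longrightarrow> f (c \<odot>\<^bsub>M\<^esub> x) = c \<odot>\<^bsub>P\<^esub> f x"
  using assms by (auto simp: cq_linear_def)

lemma cq_linear_zero:
  assumes "cq_module M" "cq_module P" "cq_linear M P f"
  shows "f \<zero>\<^bsub>M\<^esub> = \<zero>\<^bsub>P\<^esub>"
proof -
  interpret M: cq_module M by fact
  interpret P: cq_module P by fact
  have "f (0 \<odot>\<^bsub>M\<^esub> \<zero>\<^bsub>M\<^esub>) = 0 \<odot>\<^bsub>P\<^esub> f \<zero>\<^bsub>M\<^esub>"
    using assms(3) by (intro cq_linear_smult) auto
  then show ?thesis
    using cq_linear_closed[OF assms(3) M.M.zero_closed] by simp
qed

lemma cq_linear_minus:
  assumes "cq_module M" "cq_module P" "cq_linear M P f" "x \<in> carrier M"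
  shows "f (\<ominus>\<^bsub>M\<^esub> x) = \<ominus>\<^bsub>P\<^esub> f x"
proof -
  interpret M: cq_module M by fact
  interpret P: cq_module P by fact
  show ?thesis
    using cq_linear_smult[OF assms(3,4)] cq_linear_closed[OF assms(3,4)] assms(4)
    by (simp add: M.smult_minus_one P.smult_minus_one)
qed

lemma cq_linear_diff:
  assumes "cq_module M" "cq_module P" "cq_linear M P f" "x \<in> carrier M" "y \<in> carrier M"
  shows "f (x \<ominus>\<^bsub>M\<^esub> y) = f x \<ominus>\<^bsub>P\<^esub> f y"
proof -
  interpret M: cq_module M by fact
  show ?thesis
    using assms by (simp add: a_minus_def cq_linear_add[OF assms(3)] cq_linear_minus[OF assms(1-3)])
qed

lemma cq_linear_finsum:
  assumes "cq_module M" "cq_module P" "cq_linear M P f" "finite A"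
    "\<And>x. x \<in> A \<Longrightarrow> g x \<in> carrier M"
  shows "f (finsum M g A) = finsum P (\<lambda>x. f (g x)) A"
proof -
  interpret M: cq_module M by fact
  interpret P: cq_module P by fact
  show ?thesis
    using assms(4,5)
  proof (induction A rule: finite_induct)
    case (insert a A)
    then have "g \<in> A \<rightarrow> carrier M" "(\<lambda>x. f (g x)) \<in> A \<rightarrow> carrier P"
      using cq_linear_closed[OF assms(3)] by auto
    with insert cq_linear_closed[OF assms(3)] show ?case
      by (simp add: M.M.finsum_insert P.M.finsum_insert cq_linear_add[OF assms(3)])
  qed (simp add: cq_linear_zero[OF assms(1-3)])
qed

lemma cq_linear_comp:
  "cq_linear M P f \<Longrightarrow> cq_linear P Q g \<Longrightarrow> cq_linear M Q (\<lambda>x. g (f x))"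
  by (auto simp: cq_linear_def Pi_iff)

lemma cq_linear_id: "cq_linear M M (\<lambda>x. x)"
  by (auto simp: cq_linear_def)

lemma gamma_linear_iff:
  "gamma_linear M P f \<longleftrightarrow> cq_linear M P f \<and> (\<forall>\<gamma>. \<forall>x \<in> hom_part M \<gamma>. f x \<in> hom_part P \<gamma>)"
  by (auto simp: gamma_linear_def cq_linear_def)

lemma gamma_homI:
  assumes "cq_linear M P f" "\<And>\<gamma> x. x \<in> hom_part M \<gamma> \<Longrightarrow> f x \<in> hom_part P \<gamma>"
    "\<And>x y. x \<in> carrier M \<Longrightarrow> y \<in> carrier M \<Longrightarrow> f (x \<otimes>\<^bsub>M\<^esub> y) = f x \<otimes>\<^bsub>P\<^esub> f y"
    "f \<one>\<^bsub>M\<^esub> = \<one>\<^bsub>P\<^esub>"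
  shows "gamma_hom M P f"
  using assms by (auto simp: gamma_hom_def gamma_linear_iff)

lemma
  assumes "gamma_hom M P f"
  shows gamma_hom_linear: "cq_linear M P f"
    and gamma_hom_closed: "x \<in> carrier M \<Longrightarrow> f x \<in> carrier P"
    and gamma_hom_add: "x \<in> carrier M \<Longrightarrow> y \<in> carrier M \<Longrightarrow> f (x \<oplus>\<^bsub>M\<^esub> y) = f x \<oplus>\<^bsub>P\<^esub> f y"
    and gamma_hom_smult: "x \<in> carrier M \<Longrightarrow> f (c \<odot>\<^bsub>M\<^esub> x) = c \<odot>\<^bsub>P\<^esub> f x"
    and gamma_hom_degree: "x \<in> hom_part M \<gamma> \<Longrightarrow> f x \<in> hom_part P \<gamma>"
    and gamma_hom_mult: "x \<in> carrier M \<Longrightarrow> y \<in> carrier M \<Longrightarrow> f (x \<otimes>\<^bsub>M\<^esub> y) = f x \<otimes>\<^bsub>P\<^esub> f y"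
    and gamma_hom_one: "f \<one>\<^bsub>M\<^esub> = \<one>\<^bsub>P\<^esub>"
  using assms by (auto simp: gamma_hom_def gamma_linear_iff cq_linear_def)

lemma gamma_hom_comp:
  assumes "gamma_hom M P f" "gamma_hom P Q g"
  shows "gamma_hom M Q (\<lambda>x. g (f x))"
  using assms by (auto simp: gamma_hom_def gamma_linear_def Pi_iff)

lemma gamma_hom_id: "gamma_hom M M id"
  by (auto simp: gamma_hom_def gamma_linear_def)

text \<open>Projections certify a grading. Applying \<open>\<pi> \<gamma>\<close> to any
  decomposition recovers its component of degree \<open>\<gamma>\<close>, hence uniqueness; the
  family of all \<open>\<pi> \<gamma> x\<close> is a decomposition because this holds for
  homogeneous elements and survives addition. The scalars, tensor products, quotients and free
  algebras all obtain their grading from this criterion.\<close>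

lemma (in cq_module) direct_sumI:
  assumes submod: "\<And>\<gamma>. submodule (hom_part M \<gamma>) Cq M"
    and gen: "\<And>Q x. x \<in> carrier M \<Longrightarrow> (\<And>\<gamma> y. y \<in> hom_part M \<gamma> \<Longrightarrow> Q y) \<Longrightarrow>
       (\<And>y z. y \<in> carrier M \<Longrightarrow> z \<in> carrier M \<Longrightarrow> Q y \<Longrightarrow> Q z \<Longrightarrow> Q (y \<oplus> z)) \<Longrightarrow> Q x"
    and proj: "\<And>\<gamma>. cq_linear M M (\<pi> \<gamma>)"
    and proj_same: "\<And>\<gamma> x. x \<in> hom_part M \<gamma> \<Longrightarrow> \<pi> \<gamma> x = x"
    and proj_other: "\<And>\<gamma> \<delta> x. x \<in> hom_part M \<delta> \<Longrightarrow> \<gamma> \<noteq> \<delta> \<Longrightarrow> \<pi> \<gamma> x = \<zero>"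
    and x: "x \<in> carrier M"
  shows "\<exists>!f. hom_decomp M x f"
proof
  have sub: "y \<in> carrier M" if "y \<in> hom_part M \<gamma>" for \<gamma> y
    using submoduleE(1)[OF submod[of \<gamma>]] that by auto
  have zero: "\<zero> \<in> hom_part M \<gamma>" for \<gamma>
    using submod[of \<gamma>] unfolding submodule_def by (metis subgroup.one_closed monoid.simps(2))
  have uniq: "f = (\<lambda>\<gamma>. \<pi> \<gamma> y)" if f: "hom_decomp M y f" for f y
  proof
    fix \<gamma>
    \<comment> \<open>The index \<open>\<gamma>\<close> is added to the support so that the
      projected sum collapses to a single term even if \<open>f \<gamma>\<close> vanishes.\<close>
    let ?S = "insert \<gamma> {\<gamma>. f \<gamma> \<noteq> \<zero>}"
    have fin: "finite ?S" and hp: "\<And>\<gamma>. f \<gamma> \<in> hom_part M \<gamma>" 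
      using f by (auto simp: hom_decomp_def)
    have "y = finsum M f {\<gamma>. f \<gamma> \<noteq> \<zero>}"
      using f by (auto simp: hom_decomp_def)
    also have "\<dots> = finsum M f ?S"
      using fin sub[OF hp] by (intro finsum_superset) auto
    finally have "\<pi> \<gamma> y = finsum M (\<lambda>\<delta>. \<pi> \<gamma> (f \<delta>)) ?S"
      using fin sub[OF hp] cq_linear_finsum[OF cq_module_axioms cq_module_axioms proj, of ?S f]
      by simp
    also have "\<dots> = finsum M (\<lambda>\<delta>. \<pi> \<gamma> (f \<delta>)) {\<gamma>}"
      by (rule finsum_superset[symmetric])
        (use fin proj_other[OF hp] cq_linear_closed[OF proj sub[OF hp]] in auto)
    also have "\<dots> = f \<gamma>"
      using proj_same[OF hp] sub[OF hp] by (simp add: M.finsum_insert)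
    finally show "f \<gamma> = \<pi> \<gamma> y" by simp
  qed
  have ex: "hom_decomp M x (\<lambda>\<gamma>. \<pi> \<gamma> x)"
  proof (rule gen[OF x])
    fix \<gamma> y assume y: "y \<in> hom_part M \<gamma>"
    show "hom_decomp M y (\<lambda>\<gamma>. \<pi> \<gamma> y)"
    \<comment> \<open>Zero is homogeneous of every degree and has empty support; only a non-zero
      \<open>y\<close> has the support \<open>{\<gamma>}\<close>.\<close>
    proof (cases "y = \<zero>")
      case True
      have "\<pi> \<delta> \<zero> = \<zero>" for \<delta> using proj_same[OF zero] .
      with True zero show ?thesis by (auto simp: hom_decomp_def)
    next
      case False
      have "{\<delta>. \<pi> \<delta> y \<noteq> \<zero>} = {\<gamma>}"
        using proj_other[OF y] proj_same[OF y] False by force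
      moreover have "\<pi> \<delta> y \<in> hom_part M \<delta>" for \<delta>
        using proj_other[OF y, of \<delta>] proj_same[OF y] zero y by (cases "\<gamma> = \<delta>") auto
      ultimately show ?thesis
        using proj_same[OF y] sub[OF y] by (simp add: hom_decomp_def M.finsum_insert)
    qed
  next
    fix y z assume yz: "y \<in> carrier M" "z \<in> carrier M"
      and y: "hom_decomp M y (\<lambda>\<gamma>. \<pi> \<gamma> y)" and z: "hom_decomp M z (\<lambda>\<gamma>. \<pi> \<gamma> z)"
    define S where "S = {\<delta>. \<pi> \<delta> y \<noteq> \<zero>} \<union> {\<delta>. \<pi> \<delta> z \<noteq> \<zero>}"
    have fin: "finite S" using y z by (auto simp: hom_decomp_def S_def)
    have c: "\<pi> \<delta> y \<in> carrier M" "\<pi> \<delta> z \<in> carrier M" for \<delta>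
      using yz cq_linear_closed[OF proj] by auto
    have pa: "\<pi> \<delta> (y \<oplus> z) = \<pi> \<delta> y \<oplus> \<pi> \<delta> z" for \<delta>
      using yz cq_linear_add[OF proj] by auto
    have "y = finsum M (\<lambda>\<delta>. \<pi> \<delta> y) S" "z = finsum M (\<lambda>\<delta>. \<pi> \<delta> z) S"
      using y z fin c unfolding hom_decomp_def
      by (auto simp: S_def intro!: finsum_superset elim!: trans)
    then have "y \<oplus> z = finsum M (\<lambda>\<delta>. \<pi> \<delta> y) S \<oplus> finsum M (\<lambda>\<delta>. \<pi> \<delta> z) S"
      by simp
    also have "\<dots> = finsum M (\<lambda>\<delta>. \<pi> \<delta> (y \<oplus> z)) S"
      using fin c by (simp add: pa M.finsum_addf)
    also have "\<dots> = finsum M (\<lambda>\<delta>. \<pi> \<delta> (y \<oplus> z)) {\<delta>. \<pi> \<delta> (y \<oplus> z) \<noteq> \<zero>}"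
      by (rule finsum_superset[symmetric]) (use fin c in \<open>auto simp: pa S_def\<close>)
    finally have "y \<oplus> z = finsum M (\<lambda>\<delta>. \<pi> \<delta> (y \<oplus> z)) {\<delta>. \<pi> \<delta> (y \<oplus> z) \<noteq> \<zero>}" .
    moreover have "finite {\<delta>. \<pi> \<delta> (y \<oplus> z) \<noteq> \<zero>}"
      by (rule finite_subset[OF _ fin]) (use c in \<open>auto simp: pa S_def\<close>)
    moreover have "\<pi> \<delta> (y \<oplus> z) \<in> hom_part M \<delta>" for \<delta>
      using y z submoduleE(5)[OF submod[of \<delta>]] by (auto simp: pa hom_decomp_def)
    ultimately show "hom_decomp M (y \<oplus> z) (\<lambda>\<gamma>. \<pi> \<gamma> (y \<oplus> z))"
      unfolding hom_decomp_def by blast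
  qed
  show "hom_decomp M x (\<lambda>\<gamma>. \<pi> \<gamma> x)" by fact
  show "f = (\<lambda>\<gamma>. \<pi> \<gamma> x)" if "hom_decomp M x f" for f
    using uniq[OF that] .
qed

section \<open>Homogeneous components in a graded algebra\<close>

context gamma_algebra
begin

sublocale cq_module H ..

lemma hom_carrier: "x \<in> hom_part H \<gamma> \<Longrightarrow> x \<in> carrier H"
  using submoduleE(1)[OF hom_part_submodule[of \<gamma>]] by auto

lemma hom_zero [simp]: "\<zero> \<in> hom_part H \<gamma>"
  using hom_part_submodule[of \<gamma>] unfolding submodule_def
  by (metis subgroup.one_closed monoid.simps(2))

lemma hom_add: "x \<in> hom_part H \<gamma> \<Longrightarrow> y \<in> hom_part H \<gamma> \<Longrightarrow> x \<oplus> y \<in> hom_part H \<gamma>"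
  using submoduleE(5)[OF hom_part_submodule] by blast

lemma hom_smult: "x \<in> hom_part H \<gamma> \<Longrightarrow> c \<odot> x \<in> hom_part H \<gamma>"
  using submoduleE(4)[OF hom_part_submodule, of c] by simp

lemma hom_uminus: "x \<in> hom_part H \<gamma> \<Longrightarrow> \<ominus> x \<in> hom_part H \<gamma>"
  using submoduleE(3)[OF hom_part_submodule] by blast

lemma hom_mult: "x \<in> hom_part H \<alpha> \<Longrightarrow> y \<in> hom_part H \<beta> \<Longrightarrow> \<alpha> + \<beta> = \<gamma> \<Longrightarrow> x \<otimes> y \<in> hom_part H \<gamma>"
  using mult_hom_part by blast

lemma hom_decomp_hom_comp: "x \<in> carrier H \<Longrightarrow> hom_decomp H x (hom_comp H x)"
  unfolding hom_comp_def by (rule theI'[OF direct_sum])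

lemma hom_comp_hom: "x \<in> carrier H \<Longrightarrow> hom_comp H x \<gamma> \<in> hom_part H \<gamma>"
  using hom_decomp_hom_comp by (auto simp: hom_decomp_def)

lemma hom_comp_closed [simp]: "x \<in> carrier H \<Longrightarrow> hom_comp H x \<gamma> \<in> carrier H"
  using hom_comp_hom hom_carrier by blast

lemma finite_hom_supp [simp]: "x \<in> carrier H \<Longrightarrow> finite (hom_supp H x)"
  using hom_decomp_hom_comp[of x] unfolding hom_decomp_def hom_supp_def by blast

lemma finsum_hom_comp: "x \<in> carrier H \<Longrightarrow> x = finsum H (hom_comp H x) (hom_supp H x)"
  using hom_decomp_hom_comp by (auto simp: hom_decomp_def hom_supp_def)

text \<open>The finite set \<open>S\<close> may exceed the support, so supports of sums and
  multiples need not be determined.\<close>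

lemma hom_comp_eqI:
  assumes "\<And>\<gamma>. f \<gamma> \<in> hom_part H \<gamma>" "finite S" "\<And>\<gamma>. \<gamma> \<notin> S \<Longrightarrow> f \<gamma> = \<zero>" "x = finsum H f S"
  shows "hom_comp H x = f"
proof -
  have c: "f \<gamma> \<in> carrier H" for \<gamma> using assms(1) hom_carrier by blast
  have sub: "{\<gamma>. f \<gamma> \<noteq> \<zero>} \<subseteq> S" using assms(3) by auto
  have "finsum H f {\<gamma>. f \<gamma> \<noteq> \<zero>} = finsum H f S"
    using assms(2) sub c by (intro finsum_superset) auto
  then have "hom_decomp H x f"
    using assms sub by (auto simp: hom_decomp_def intro: finite_subset)
  moreover have "x \<in> carrier H"
    using assms(4) c M.finsum_closed by simp
  ultimately show ?thesis
    using direct_sum hom_decomp_hom_comp by blast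
qed

lemma hom_comp_of_hom:
  assumes "x \<in> hom_part H \<gamma>"
  shows "hom_comp H x = (\<lambda>\<delta>. if \<delta> = \<gamma> then x else \<zero>)"
  by (rule hom_comp_eqI[of _ "{\<gamma>}"]) (use assms hom_carrier in \<open>auto simp: M.finsum_insert\<close>)

lemma hom_comp_add:
  assumes "x \<in> carrier H" "y \<in> carrier H"
  shows "hom_comp H (x \<oplus> y) = (\<lambda>\<gamma>. hom_comp H x \<gamma> \<oplus> hom_comp H y \<gamma>)"
proof (rule hom_comp_eqI[of _ "hom_supp H x \<union> hom_supp H y"])
  let ?S = "hom_supp H x \<union> hom_supp H y"
  have *: "z = finsum H (hom_comp H z) ?S" if "z \<in> carrier H" "hom_supp H z \<subseteq> ?S" for z
    by (rule trans[OF finsum_hom_comp[OF that(1)]], rule finsum_superset)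
      (use assms that in \<open>auto simp: hom_supp_def[of H z]\<close>)
  have "x = finsum H (hom_comp H x) ?S" "y = finsum H (hom_comp H y) ?S"
    by (rule *; use assms in auto)+
  then have "x \<oplus> y = finsum H (hom_comp H x) ?S \<oplus> finsum H (hom_comp H y) ?S"
    by (rule arg_cong2)
  then show "x \<oplus> y = (\<Oplus>\<gamma>\<in>?S. hom_comp H x \<gamma> \<oplus> hom_comp H y \<gamma>)"
    using assms by (simp add: M.finsum_addf)
qed (use assms in \<open>auto simp: hom_comp_hom hom_add, auto simp: hom_supp_def\<close>)

lemma hom_comp_smult:
  assumes "x \<in> carrier H"
  shows "hom_comp H (c \<odot> x) = (\<lambda>\<gamma>. c \<odot> hom_comp H x \<gamma>)"
proof (rule hom_comp_eqI[of _ "hom_supp H x"])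
  show "c \<odot> x = (\<Oplus>\<gamma>\<in>hom_supp H x. c \<odot> hom_comp H x \<gamma>)"
    using assms finsum_smult_ldistr[of "hom_supp H x" c "hom_comp H x"]
    by (simp flip: finsum_hom_comp)
  show "finite (hom_supp H x)" using assms by simp
qed (use assms in \<open>auto simp: hom_comp_hom hom_smult, auto simp: hom_supp_def\<close>)

lemma hom_induct [consumes 1, case_names hom add]:
  assumes "x \<in> carrier H" "\<And>\<gamma> x. x \<in> hom_part H \<gamma> \<Longrightarrow> Q x"
    "\<And>x y. x \<in> carrier H \<Longrightarrow> y \<in> carrier H \<Longrightarrow> Q x \<Longrightarrow> Q y \<Longrightarrow> Q (x \<oplus> y)"
  shows "Q x"
proof -
  have "Q (finsum H (hom_comp H x) (hom_supp H x))"
    by (rule finsum_induct)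
      (use assms(1,3) assms(2)[OF hom_zero] assms(2)[OF hom_comp_hom] in auto)
  then show ?thesis by (simp only: finsum_hom_comp[OF assms(1), symmetric])
qed

end

text \<open>The linear map that is \<open>\<phi> \<beta>\<close> on the part of degree
  \<open>\<beta>\<close>. The twisted products of tensor products and of the opposite algebra, and
  the projections that grade a tensor product, are nested instances.\<close>

definition gsum :: "('a, 'g) graded_algebra \<Rightarrow> ('b, 'g) graded_algebra \<Rightarrow> ('g \<Rightarrow> 'a \<Rightarrow> 'b) \<Rightarrow> 'a \<Rightarrow> 'b" where
  "gsum H P \<phi> x = (\<Oplus>\<^bsub>P\<^esub>\<beta>\<in>hom_supp H x. \<phi> \<beta> (hom_comp H x \<beta>))"

context gamma_algebra
begin

context
  fixes P :: "('b, 'g) graded_algebra" and \<phi> :: "'g \<Rightarrow> 'a \<Rightarrow> 'b"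
  assumes P: "cq_module P" and \<phi>: "\<And>\<beta>. cq_linear H P (\<phi> \<beta>)"
begin

interpretation P: cq_module P by (rule P)

lemma gsum_superset:
  assumes "x \<in> carrier H" "finite S" "hom_supp H x \<subseteq> S"
  shows "gsum H P \<phi> x = (\<Oplus>\<^bsub>P\<^esub>\<beta>\<in>S. \<phi> \<beta> (hom_comp H x \<beta>))"
  unfolding gsum_def
proof (rule P.finsum_superset)
  show "\<phi> \<beta> (hom_comp H x \<beta>) = \<zero>\<^bsub>P\<^esub>" if "\<beta> \<in> S - hom_supp H x" for \<beta>
    using that by (simp add: hom_supp_def cq_linear_zero[OF cq_module_axioms P \<phi>])
qed (use assms in \<open>auto intro!: cq_linear_closed[OF \<phi>]\<close>)

lemma gsum_linear: "cq_linear H P (gsum H P \<phi>)"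
proof (rule cq_linearI)
  fix x assume x: "x \<in> carrier H"
  then show "gsum H P \<phi> x \<in> carrier P"
    by (auto simp: gsum_def intro!: P.M.finsum_closed cq_linear_closed[OF \<phi>])
  have "hom_supp H (c \<odot> x) \<subseteq> hom_supp H x" for c
    using x by (auto simp: hom_supp_def hom_comp_smult)
  then show "gsum H P \<phi> (c \<odot> x) = c \<odot>\<^bsub>P\<^esub> gsum H P \<phi> x" for c
    using x by (simp add: cq_linear_closed[OF \<phi>] gsum_superset[of _ "hom_supp H x"] hom_comp_smult cq_linear_smult[OF \<phi>] P.finsum_smult_ldistr)
next
  fix x y assume xy: "x \<in> carrier H" "y \<in> carrier H"
  let ?S = "hom_supp H x \<union> hom_supp H y"
  have "hom_supp H (x \<oplus> y) \<subseteq> ?S"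
    using xy by (auto simp: hom_supp_def hom_comp_add)
  then show "gsum H P \<phi> (x \<oplus> y) = gsum H P \<phi> x \<oplus>\<^bsub>P\<^esub> gsum H P \<phi> y"
    using xy by (simp add: cq_linear_closed[OF \<phi>] gsum_superset[of _ ?S] hom_comp_add cq_linear_add[OF \<phi>] P.M.finsum_addf)
qed

lemma gsum_hom:
  assumes "x \<in> hom_part H \<beta>"
  shows "gsum H P \<phi> x = \<phi> \<beta> x"
proof -
  have "gsum H P \<phi> x = (\<Oplus>\<^bsub>P\<^esub>\<beta>\<in>{\<beta>}. \<phi> \<beta> (hom_comp H x \<beta>))"
    using assms hom_carrier by (intro gsum_superset) (auto simp: hom_supp_def hom_comp_of_hom)
  then show ?thesis
    using assms hom_carrier[OF assms]
    by (simp add: cq_linear_closed[OF \<phi>] P.M.finsum_insert hom_comp_of_hom)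
qed

end

lemma linear_eqI:
  assumes "cq_linear H P f" "cq_linear H P g" "\<And>\<gamma> x. x \<in> hom_part H \<gamma> \<Longrightarrow> f x = g x"
    "x \<in> carrier H"
  shows "f x = g x"
  using assms(4)
proof (induction rule: hom_induct)
  case (add x y)
  then show ?case by (simp add: cq_linear_add[OF assms(1)] cq_linear_add[OF assms(2)])
qed (rule assms(3))

end

section \<open>Tensor products of modules\<close>

abbreviation fscale :: "cq \<Rightarrow> ('z \<Rightarrow>\<^sub>0 cq) \<Rightarrow> ('z \<Rightarrow>\<^sub>0 cq)" where
  "fscale c \<equiv> Poly_Mapping.map ((*) c)"

lemma lookup_fscale [simp]: "Poly_Mapping.lookup (fscale c p) k = c * Poly_Mapping.lookup p k"
  by (simp add: Poly_Mapping.map.rep_eq when_def)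

lemma fscale_simps:
  "fscale c (p + q) = fscale c p + fscale c q"
  "fscale c (p - q) = fscale c p - fscale c q"
  "fscale c (fscale d p) = fscale (c * d) p"
  "fscale (c + d) p = fscale c p + fscale d p"
  "fscale 1 p = p"
  "fscale c (Poly_Mapping.single z d) = Poly_Mapping.single z (c * d)"
  by (rule poly_mapping_eqI;
      simp add: lookup_add lookup_minus algebra_simps lookup_single when_def)+

lemma minus_eq_fscale: "p - q = p + fscale (- 1) q"
  by (rule poly_mapping_eqI) (simp add: lookup_add lookup_minus)

lemma keys_fscale: "Poly_Mapping.keys (fscale c p) \<subseteq> Poly_Mapping.keys p"
  by (auto simp: in_keys_iff)

lemma poly_mapping_eq_sum_single:
  "p = (\<Sum>k\<in>Poly_Mapping.keys p. Poly_Mapping.single k (Poly_Mapping.lookup p k))"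
  by (rule poly_mapping_eqI) (simp add: lookup_sum lookup_single when_def in_keys_iff)

lemma tensor_alg_simps [simp]:
  "carrier (tensor_alg \<omega> M N) = tensor_class M N ` tensor_free M N"
  "mult (tensor_alg \<omega> M N) = tensor_mult \<omega> M N"
  "one (tensor_alg \<omega> M N) = pure_tensor M N \<one>\<^bsub>M\<^esub> \<one>\<^bsub>N\<^esub>"
  "zero (tensor_alg \<omega> M N) = tensor_class M N 0"
  "add (tensor_alg \<omega> M N) = (\<lambda>X Y. tensor_class M N (tensor_rep X + tensor_rep Y))"
  "smult (tensor_alg \<omega> M N) = (\<lambda>c X. tensor_class M N (fscale c (tensor_rep X)))"
  by (simp_all add: tensor_alg_def)

definition cq_bilinear ::
  "('a, 'g) graded_algebra \<Rightarrow> ('b, 'g) graded_algebra \<Rightarrow> ('c, 'g) graded_algebra \<Rightarrow>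
   ('a \<Rightarrow> 'b \<Rightarrow> 'c) \<Rightarrow> bool" where
  "cq_bilinear M N P B \<longleftrightarrow>
     (\<forall>x \<in> carrier M. cq_linear N P (B x)) \<and> (\<forall>y \<in> carrier N. cq_linear M P (\<lambda>x. B x y))"

locale tensor_modules = M: cq_module M + N: cq_module N
  for \<omega> :: "'g::ab_group_add \<Rightarrow> 'g \<Rightarrow> complex"
    and M :: "('a, 'g) graded_algebra" and N :: "('b, 'g) graded_algebra"
begin

abbreviation T where "T \<equiv> tensor_alg \<omega> M N"
abbreviation pure (infixl \<open>\<boxtimes>\<close> 75) where "x \<boxtimes> y \<equiv> pure_tensor M N x y"
abbreviation cls where "cls \<equiv> tensor_class M N"
abbreviation null where "null \<equiv> tensor_null M N"
abbreviation free where "free \<equiv> tensor_free M N"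

lemma free_simps [simp]:
  "0 \<in> free"
  "p \<in> free \<Longrightarrow> q \<in> free \<Longrightarrow> p + q \<in> free"
  "p \<in> free \<Longrightarrow> fscale c p \<in> free"
  "x \<in> carrier M \<Longrightarrow> y \<in> carrier N \<Longrightarrow> Poly_Mapping.single (x, y) c \<in> free"
  using keys_add[of p q] keys_fscale[of c p] by (auto simp: tensor_free_def)

lemma free_diff [simp]: "p \<in> free \<Longrightarrow> q \<in> free \<Longrightarrow> p - q \<in> free"
  by (simp add: minus_eq_fscale)

lemma free_sum: "(\<And>a. a \<in> A \<Longrightarrow> f a \<in> free) \<Longrightarrow> sum f A \<in> free"
  by (induction A rule: infinite_finite_induct) auto

lemma null_free: "p \<in> null \<Longrightarrow> p \<in> free"
  by (induction rule: tensor_null.induct) auto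

text \<open>The relations carry an arbitrary coefficient, so scaling turns each of them into one of
  the same kind.\<close>

lemma null_fscale: "p \<in> null \<Longrightarrow> fscale c p \<in> null"
proof (induction rule: tensor_null.induct)
  case zero
  then show ?case
    by (metis (no_types, lifting) tensor_null.zero lookup_fscale lookup_zero mult_zero_right poly_mapping_eqI)
qed (auto simp: fscale_simps mult.left_commute[of c] intro: tensor_null.intros)

lemma null_diff: "p \<in> null \<Longrightarrow> q \<in> null \<Longrightarrow> p - q \<in> null"
  by (simp add: minus_eq_fscale null_fscale tensor_null.add)

lemma cls_eq_iff: "cls p = cls q \<longleftrightarrow> p - q \<in> null"
proof
  assume "cls p = cls q"
  moreover have "p \<in> cls p"
    using tensor_null.zero[of M N] by (force simp: tensor_class_def)
  ultimately show "p - q \<in> null" by (auto simp: tensor_class_def)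
next
  assume *: "p - q \<in> null"
  have "\<exists>n'\<in>null. p + n = q + n'" if "n \<in> null" for n
    using * that by (intro bexI[of _ "p - q + n"]) (auto intro: tensor_null.add)
  moreover have "\<exists>n'\<in>null. q + n = p + n'" if "n \<in> null" for n
    using * that by (intro bexI[of _ "n - (p - q)"]) (auto intro: null_diff)
  ultimately show "cls p = cls q"
    by (force simp: tensor_class_def image_def)
qed

text \<open>Together with the two congruence lemmas below, this makes addition and scalar
  multiplication independent of the representative picked by \<open>tensor_rep\<close>.\<close>

lemma cls_rep: "cls (tensor_rep (cls p)) = cls p"
proof -
  have "p \<in> cls p"
    using tensor_null.zero[of M N] by (force simp: tensor_class_def)
  then have "tensor_rep (cls p) \<in> cls p"
    unfolding tensor_rep_def by (rule someI)
  then obtain n where "tensor_rep (cls p) = p + n" "n \<in> null"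
    unfolding tensor_class_def by blast
  then show ?thesis by (simp add: cls_eq_iff)
qed

text \<open>The relations involve only pairs from the carriers, so the representative that was
  picked differs from \<open>p\<close> by a free element.\<close>

lemma rep_free: "p \<in> free \<Longrightarrow> tensor_rep (cls p) \<in> free"
  using cls_rep[of p] null_free[of "tensor_rep (cls p) - p"] free_simps(2)[of "tensor_rep (cls p) - p" p]
  by (simp add: cls_eq_iff)

lemma cls_cong_add: "cls p = cls p' \<Longrightarrow> cls q = cls q' \<Longrightarrow> cls (p + q) = cls (p' + q')"
  unfolding cls_eq_iff by (drule (1) tensor_null.add) (simp add: algebra_simps)

lemma cls_cong_fscale: "cls p = cls p' \<Longrightarrow> cls (fscale c p) = cls (fscale c p')"
  unfolding cls_eq_iff by (drule null_fscale[of _ c]) (simp add: fscale_simps)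

lemma cls_add: "cls p \<oplus>\<^bsub>T\<^esub> cls q = cls (p + q)"
  by (simp, rule cls_cong_add) (rule cls_rep)+

lemma cls_smult: "c \<odot>\<^bsub>T\<^esub> cls p = cls (fscale c p)"
  by (simp, rule cls_cong_fscale) (rule cls_rep)

lemma cls_zero: "\<zero>\<^bsub>T\<^esub> = cls 0"
  by simp

lemma cls_closed: "p \<in> free \<Longrightarrow> cls p \<in> carrier T"
  by simp

lemma carrier_cases:
  assumes "X \<in> carrier T"
  obtains p where "p \<in> free" "X = cls p"
  using assms by auto

lemma tensor_module: "cq_module T"
proof (intro cq_module.intro moduleI cring_Cq abelian_groupI)
  fix X Y Z assume "X \<in> carrier T" "Y \<in> carrier T" "Z \<in> carrier T"
  then show "X \<oplus>\<^bsub>T\<^esub> Y \<oplus>\<^bsub>T\<^esub> Z = X \<oplus>\<^bsub>T\<^esub> (Y \<oplus>\<^bsub>T\<^esub> Z)"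
    by (elim carrier_cases) (simp only: cls_add add.assoc)
next
  fix X Y assume "X \<in> carrier T" "Y \<in> carrier T"
  then show "X \<oplus>\<^bsub>T\<^esub> Y = Y \<oplus>\<^bsub>T\<^esub> X"
    by (elim carrier_cases) (simp only: cls_add add.commute)
next
  fix X Y assume "X \<in> carrier T" "Y \<in> carrier T"
  then show "X \<oplus>\<^bsub>T\<^esub> Y \<in> carrier T"
    by (elim carrier_cases) (simp only: cls_add cls_closed free_simps)
next
  fix X assume "X \<in> carrier T"
  then show "\<zero>\<^bsub>T\<^esub> \<oplus>\<^bsub>T\<^esub> X = X"
    by (elim carrier_cases) (simp only: cls_zero cls_add add_0_left)
next
  fix X assume "X \<in> carrier T"
  then obtain p where p: "p \<in> free" "X = cls p" by (elim carrier_cases)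
  have "cls (0 - p) \<oplus>\<^bsub>T\<^esub> X = \<zero>\<^bsub>T\<^esub>"
    by (simp only: cls_zero cls_add p diff_0 add.left_inverse)
  moreover have "cls (0 - p) \<in> carrier T" using p by (intro cls_closed free_diff) auto
  ultimately show "\<exists>Y\<in>carrier T. Y \<oplus>\<^bsub>T\<^esub> X = \<zero>\<^bsub>T\<^esub>" by blast
next
  fix c X assume "X \<in> carrier T"
  then show "c \<odot>\<^bsub>T\<^esub> X \<in> carrier T"
    by (elim carrier_cases) (simp only: cls_smult cls_closed free_simps)
next
  fix c d X assume "X \<in> carrier T"
  then show "(c \<oplus>\<^bsub>Cq\<^esub> d) \<odot>\<^bsub>T\<^esub> X = c \<odot>\<^bsub>T\<^esub> X \<oplus>\<^bsub>T\<^esub> d \<odot>\<^bsub>T\<^esub> X"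
    by (elim carrier_cases) (simp only: cls_smult cls_add Cq_simps fscale_simps)
next
  fix c X Y assume "X \<in> carrier T" "Y \<in> carrier T"
  then show "c \<odot>\<^bsub>T\<^esub> (X \<oplus>\<^bsub>T\<^esub> Y) = c \<odot>\<^bsub>T\<^esub> X \<oplus>\<^bsub>T\<^esub> c \<odot>\<^bsub>T\<^esub> Y"
    by (elim carrier_cases) (simp only: cls_smult cls_add fscale_simps)
next
  fix c d X assume "X \<in> carrier T"
  then show "(c \<otimes>\<^bsub>Cq\<^esub> d) \<odot>\<^bsub>T\<^esub> X = c \<odot>\<^bsub>T\<^esub> (d \<odot>\<^bsub>T\<^esub> X)"
    by (elim carrier_cases) (simp only: cls_smult Cq_simps fscale_simps)
next
  fix X assume "X \<in> carrier T"
  then show "\<one>\<^bsub>Cq\<^esub> \<odot>\<^bsub>T\<^esub> X = X"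
    by (elim carrier_cases) (simp only: cls_smult Cq_simps fscale_simps)
qed (simp only: cls_zero cls_closed free_simps)

end

sublocale tensor_modules \<subseteq> T: cq_module "tensor_alg \<omega> M N"
  by (rule tensor_module)

context tensor_modules
begin

text \<open>From here on the operations of \<open>T\<close> are used through their laws; unfolding
  them would bring back the chosen representatives.\<close>

declare tensor_alg_simps [simp del]

lemma pure_closed [simp]: "x \<in> carrier M \<Longrightarrow> y \<in> carrier N \<Longrightarrow> x \<boxtimes> y \<in> carrier T"
  unfolding pure_tensor_def by (intro cls_closed) simp

lemma pure_add_left:
  assumes "x \<in> carrier M" "x' \<in> carrier M" "y \<in> carrier N"
  shows "(x \<oplus>\<^bsub>M\<^esub> x') \<boxtimes> y = x \<boxtimes> y \<oplus>\<^bsub>T\<^esub> x' \<boxtimes> y"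
  using tensor_null.add_left[OF assms, of 1]
  by (simp add: pure_tensor_def cls_add cls_eq_iff algebra_simps)

lemma pure_add_right:
  assumes "x \<in> carrier M" "y \<in> carrier N" "y' \<in> carrier N"
  shows "x \<boxtimes> (y \<oplus>\<^bsub>N\<^esub> y') = x \<boxtimes> y \<oplus>\<^bsub>T\<^esub> x \<boxtimes> y'"
  using tensor_null.add_right[OF assms, of 1]
  by (simp add: pure_tensor_def cls_add cls_eq_iff algebra_simps)

lemma cls_single: "cls (Poly_Mapping.single (x, y) c) = c \<odot>\<^bsub>T\<^esub> (x \<boxtimes> y)"
  by (simp add: pure_tensor_def cls_smult fscale_simps)

lemma pure_smult_left:
  assumes "x \<in> carrier M" "y \<in> carrier N"
  shows "(c \<odot>\<^bsub>M\<^esub> x) \<boxtimes> y = c \<odot>\<^bsub>T\<^esub> (x \<boxtimes> y)"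
  using tensor_null.smult_left[OF assms, of c 1]
  by (simp add: pure_tensor_def cls_smult cls_eq_iff fscale_simps)

lemma pure_smult_right:
  assumes "x \<in> carrier M" "y \<in> carrier N"
  shows "x \<boxtimes> (c \<odot>\<^bsub>N\<^esub> y) = c \<odot>\<^bsub>T\<^esub> (x \<boxtimes> y)"
  using tensor_null.smult_right[OF assms, of c 1]
  by (simp add: pure_tensor_def cls_smult cls_eq_iff fscale_simps)

lemma pure_bilinear: "cq_bilinear M N T (\<boxtimes>)"
  by (auto simp: cq_bilinear_def pure_add_left pure_add_right pure_smult_left pure_smult_right
      intro!: cq_linearI)

lemma cls_sum:
  assumes "finite A" "\<And>a. a \<in> A \<Longrightarrow> f a \<in> free"
  shows "cls (sum f A) = (\<Oplus>\<^bsub>T\<^esub>a\<in>A. cls (f a))"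
  using assms
proof (induction A rule: finite_induct)
  case (insert a A)
  then have "(\<lambda>a. cls (f a)) \<in> A \<rightarrow> carrier T" "cls (f a) \<in> carrier T"
    by (auto intro: cls_closed)
  with insert show ?case
    by (simp add: T.M.finsum_insert cls_add[symmetric])
qed (simp add: cls_zero[symmetric])

lemma cls_eq_finsum:
  assumes "p \<in> free"
  shows "cls p = (\<Oplus>\<^bsub>T\<^esub>z\<in>Poly_Mapping.keys p. Poly_Mapping.lookup p z \<odot>\<^bsub>T\<^esub> (fst z \<boxtimes> snd z))"
proof -
  have "cls p = (\<Oplus>\<^bsub>T\<^esub>z\<in>Poly_Mapping.keys p. cls (Poly_Mapping.single z (Poly_Mapping.lookup p z)))"
    by (rule trans[OF arg_cong[where f = cls, OF poly_mapping_eq_sum_single] cls_sum])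
      (use assms in \<open>auto simp: tensor_free_def\<close>)
  also have "\<dots> = (\<Oplus>\<^bsub>T\<^esub>z\<in>Poly_Mapping.keys p. Poly_Mapping.lookup p z \<odot>\<^bsub>T\<^esub> (fst z \<boxtimes> snd z))"
    by (rule T.M.finsum_cong')
      (use assms in \<open>auto simp: cls_single tensor_free_def intro!: T.smult_closed pure_closed\<close>)
  finally show ?thesis .
qed

text \<open>Neither scalar multiples nor zero need a case of their own: a multiple of a pure tensor
  is pure, since the scalar can be moved into the left factor, and zero is the pure tensor of two
  zeros.\<close>

lemma tensor_induct [consumes 1, case_names pure add]:
  assumes "X \<in> carrier T" "\<And>x y. x \<in> carrier M \<Longrightarrow> y \<in> carrier N \<Longrightarrow> Q (x \<boxtimes> y)"
    "\<And>X Y. X \<in> carrier T \<Longrightarrow> Y \<in> carrier T \<Longrightarrow> Q X \<Longrightarrow> Q Y \<Longrightarrow> Q (X \<oplus>\<^bsub>T\<^esub> Y)"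
  shows "Q X"
proof -
  obtain p where p: "p \<in> free" "X = cls p" using assms(1) by (elim carrier_cases)
  have k: "fst z \<in> carrier M" "snd z \<in> carrier N" if "z \<in> Poly_Mapping.keys p" for z
    using p that by (auto simp: tensor_free_def)
  have "\<zero>\<^bsub>M\<^esub> \<boxtimes> \<zero>\<^bsub>N\<^esub> = \<zero>\<^bsub>T\<^esub>"
    using pure_smult_left[of "\<zero>\<^bsub>M\<^esub>" "\<zero>\<^bsub>N\<^esub>" 0] by simp
  then have "Q \<zero>\<^bsub>T\<^esub>" using assms(2)[of "\<zero>\<^bsub>M\<^esub>" "\<zero>\<^bsub>N\<^esub>"] by simp
  moreover have "Q (c \<odot>\<^bsub>T\<^esub> (fst z \<boxtimes> snd z))" if "z \<in> Poly_Mapping.keys p" for z c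
    using k[OF that] assms(2)[of "c \<odot>\<^bsub>M\<^esub> fst z" "snd z"] by (simp add: pure_smult_left)
  ultimately show ?thesis
    unfolding p(2) cls_eq_finsum[OF p(1)]
    by (rule_tac T.finsum_induct[where Q = Q]) (simp_all add: k assms(3))
qed

lemma linear_eqI:
  assumes "cq_linear T P f" "cq_linear T P g"
    "\<And>x y. x \<in> carrier M \<Longrightarrow> y \<in> carrier N \<Longrightarrow> f (x \<boxtimes> y) = g (x \<boxtimes> y)" "X \<in> carrier T"
  shows "f X = g X"
  using assms(4)
proof (induction rule: tensor_induct)
  case (add x y)
  then show ?case by (simp add: cq_linear_add[OF assms(1)] cq_linear_add[OF assms(2)])
qed (rule assms(3))

section \<open>The universal property of the tensor product\<close>

context
  fixes P :: "('c, 'g) graded_algebra" and B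
  assumes P: "cq_module P" and B: "cq_bilinear M N P B"
begin

interpretation P: cq_module P by (rule P)

text \<open>The linear extension of \<open>B\<close> to formal combinations. It kills
  \<open>null\<close>, because each generating relation expresses one clause of bilinearity, and so
  \<open>tensor_lift\<close> does not depend on the representative at which it is evaluated.\<close>

definition lift_free :: "('a \<times> 'b \<Rightarrow>\<^sub>0 cq) \<Rightarrow> 'c" where
  "lift_free p = (\<Oplus>\<^bsub>P\<^esub>z\<in>Poly_Mapping.keys p. Poly_Mapping.lookup p z \<odot>\<^bsub>P\<^esub> B (fst z) (snd z))"

lemma
  assumes "x \<in> carrier M" "y \<in> carrier N"
  shows B_closed: "B x y \<in> carrier P"
    and B_add_left: "x' \<in> carrier M \<Longrightarrow> B (x \<oplus>\<^bsub>M\<^esub> x') y = B x y \<oplus>\<^bsub>P\<^esub> B x' y"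
    and B_add_right: "y' \<in> carrier N \<Longrightarrow> B x (y \<oplus>\<^bsub>N\<^esub> y') = B x y \<oplus>\<^bsub>P\<^esub> B x y'"
    and B_smult_left: "B (c \<odot>\<^bsub>M\<^esub> x) y = c \<odot>\<^bsub>P\<^esub> B x y"
    and B_smult_right: "B x (c \<odot>\<^bsub>N\<^esub> y) = c \<odot>\<^bsub>P\<^esub> B x y"
  using B assms by (auto simp: cq_bilinear_def cq_linear_def)

lemma B_closed_subset: "z \<in> S \<Longrightarrow> S \<subseteq> carrier M \<times> carrier N \<Longrightarrow> B (fst z) (snd z) \<in> carrier P"
  by (rule B_closed) auto

lemma lift_free_superset:
  assumes "p \<in> free" "finite S" "Poly_Mapping.keys p \<subseteq> S" "S \<subseteq> carrier M \<times> carrier N"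
  shows "lift_free p = (\<Oplus>\<^bsub>P\<^esub>z\<in>S. Poly_Mapping.lookup p z \<odot>\<^bsub>P\<^esub> B (fst z) (snd z))"
  unfolding lift_free_def
  by (rule P.finsum_superset)
    (use assms in \<open>auto simp: in_keys_iff subset_iff intro!: B_closed P.smult_0\<close>)

lemma lift_free_closed: "p \<in> free \<Longrightarrow> lift_free p \<in> carrier P"
  unfolding lift_free_def tensor_free_def
  by (auto intro!: P.M.finsum_closed P.smult_closed B_closed)

lemma lift_free_add:
  assumes "p \<in> free" "q \<in> free"
  shows "lift_free (p + q) = lift_free p \<oplus>\<^bsub>P\<^esub> lift_free q"
proof -
  let ?S = "Poly_Mapping.keys p \<union> Poly_Mapping.keys q"
  have S: "?S \<subseteq> carrier M \<times> carrier N" "finite ?S" using assms by (auto simp: tensor_free_def)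
  have c: "B (fst z) (snd z) \<in> carrier P" if "z \<in> ?S" for z by (rule B_closed_subset[OF that S(1)])
  have "lift_free (p + q) = (\<Oplus>\<^bsub>P\<^esub>z\<in>?S. Poly_Mapping.lookup (p + q) z \<odot>\<^bsub>P\<^esub> B (fst z) (snd z))"
    by (rule lift_free_superset) (use assms S keys_add[of p q] in auto)
  also have "\<dots> = (\<Oplus>\<^bsub>P\<^esub>z\<in>?S. Poly_Mapping.lookup p z \<odot>\<^bsub>P\<^esub> B (fst z) (snd z) \<oplus>\<^bsub>P\<^esub>
          Poly_Mapping.lookup q z \<odot>\<^bsub>P\<^esub> B (fst z) (snd z))"
    by (rule P.M.finsum_cong') (use c in \<open>auto simp: lookup_add P.smult_add\<close>)
  also have "\<dots> = lift_free p \<oplus>\<^bsub>P\<^esub> lift_free q"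
    using assms S c
    by (subst P.M.finsum_addf) (auto simp: lift_free_superset[of _ ?S])
  finally show ?thesis .
qed

lemma lift_free_fscale:
  assumes "p \<in> free"
  shows "lift_free (fscale c p) = c \<odot>\<^bsub>P\<^esub> lift_free p"
proof -
  let ?S = "Poly_Mapping.keys p"
  have S: "?S \<subseteq> carrier M \<times> carrier N" "?S \<subseteq> ?S" using assms by (auto simp: tensor_free_def)
  have B: "B (fst z) (snd z) \<in> carrier P" if "z \<in> ?S" for z by (rule B_closed_subset[OF that S(1)])
  have "lift_free (fscale c p)
      = (\<Oplus>\<^bsub>P\<^esub>z\<in>?S. c \<odot>\<^bsub>P\<^esub> (Poly_Mapping.lookup p z \<odot>\<^bsub>P\<^esub> B (fst z) (snd z)))"
    by (subst lift_free_superset[of _ ?S])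
      (use assms S keys_fscale[of c p] B in \<open>auto simp: P.smult_smult intro!: P.M.finsum_cong'\<close>)
  also have "\<dots> = c \<odot>\<^bsub>P\<^esub> lift_free p"
    using B by (simp add: lift_free_def P.finsum_smult_ldistr)
  finally show ?thesis .
qed

lemma lift_free_single:
  assumes "x \<in> carrier M" "y \<in> carrier N"
  shows "lift_free (Poly_Mapping.single (x, y) c) = c \<odot>\<^bsub>P\<^esub> B x y"
  using assms B_closed[OF assms]
  by (subst lift_free_superset[of _ "{(x, y)}"]) (auto simp: P.M.finsum_insert)

lemma lift_free_diff:
  assumes "p \<in> free" "q \<in> free"
  shows "lift_free (p - q) = lift_free p \<ominus>\<^bsub>P\<^esub> lift_free q"
  using assms lift_free_closed[of q]
  by (simp add: minus_eq_fscale lift_free_add lift_free_fscale a_minus_def P.smult_minus_one)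

lemma lift_free_null: "p \<in> null \<Longrightarrow> lift_free p = \<zero>\<^bsub>P\<^esub>"
proof (induction rule: tensor_null.induct)
  case (add p p')
  then show ?case by (simp add: lift_free_add null_free)
next
  case (add_left x x' y c)
  then have "B x y \<in> carrier P" "B x' y \<in> carrier P" by (auto intro: B_closed)
  with add_left show ?case
    by (simp add: lift_free_diff lift_free_single B_add_left P.smult_add_right a_minus_def
        P.M.a_ac P.M.r_neg P.M.r_neg1 P.M.r_neg2 P.M.minus_add)
next
  case (add_right x y y' c)
  then have "B x y \<in> carrier P" "B x y' \<in> carrier P" by (auto intro: B_closed)
  with add_right show ?case
    by (simp add: lift_free_diff lift_free_single B_add_right P.smult_add_right a_minus_def
        P.M.a_ac P.M.r_neg P.M.r_neg1 P.M.r_neg2 P.M.minus_add)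
next
  case (smult_left x y s c)
  then show ?case
    using B_closed[OF smult_left]
    by (simp add: lift_free_diff lift_free_single B_smult_left P.smult_smult a_minus_def P.M.r_neg
        mult.commute)
next
  case (smult_right x y s c)
  then show ?case
    using B_closed[OF smult_right]
    by (simp add: lift_free_diff lift_free_single B_smult_right P.smult_smult a_minus_def P.M.r_neg
        mult.commute)
qed (simp add: lift_free_def)

lemma tensor_lift_cls:
  assumes "p \<in> free"
  shows "tensor_lift P B (cls p) = lift_free p"
proof -
  let ?r = "tensor_rep (cls p)"
  have r: "?r \<in> free" by (rule rep_free[OF assms])
  have "?r - p \<in> null" using cls_rep[of p] by (simp add: cls_eq_iff)
  then have "lift_free ?r \<ominus>\<^bsub>P\<^esub> lift_free p = \<zero>\<^bsub>P\<^esub>"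
    using lift_free_null lift_free_diff[OF r assms] by metis
  then have "lift_free ?r = lift_free p"
    using P.diff_eq_zero_iff lift_free_closed assms r by blast
  then show ?thesis by (simp add: tensor_lift_def lift_free_def Let_def)
qed

lemma tensor_lift_linear: "cq_linear T P (tensor_lift P B)"
proof (rule cq_linearI)
  fix X assume "X \<in> carrier T"
  then obtain p where p: "p \<in> free" "X = cls p" by (elim carrier_cases)
  then show "tensor_lift P B X \<in> carrier P" by (simp add: tensor_lift_cls lift_free_closed)
  show "tensor_lift P B (c \<odot>\<^bsub>T\<^esub> X) = c \<odot>\<^bsub>P\<^esub> tensor_lift P B X" for c
    using p by (simp add: cls_smult tensor_lift_cls lift_free_fscale)
next
  fix X Y assume "X \<in> carrier T" "Y \<in> carrier T"
  then obtain p q where "p \<in> free" "X = cls p" "q \<in> free" "Y = cls q" by (elim carrier_cases)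
  then show "tensor_lift P B (X \<oplus>\<^bsub>T\<^esub> Y) = tensor_lift P B X \<oplus>\<^bsub>P\<^esub> tensor_lift P B Y"
    by (simp add: cls_add tensor_lift_cls lift_free_add)
qed

lemma tensor_lift_pure:
  "x \<in> carrier M \<Longrightarrow> y \<in> carrier N \<Longrightarrow> tensor_lift P B (x \<boxtimes> y) = B x y"
  by (simp add: pure_tensor_def tensor_lift_cls lift_free_single B_closed)

end

end

section \<open>Tensor products of graded algebras\<close>

lemma cq_of_mult [simp]: "cq_of (a * b) = cq_of a * cq_of b"
  and cq_of_1 [simp]: "cq_of 1 = 1"
  by (simp_all add: cq_of_def One_fract_def one_pCons mult.commute)

section \<open>Calculating with a commutative factor\<close>

locale com_factor =
  fixes \<omega> :: "'g::ab_group_add \<Rightarrow> 'g \<Rightarrow> complex"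
  assumes commutative_factor: "commutative_factor \<omega>"
begin

abbreviation w where "w \<alpha> \<beta> \<equiv> cq_of (\<omega> \<alpha> \<beta>)"

lemma w_add_left: "w (\<alpha> + \<beta>) \<gamma> = w \<alpha> \<gamma> * w \<beta> \<gamma>"
  using commutative_factor unfolding commutative_factor_def by (metis cq_of_mult)

lemma w_add_right: "w \<alpha> (\<beta> + \<gamma>) = w \<alpha> \<beta> * w \<alpha> \<gamma>"
  using commutative_factor unfolding commutative_factor_def by (metis cq_of_mult)

lemma w_inverse: "w \<alpha> \<beta> * w \<beta> \<alpha> = 1"
proof -
  have "\<omega> \<alpha> \<beta> = inverse (\<omega> \<beta> \<alpha>)" "\<omega> \<beta> \<alpha> \<noteq> 0"
    using commutative_factor unfolding commutative_factor_def by blast+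
  then have "\<omega> \<alpha> \<beta> * \<omega> \<beta> \<alpha> = 1" by simp
  then show ?thesis by (metis cq_of_1 cq_of_mult)
qed

lemma w_nonzero [simp]: "w \<alpha> \<beta> \<noteq> 0"
  using w_inverse[of \<alpha> \<beta>] by auto

lemma w_0_left [simp]: "w 0 \<alpha> = 1"
  using w_add_left[of 0 0 \<alpha>] by simp

lemma w_0_right [simp]: "w \<alpha> 0 = 1"
  using w_add_right[of \<alpha> 0 0] by simp

lemma w_minus_left: "w (- \<alpha>) \<beta> = w \<beta> \<alpha>"
  using w_add_left[of "- \<alpha>" \<alpha> \<beta>] w_inverse[of \<alpha> \<beta>]
  by (simp, metis mult_cancel_right w_nonzero mult.commute)

lemma w_minus_right: "w \<alpha> (- \<beta>) = w \<beta> \<alpha>"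
  using w_add_right[of \<alpha> "- \<beta>" \<beta>] w_inverse[of \<alpha> \<beta>]
  by (simp, metis mult_cancel_right w_nonzero mult.commute)

end

lemma cq_linear_cong:
  assumes "cq_module M" "\<And>x. x \<in> carrier M \<Longrightarrow> f x = g x"
  shows "cq_linear M P f \<longleftrightarrow> cq_linear M P g"
proof -
  interpret M: cq_module M by fact
  show ?thesis using assms(2) by (auto simp: cq_linear_def Pi_iff)
qed

lemma cq_linear_finsum_maps:
  assumes "cq_module Q" "cq_module P" "finite A" "\<And>a. a \<in> A \<Longrightarrow> cq_linear Q P (f a)"
  shows "cq_linear Q P (\<lambda>x. \<Oplus>\<^bsub>P\<^esub>a\<in>A. f a x)"
proof -
  interpret Q: cq_module Q by fact
  interpret P: cq_module P by fact
  show ?thesis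
  proof (rule cq_linearI)
    fix x assume x: "x \<in> carrier Q"
    show "(\<Oplus>\<^bsub>P\<^esub>a\<in>A. f a x) \<in> carrier P"
      using cq_linear_closed[OF assms(4) x] by (auto intro!: P.M.finsum_closed)
    fix c
    have "(\<Oplus>\<^bsub>P\<^esub>a\<in>A. f a (c \<odot>\<^bsub>Q\<^esub> x)) = (\<Oplus>\<^bsub>P\<^esub>a\<in>A. c \<odot>\<^bsub>P\<^esub> f a x)"
      using cq_linear_closed[OF assms(4) x] cq_linear_smult[OF assms(4) x]
      by (intro P.M.finsum_cong') auto
    also have "\<dots> = c \<odot>\<^bsub>P\<^esub> (\<Oplus>\<^bsub>P\<^esub>a\<in>A. f a x)"
      using cq_linear_closed[OF assms(4) x] assms(3)
      by (subst P.finsum_smult_ldistr) auto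
    finally show "(\<Oplus>\<^bsub>P\<^esub>a\<in>A. f a (c \<odot>\<^bsub>Q\<^esub> x)) = c \<odot>\<^bsub>P\<^esub> (\<Oplus>\<^bsub>P\<^esub>a\<in>A. f a x)" .
  next
    fix x y assume x: "x \<in> carrier Q" and y: "y \<in> carrier Q"
    have "(\<Oplus>\<^bsub>P\<^esub>a\<in>A. f a (x \<oplus>\<^bsub>Q\<^esub> y)) = (\<Oplus>\<^bsub>P\<^esub>a\<in>A. f a x \<oplus>\<^bsub>P\<^esub> f a y)"
      using cq_linear_closed[OF assms(4) x] cq_linear_closed[OF assms(4) y]
        cq_linear_add[OF assms(4) x y]
      by (intro P.M.finsum_cong') auto
    also have "\<dots> = (\<Oplus>\<^bsub>P\<^esub>a\<in>A. f a x) \<oplus>\<^bsub>P\<^esub> (\<Oplus>\<^bsub>P\<^esub>a\<in>A. f a y)"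
      using cq_linear_closed[OF assms(4) x] cq_linear_closed[OF assms(4) y]
      by (intro P.M.finsum_addf) auto
    finally show "(\<Oplus>\<^bsub>P\<^esub>a\<in>A. f a (x \<oplus>\<^bsub>Q\<^esub> y)) = (\<Oplus>\<^bsub>P\<^esub>a\<in>A. f a x) \<oplus>\<^bsub>P\<^esub> (\<Oplus>\<^bsub>P\<^esub>a\<in>A. f a y)" .
  qed
qed

lemma cq_linear_smult_map:
  assumes "cq_module P" "cq_linear Q P f"
  shows "cq_linear Q P (\<lambda>x. c \<odot>\<^bsub>P\<^esub> f x)"
proof -
  interpret P: cq_module P by fact
  show ?thesis
    by (rule cq_linearI)
      (simp_all add: cq_linear_closed[OF assms(2)] cq_linear_add[OF assms(2)]
        cq_linear_smult[OF assms(2)] P.smult_add_right P.smult_smult mult.commute)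
qed

lemma cq_linear_zero_map:
  assumes "cq_module P"
  shows "cq_linear Q P (\<lambda>x. \<zero>\<^bsub>P\<^esub>)"
proof -
  interpret P: cq_module P by fact
  show ?thesis by (rule cq_linearI) simp_all
qed

lemma (in gamma_algebra) gsum_param_linear:
  assumes "cq_module Q" "cq_module P" "x \<in> carrier H"
    "\<And>\<beta> y. y \<in> carrier H \<Longrightarrow> cq_linear Q P (\<lambda>b. \<phi> b \<beta> y)"
  shows "cq_linear Q P (\<lambda>b. gsum H P (\<phi> b) x)"
  unfolding gsum_def using assms by (intro cq_linear_finsum_maps) auto

lemma (in gamma_algebra) mult_linear_left: "y \<in> carrier H \<Longrightarrow> cq_linear H H (\<lambda>x. x \<otimes> y)"
  by (rule cq_linearI) (simp_all add: l_distr smult_mult_left)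

lemma (in gamma_algebra) mult_linear_right: "x \<in> carrier H \<Longrightarrow> cq_linear H H (\<lambda>y. x \<otimes> y)"
  by (rule cq_linearI) (simp_all add: r_distr smult_mult_right)

context tensor_modules
begin

lemma pure_linear_left: "y \<in> carrier N \<Longrightarrow> cq_linear M T (\<lambda>x. x \<boxtimes> y)"
  and pure_linear_right: "x \<in> carrier M \<Longrightarrow> cq_linear N T (\<lambda>y. x \<boxtimes> y)"
  using pure_bilinear by (auto simp: cq_bilinear_def)

text \<open>The element \<open>X\<close> keeps one representative while \<open>c\<close> varies, so
  the lift is a fixed finite combination of maps that are linear in \<open>c\<close>.\<close>

lemma tensor_lift_param_linear:
  assumes Q: "cq_module Q" and P: "cq_module P" and X: "X \<in> carrier T"
    and B: "\<And>x y. x \<in> carrier M \<Longrightarrow> y \<in> carrier N \<Longrightarrow> cq_linear Q P (\<lambda>c. B c x y)"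
  shows "cq_linear Q P (\<lambda>c. tensor_lift P (B c) X)"
proof -
  obtain p where p: "p \<in> free" "X = cls p" using X by (elim carrier_cases)
  have r: "Poly_Mapping.keys (tensor_rep X) \<subseteq> carrier M \<times> carrier N"
    using rep_free[OF p(1)] p(2) by (simp add: tensor_free_def)
  show ?thesis
    unfolding tensor_lift_def Let_def
  proof (intro cq_linear_finsum_maps[OF Q P] cq_linear_smult_map[OF P])
    fix z assume "z \<in> Poly_Mapping.keys (tensor_rep X)"
    with r show "cq_linear Q P (\<lambda>c. B c (fst z) (snd z))"
      by (intro B) auto
  qed simp
qed

end

locale tensor_algebras = com_factor \<omega> + M: gamma_algebra M + N: gamma_algebra N
  for \<omega> :: "'g::ab_group_add \<Rightarrow> 'g \<Rightarrow> complex"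
    and M :: "('a, 'g) graded_algebra" and N :: "('b, 'g) graded_algebra"

sublocale tensor_algebras \<subseteq> tensor_modules \<omega> M N ..

section \<open>The product on a tensor product of graded algebras\<close>

context tensor_algebras
begin

text \<open>The product of \<open>a \<boxtimes> b\<close> and \<open>c \<boxtimes> d\<close>,
  expressed by sums over components so that it is linear in all four arguments also when
  \<open>b\<close> and \<open>c\<close> are not homogeneous.\<close>

definition pure_mult where
  "pure_mult a b c d =
     gsum N T (\<lambda>\<beta> b'. gsum M T (\<lambda>\<gamma> c'. w \<beta> \<gamma> \<odot>\<^bsub>T\<^esub> ((a \<otimes>\<^bsub>M\<^esub> c') \<boxtimes> (b' \<otimes>\<^bsub>N\<^esub> d))) c) b"

lemmas modules = M.cq_module_axioms N.cq_module_axioms T.cq_module_axioms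

lemma pure_mult_linear4:
  assumes "a \<in> carrier M" "b \<in> carrier N" "c \<in> carrier M"
  shows "cq_linear N T (\<lambda>d. pure_mult a b c d)"
  unfolding pure_mult_def using assms
  by (intro N.gsum_param_linear M.gsum_param_linear modules cq_linear_smult_map
      cq_linear_comp[OF N.mult_linear_right pure_linear_right]) auto

lemma pure_mult_linear1:
  assumes "b \<in> carrier N" "c \<in> carrier M" "d \<in> carrier N"
  shows "cq_linear M T (\<lambda>a. pure_mult a b c d)"
  unfolding pure_mult_def using assms
  by (intro N.gsum_param_linear M.gsum_param_linear modules cq_linear_smult_map
      cq_linear_comp[OF M.mult_linear_left pure_linear_left]) auto

lemma pure_mult_inner_linear:
  assumes "a \<in> carrier M" "b' \<in> carrier N" "d \<in> carrier N"
  shows "cq_linear M T (\<lambda>c'. k \<odot>\<^bsub>T\<^esub> ((a \<otimes>\<^bsub>M\<^esub> c') \<boxtimes> (b' \<otimes>\<^bsub>N\<^esub> d)))"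
  using assms
  by (intro modules cq_linear_smult_map cq_linear_comp[OF M.mult_linear_right pure_linear_left]) auto

lemma pure_mult_outer_linear:
  assumes "a \<in> carrier M" "c \<in> carrier M" "d \<in> carrier N"
  shows "cq_linear N T (\<lambda>b'. gsum M T (\<lambda>\<gamma> c'. w \<beta> \<gamma> \<odot>\<^bsub>T\<^esub> ((a \<otimes>\<^bsub>M\<^esub> c') \<boxtimes> (b' \<otimes>\<^bsub>N\<^esub> d))) c)"
  using assms
  by (intro M.gsum_param_linear modules cq_linear_smult_map
      cq_linear_comp[OF N.mult_linear_left pure_linear_right]) auto

lemma pure_mult_linear3:
  assumes "a \<in> carrier M" "b \<in> carrier N" "d \<in> carrier N"
  shows "cq_linear M T (\<lambda>c. pure_mult a b c d)"
  unfolding pure_mult_def gsum_def[of N] using assms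
  by (intro cq_linear_finsum_maps modules M.gsum_linear pure_mult_inner_linear) auto

lemma pure_mult_linear2:
  assumes "a \<in> carrier M" "c \<in> carrier M" "d \<in> carrier N"
  shows "cq_linear N T (\<lambda>b. pure_mult a b c d)"
  unfolding pure_mult_def using assms
  by (intro N.gsum_linear modules pure_mult_outer_linear) auto

lemma pure_mult_closed:
  "a \<in> carrier M \<Longrightarrow> b \<in> carrier N \<Longrightarrow> c \<in> carrier M \<Longrightarrow> d \<in> carrier N \<Longrightarrow> pure_mult a b c d \<in> carrier T"
  by (rule cq_linear_closed[OF pure_mult_linear1])

lemma pure_mult_hom:
  assumes "a \<in> carrier M" "b \<in> hom_part N \<beta>" "c \<in> hom_part M \<gamma>" "d \<in> carrier N"
  shows "pure_mult a b c d = w \<beta> \<gamma> \<odot>\<^bsub>T\<^esub> ((a \<otimes>\<^bsub>M\<^esub> c) \<boxtimes> (b \<otimes>\<^bsub>N\<^esub> d))"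
proof -
  have "b \<in> carrier N" "c \<in> carrier M" using assms N.hom_carrier M.hom_carrier by auto
  then show ?thesis
    unfolding pure_mult_def using assms
    by (subst N.gsum_hom[OF modules(3) pure_mult_outer_linear],
        simp_all add: M.gsum_hom[OF modules(3) pure_mult_inner_linear])
qed

lemma pure_mult_bilinear1: "b \<in> carrier N \<Longrightarrow> a \<in> carrier M \<Longrightarrow> cq_bilinear M N T (pure_mult a b)"
  by (simp add: cq_bilinear_def pure_mult_linear3 pure_mult_linear4)

lemma pure_mult_bilinear2:
  assumes "Y \<in> carrier T"
  shows "cq_bilinear M N T (\<lambda>a b. tensor_lift T (pure_mult a b) Y)"
  using assms by (auto simp: cq_bilinear_def
      intro!: tensor_lift_param_linear pure_mult_linear1 pure_mult_linear2 modules)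

lemma cls_pure_mult:
  assumes "a \<in> carrier M" "b \<in> carrier N" "c \<in> carrier M" "d \<in> carrier N"
  shows "cls (\<Sum>\<beta>\<in>hom_supp N b. \<Sum>\<gamma>\<in>hom_supp M c.
      Poly_Mapping.single (a \<otimes>\<^bsub>M\<^esub> hom_comp M c \<gamma>, hom_comp N b \<beta> \<otimes>\<^bsub>N\<^esub> d) (k * w \<beta> \<gamma>))
    = k \<odot>\<^bsub>T\<^esub> pure_mult a b c d" (is "cls (\<Sum>\<beta>\<in>_. \<Sum>\<gamma>\<in>_. ?f \<beta> \<gamma>) = _")
proof -
  have f: "?f \<beta> \<gamma> \<in> free" for \<beta> \<gamma> using assms by simp
  have c: "w \<beta> \<gamma> \<odot>\<^bsub>T\<^esub> ((a \<otimes>\<^bsub>M\<^esub> hom_comp M c \<gamma>) \<boxtimes> (hom_comp N b \<beta> \<otimes>\<^bsub>N\<^esub> d)) \<in> carrier T" for \<beta> \<gamma>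
    using assms by simp
  have "cls (\<Sum>\<beta>\<in>hom_supp N b. \<Sum>\<gamma>\<in>hom_supp M c. ?f \<beta> \<gamma>)
      = (\<Oplus>\<^bsub>T\<^esub>\<beta>\<in>hom_supp N b. cls (\<Sum>\<gamma>\<in>hom_supp M c. ?f \<beta> \<gamma>))"
    using assms f by (intro cls_sum free_sum) auto
  also have "\<dots> = (\<Oplus>\<^bsub>T\<^esub>\<beta>\<in>hom_supp N b. \<Oplus>\<^bsub>T\<^esub>\<gamma>\<in>hom_supp M c. cls (?f \<beta> \<gamma>))"
    using assms f by (simp add: cls_sum)
  also have "\<dots> = (\<Oplus>\<^bsub>T\<^esub>\<beta>\<in>hom_supp N b. \<Oplus>\<^bsub>T\<^esub>\<gamma>\<in>hom_supp M c. k \<odot>\<^bsub>T\<^esub>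
     (w \<beta> \<gamma> \<odot>\<^bsub>T\<^esub> ((a \<otimes>\<^bsub>M\<^esub> hom_comp M c \<gamma>) \<boxtimes> (hom_comp N b \<beta> \<otimes>\<^bsub>N\<^esub> d))))"
    using assms by (simp add: cls_single T.smult_smult)
  also have "\<dots> = k \<odot>\<^bsub>T\<^esub> pure_mult a b c d"
    unfolding pure_mult_def gsum_def using assms c
    by (simp add: T.finsum_smult_ldistr Pi_iff)
  finally show ?thesis .
qed

text \<open>The product was introduced by sums over representatives. Rewritten as a double lift of
  \<open>pure_mult\<close>, it inherits well-definedness and bilinearity from
  \<open>tensor_lift\<close>.\<close>

lemma mult_eq_lift:
  assumes "X \<in> carrier T" "Y \<in> carrier T"
  shows "X \<otimes>\<^bsub>T\<^esub> Y = tensor_lift T (\<lambda>a b. tensor_lift T (pure_mult a b) Y) X"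
proof -
  obtain p0 where p0: "p0 \<in> free" "X = cls p0" using assms(1) by (elim carrier_cases)
  obtain p0' where p0': "p0' \<in> free" "Y = cls p0'" using assms(2) by (elim carrier_cases)
  let ?p = "tensor_rep X" and ?p' = "tensor_rep Y"
  let ?K = "Poly_Mapping.keys ?p" and ?K' = "Poly_Mapping.keys ?p'"
  have k: "fst z \<in> carrier M" "snd z \<in> carrier N" if "z \<in> ?K" for z
    using rep_free[OF p0(1)] p0(2) that by (auto simp: tensor_free_def)
  have k': "fst z \<in> carrier M" "snd z \<in> carrier N" if "z \<in> ?K'" for z
    using rep_free[OF p0'(1)] p0'(2) that by (auto simp: tensor_free_def)
  let ?g = "\<lambda>z z'. (\<Sum>\<beta> \<in> hom_supp N (snd z). \<Sum>\<gamma> \<in> hom_supp M (fst z').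
            Poly_Mapping.single (fst z \<otimes>\<^bsub>M\<^esub> hom_comp M (fst z') \<gamma>, hom_comp N (snd z) \<beta> \<otimes>\<^bsub>N\<^esub> snd z')
              (Poly_Mapping.lookup ?p z * Poly_Mapping.lookup ?p' z' * w \<beta> \<gamma>))"
  have f: "?g z z' \<in> free" if "z \<in> ?K" "z' \<in> ?K'" for z z'
    using k[OF that(1)] k'[OF that(2)] by (intro free_sum) simp
  have c: "pure_mult (fst z) (snd z) (fst z') (snd z') \<in> carrier T"
    if "z \<in> ?K" "z' \<in> ?K'" for z z'
    using k[OF that(1)] k'[OF that(2)] by (intro pure_mult_closed)
  have "X \<otimes>\<^bsub>T\<^esub> Y = cls (\<Sum>z\<in>?K. \<Sum>z'\<in>?K'. ?g z z')"
    by (simp add: tensor_alg_simps tensor_mult_def Let_def case_prod_beta)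
  also have "\<dots> = (\<Oplus>\<^bsub>T\<^esub>z\<in>?K. cls (\<Sum>z'\<in>?K'. ?g z z'))"
    by (rule cls_sum[OF finite_keys], rule free_sum, rule f)
  also have "\<dots> = (\<Oplus>\<^bsub>T\<^esub>z\<in>?K. Poly_Mapping.lookup ?p z \<odot>\<^bsub>T\<^esub> tensor_lift T (pure_mult (fst z) (snd z)) Y)"
  proof (rule T.M.finsum_cong'[OF refl])
    show "(\<lambda>z. Poly_Mapping.lookup ?p z \<odot>\<^bsub>T\<^esub> tensor_lift T (pure_mult (fst z) (snd z)) Y) \<in> ?K \<rightarrow> carrier T"
      using k cq_linear_closed[OF tensor_lift_linear[OF modules(3) pure_mult_bilinear1] assms(2)]
      by auto
    fix z assume z: "z \<in> ?K"
    have "cls (\<Sum>z'\<in>?K'. ?g z z') = (\<Oplus>\<^bsub>T\<^esub>z'\<in>?K'. cls (?g z z'))"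
      using f[OF z] by (intro cls_sum) auto
    also have "\<dots> = (\<Oplus>\<^bsub>T\<^esub>z'\<in>?K'. Poly_Mapping.lookup ?p z \<odot>\<^bsub>T\<^esub>
        (Poly_Mapping.lookup ?p' z' \<odot>\<^bsub>T\<^esub> pure_mult (fst z) (snd z) (fst z') (snd z')))"
      using k[OF z] k' c[OF z]
      by (intro T.M.finsum_cong') (auto simp: cls_pure_mult T.smult_smult)
    also have "\<dots> = Poly_Mapping.lookup ?p z \<odot>\<^bsub>T\<^esub> tensor_lift T (pure_mult (fst z) (snd z)) Y"
      unfolding tensor_lift_def Let_def using c[OF z]
      by (intro T.finsum_smult_ldistr[symmetric]) auto
    finally show "cls (\<Sum>z'\<in>?K'. ?g z z') =
      Poly_Mapping.lookup ?p z \<odot>\<^bsub>T\<^esub> tensor_lift T (pure_mult (fst z) (snd z)) Y" .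
  qed
  also have "\<dots> = tensor_lift T (\<lambda>a b. tensor_lift T (pure_mult a b) Y) X"
    by (simp add: tensor_lift_def[of T "\<lambda>a b. tensor_lift T (pure_mult a b) Y"] Let_def)
  finally show ?thesis .
qed

lemma T_mult_linear_left: "Y \<in> carrier T \<Longrightarrow> cq_linear T T (\<lambda>X. X \<otimes>\<^bsub>T\<^esub> Y)"
  by (subst cq_linear_cong[OF modules(3) mult_eq_lift])
    (auto intro!: tensor_lift_linear modules pure_mult_bilinear2)

lemma T_mult_linear_right:
  assumes "X \<in> carrier T"
  shows "cq_linear T T (\<lambda>Y. X \<otimes>\<^bsub>T\<^esub> Y)"
  by (subst cq_linear_cong[OF modules(3) mult_eq_lift])
    (use assms in \<open>auto intro!: tensor_lift_param_linear tensor_lift_linear modules pure_mult_bilinear1\<close>)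

lemma mult_pure:
  assumes "a \<in> carrier M" "b \<in> hom_part N \<beta>" "c \<in> hom_part M \<gamma>" "d \<in> carrier N"
  shows "(a \<boxtimes> b) \<otimes>\<^bsub>T\<^esub> (c \<boxtimes> d) = w \<beta> \<gamma> \<odot>\<^bsub>T\<^esub> ((a \<otimes>\<^bsub>M\<^esub> c) \<boxtimes> (b \<otimes>\<^bsub>N\<^esub> d))"
proof -
  have "b \<in> carrier N" "c \<in> carrier M" using assms N.hom_carrier M.hom_carrier by auto
  with assms show ?thesis
    by (simp add: mult_eq_lift tensor_lift_pure[OF modules(3) pure_mult_bilinear2]
        tensor_lift_pure[OF modules(3) pure_mult_bilinear1] pure_mult_hom)
qed

text \<open>Splitting both factors of a pure tensor into components shows that homogeneous pure
  tensors generate \<open>T\<close> additively; on them \<open>mult_pure\<close> computes the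
  product.\<close>

lemma homogeneous_induct [consumes 1, case_names pure add]:
  assumes "X \<in> carrier T"
    "\<And>\<alpha> \<beta> x y. x \<in> hom_part M \<alpha> \<Longrightarrow> y \<in> hom_part N \<beta> \<Longrightarrow> Q (x \<boxtimes> y)"
    "\<And>X Y. X \<in> carrier T \<Longrightarrow> Y \<in> carrier T \<Longrightarrow> Q X \<Longrightarrow> Q Y \<Longrightarrow> Q (X \<oplus>\<^bsub>T\<^esub> Y)"
  shows "Q X"
  using assms(1)
proof (induction rule: tensor_induct)
  case (pure x y)
  from \<open>x \<in> carrier M\<close> show ?case
  proof (induction rule: M.hom_induct)
    case (hom \<alpha> x)
    from \<open>y \<in> carrier N\<close> show ?case
    proof (induction rule: N.hom_induct)
      case (hom \<beta> y)
      show ?case by (rule assms(2)) fact+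
    next
      case (add y y')
      then show ?case using hom M.hom_carrier by (simp add: pure_add_right assms(3))
    qed
  next
    case (add x x')
    then show ?case using pure by (simp add: pure_add_left assms(3))
  qed
qed (rule assms(3))

section \<open>The grading of the tensor product\<close>

lemma hom_part_T:
  "hom_part T \<gamma> = cls ` {p. \<forall>(x, y) \<in> Poly_Mapping.keys p.
             \<exists>\<alpha> \<beta>. x \<in> hom_part M \<alpha> \<and> y \<in> hom_part N \<beta> \<and> \<alpha> + \<beta> = \<gamma>}" (is "_ = cls ` ?F")
  by (simp add: tensor_alg_def)

lemma hom_part_T_free:
  assumes "\<forall>(x, y) \<in> Poly_Mapping.keys p. \<exists>\<alpha> \<beta>. x \<in> hom_part M \<alpha> \<and> y \<in> hom_part N \<beta> \<and> \<alpha> + \<beta> = \<gamma>"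
  shows "p \<in> free"
  using assms M.hom_carrier N.hom_carrier by (fastforce simp: tensor_free_def)

lemma pure_hom:
  assumes "x \<in> hom_part M \<alpha>" "y \<in> hom_part N \<beta>" "\<alpha> + \<beta> = \<gamma>"
  shows "x \<boxtimes> y \<in> hom_part T \<gamma>"
  unfolding hom_part_T pure_tensor_def using assms by (intro imageI) auto

lemma T_hom_induct [consumes 1, case_names pure add]:
  assumes "X \<in> hom_part T \<gamma>"
    "\<And>\<alpha> \<beta> x y. x \<in> hom_part M \<alpha> \<Longrightarrow> y \<in> hom_part N \<beta> \<Longrightarrow> \<alpha> + \<beta> = \<gamma> \<Longrightarrow> Q (x \<boxtimes> y)"
    "\<And>X Y. X \<in> carrier T \<Longrightarrow> Y \<in> carrier T \<Longrightarrow> Q X \<Longrightarrow> Q Y \<Longrightarrow> Q (X \<oplus>\<^bsub>T\<^esub> Y)"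
  shows "Q X"
proof -
  obtain p where p: "X = cls p" and
    k: "\<forall>(x, y) \<in> Poly_Mapping.keys p. \<exists>\<alpha> \<beta>. x \<in> hom_part M \<alpha> \<and> y \<in> hom_part N \<beta> \<and> \<alpha> + \<beta> = \<gamma>"
    using assms(1) unfolding hom_part_T by blast
  have f: "p \<in> free" by (rule hom_part_T_free[OF k])
  have c: "fst z \<boxtimes> snd z \<in> carrier T" if "z \<in> Poly_Mapping.keys p" for z
    using f that by (intro pure_closed) (auto simp: tensor_free_def)
  have "\<zero>\<^bsub>M\<^esub> \<boxtimes> \<zero>\<^bsub>N\<^esub> = \<zero>\<^bsub>T\<^esub>"
    using pure_smult_left[of "\<zero>\<^bsub>M\<^esub>" "\<zero>\<^bsub>N\<^esub>" 0] by simp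
  \<comment> \<open>Zero has every degree, so the splitting of \<open>\<gamma>\<close> as
    \<open>\<gamma> + 0\<close> is as good as any other.\<close>
  then have "Q \<zero>\<^bsub>T\<^esub>" using assms(2)[of "\<zero>\<^bsub>M\<^esub>" \<gamma> "\<zero>\<^bsub>N\<^esub>" 0] by simp
  moreover have "Q (c \<odot>\<^bsub>T\<^esub> (fst z \<boxtimes> snd z))" if z: "z \<in> Poly_Mapping.keys p" for z c
  proof -
    obtain \<alpha> \<beta> where h: "fst z \<in> hom_part M \<alpha>" "snd z \<in> hom_part N \<beta>" "\<alpha> + \<beta> = \<gamma>"
      using k z by fastforce
    then show ?thesis
      using assms(2)[OF M.hom_smult[OF h(1)] h(2,3), of c] M.hom_carrier N.hom_carrier
      by (simp add: pure_smult_left)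
  qed
  ultimately show ?thesis
    unfolding p cls_eq_finsum[OF f]
    by (rule_tac T.finsum_induct[where Q = Q]) (simp_all add: c assms(3))
qed

lemma T_hom_carrier: "X \<in> hom_part T \<gamma> \<Longrightarrow> X \<in> carrier T"
  unfolding hom_part_T using hom_part_T_free by (auto intro!: cls_closed)

lemma T_hom_submodule: "submodule (hom_part T \<gamma>) Cq T"
proof (rule T.submoduleI)
  let ?F = "{p. \<forall>(x, y) \<in> Poly_Mapping.keys p.
             \<exists>\<alpha> \<beta>. x \<in> hom_part M \<alpha> \<and> y \<in> hom_part N \<beta> \<and> \<alpha> + \<beta> = \<gamma>}"
  show "hom_part T \<gamma> \<subseteq> carrier T" using T_hom_carrier by auto
  show "\<zero>\<^bsub>T\<^esub> \<in> hom_part T \<gamma>"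
    unfolding hom_part_T cls_zero by (intro imageI) auto
  show sm: "c \<odot>\<^bsub>T\<^esub> X \<in> hom_part T \<gamma>" if X: "X \<in> hom_part T \<gamma>" for c X
  proof -
    obtain p where "X = cls p" "p \<in> ?F" using X unfolding hom_part_T by blast
    then show ?thesis
      unfolding hom_part_T using keys_fscale[of c p]
      by (simp only: cls_smult, intro imageI) blast
  qed
  show "\<ominus>\<^bsub>T\<^esub> X \<in> hom_part T \<gamma>" if X: "X \<in> hom_part T \<gamma>" for X
    using sm[OF X, of "- 1"] T_hom_carrier[OF X] by (simp add: T.smult_minus_one)
  show "X \<oplus>\<^bsub>T\<^esub> Y \<in> hom_part T \<gamma>" if X: "X \<in> hom_part T \<gamma>" and Y: "Y \<in> hom_part T \<gamma>" for X Y
  proof -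
    obtain p q where "X = cls p" "p \<in> ?F" "Y = cls q" "q \<in> ?F"
      using X Y unfolding hom_part_T by blast
    then show ?thesis
      unfolding hom_part_T using keys_add[of p q]
      by (simp only: cls_add, intro imageI) blast
  qed
qed

lemma T_mult_closed: "X \<in> carrier T \<Longrightarrow> Y \<in> carrier T \<Longrightarrow> X \<otimes>\<^bsub>T\<^esub> Y \<in> carrier T"
  by (rule cq_linear_closed[OF T_mult_linear_left])

lemma T_l_distr:
  "X \<in> carrier T \<Longrightarrow> Y \<in> carrier T \<Longrightarrow> Z \<in> carrier T \<Longrightarrow>
     (X \<oplus>\<^bsub>T\<^esub> Y) \<otimes>\<^bsub>T\<^esub> Z = X \<otimes>\<^bsub>T\<^esub> Z \<oplus>\<^bsub>T\<^esub> Y \<otimes>\<^bsub>T\<^esub> Z"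
  by (rule cq_linear_add[OF T_mult_linear_left])

lemma T_r_distr:
  "X \<in> carrier T \<Longrightarrow> Y \<in> carrier T \<Longrightarrow> Z \<in> carrier T \<Longrightarrow>
     Z \<otimes>\<^bsub>T\<^esub> (X \<oplus>\<^bsub>T\<^esub> Y) = Z \<otimes>\<^bsub>T\<^esub> X \<oplus>\<^bsub>T\<^esub> Z \<otimes>\<^bsub>T\<^esub> Y"
  by (rule cq_linear_add[OF T_mult_linear_right])

lemma T_smult_left:
  "X \<in> carrier T \<Longrightarrow> Y \<in> carrier T \<Longrightarrow> (c \<odot>\<^bsub>T\<^esub> X) \<otimes>\<^bsub>T\<^esub> Y = c \<odot>\<^bsub>T\<^esub> (X \<otimes>\<^bsub>T\<^esub> Y)"
  by (rule cq_linear_smult[OF T_mult_linear_left])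

lemma T_smult_right:
  "X \<in> carrier T \<Longrightarrow> Y \<in> carrier T \<Longrightarrow> X \<otimes>\<^bsub>T\<^esub> (c \<odot>\<^bsub>T\<^esub> Y) = c \<odot>\<^bsub>T\<^esub> (X \<otimes>\<^bsub>T\<^esub> Y)"
  by (rule cq_linear_smult[OF T_mult_linear_right])

text \<open>For homogeneous pure tensors both bracketings move \<open>x'\<close> past
  \<open>y\<close> and \<open>z\<close>, and \<open>y'\<close> past \<open>z\<close>; the common
  factor is \<open>w \<alpha>' \<beta> * w \<alpha>' \<gamma> * w \<beta>' \<gamma>\<close>.\<close>

lemma T_assoc:
  assumes "X \<in> carrier T" "Y \<in> carrier T" "Z \<in> carrier T"
  shows "X \<otimes>\<^bsub>T\<^esub> Y \<otimes>\<^bsub>T\<^esub> Z = X \<otimes>\<^bsub>T\<^esub> (Y \<otimes>\<^bsub>T\<^esub> Z)"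
  using assms(1)
proof (induction rule: homogeneous_induct)
  case (add X X')
  then show ?case using assms by (simp add: T_l_distr T_mult_closed)
next
  case x: (pure \<alpha> \<alpha>' x x')
  from assms(2) show ?case
  proof (induction rule: homogeneous_induct)
    case (add Y Y')
    then show ?case using x M.hom_carrier N.hom_carrier assms
      by (simp add: T_l_distr T_r_distr T_mult_closed)
  next
    case y: (pure \<beta> \<beta>' y y')
    from assms(3) show ?case
    proof (induction rule: homogeneous_induct)
      case (add Z Z')
      then show ?case using x y M.hom_carrier N.hom_carrier
        by (simp add: T_r_distr T_mult_closed)
    next
      case z: (pure \<gamma> \<gamma>' z z')
      have c: "x \<in> carrier M" "y \<in> carrier M" "z \<in> carrier M" "x' \<in> carrier N" "y' \<in> carrier N" "z' \<in> carrier N"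
        using x y z M.hom_carrier N.hom_carrier by auto
      note h = M.hom_mult[OF y(1) z(1) refl] N.hom_mult[OF x(2) y(2) refl]
      show ?case
        using c x y z h
        by (simp add: mult_pure[where \<beta> = \<alpha>' and \<gamma> = \<beta>] mult_pure[where \<beta> = \<beta>' and \<gamma> = \<gamma>]
            mult_pure[where \<beta> = "\<alpha>' + \<beta>'" and \<gamma> = \<gamma>] mult_pure[where \<beta> = \<alpha>' and \<gamma> = "\<beta> + \<gamma>"]
            T_smult_left T_smult_right T.smult_smult w_add_left w_add_right M.m_assoc N.m_assoc mult_ac)
    qed
  qed
qed

lemma T_one_closed: "\<one>\<^bsub>T\<^esub> \<in> carrier T"
  by (simp add: tensor_alg_simps(3))

lemma T_one_left: "X \<in> carrier T \<Longrightarrow> \<one>\<^bsub>T\<^esub> \<otimes>\<^bsub>T\<^esub> X = X"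
proof (induction rule: homogeneous_induct)
  case (pure \<alpha> \<beta> x y)
  then show ?case
    using mult_pure[OF M.one_closed N.one_hom_part pure(1), of y] M.hom_carrier N.hom_carrier
    by (simp add: tensor_alg_simps(3))
qed (simp add: T_r_distr T_one_closed)

lemma T_one_right: "X \<in> carrier T \<Longrightarrow> X \<otimes>\<^bsub>T\<^esub> \<one>\<^bsub>T\<^esub> = X"
proof (induction rule: homogeneous_induct)
  case (pure \<alpha> \<beta> x y)
  then show ?case
    using mult_pure[OF _ pure(2) M.one_hom_part N.one_closed, of x] M.hom_carrier N.hom_carrier
    by (simp add: tensor_alg_simps(3))
qed (simp add: T_l_distr T_one_closed)

lemma T_ring: "ring T"
  by (assumption | rule ringI monoidI T.M.abelian_group_axioms T_mult_closed T_assoc T_one_closed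
      T_one_left T_one_right T_l_distr T_r_distr)+

lemma T_mult_hom:
  assumes "X \<in> hom_part T \<alpha>" "Y \<in> hom_part T \<beta>"
  shows "X \<otimes>\<^bsub>T\<^esub> Y \<in> hom_part T (\<alpha> + \<beta>)"
  using assms(1)
proof (induction rule: T_hom_induct)
  case (add X X')
  then show ?case
    using T_hom_carrier[OF assms(2)] T.submoduleE(5)[OF T_hom_submodule] by (simp add: T_l_distr)
next
  case x: (pure \<gamma> \<gamma>' x x')
  have cx: "x \<boxtimes> x' \<in> carrier T" using x M.hom_carrier N.hom_carrier by auto
  from assms(2) show ?case
  proof (induction rule: T_hom_induct)
    case (add Y Y')
    then show ?case
      using cx T.submoduleE(5)[OF T_hom_submodule] by (simp add: T_r_distr)
  next
    case y: (pure \<delta> \<delta>' y y')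
    have "(x \<otimes>\<^bsub>M\<^esub> y) \<boxtimes> (x' \<otimes>\<^bsub>N\<^esub> y') \<in> hom_part T (\<alpha> + \<beta>)"
      using x y by (intro pure_hom[OF M.mult_hom_part N.mult_hom_part]) (auto simp: algebra_simps)
    then show ?case
      using x y M.hom_carrier N.hom_carrier T.submoduleE(4)[OF T_hom_submodule]
      by (simp add: mult_pure[OF _ x(2) y(1)])
  qed
qed

text \<open>The candidate projection onto degree \<open>\<gamma>\<close> for
  \<open>direct_sumI\<close>: of all pairs of components only those with
  \<open>\<alpha> + \<beta> = \<gamma>\<close> are kept. As a lift of a bilinear map it is well
  defined on classes.\<close>

definition T_proj where
  "T_proj \<gamma> = tensor_lift T (\<lambda>x y. gsum M T (\<lambda>\<alpha> x'. gsum N T (\<lambda>\<beta> y'.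
      if \<alpha> + \<beta> = \<gamma> then x' \<boxtimes> y' else \<zero>\<^bsub>T\<^esub>) y) x)"

lemma T_proj_inner1:
  "x' \<in> carrier M \<Longrightarrow> cq_linear N T (\<lambda>y'. if b then x' \<boxtimes> y' else \<zero>\<^bsub>T\<^esub>)"
  by (cases b) (auto intro: pure_linear_right cq_linear_zero_map modules)

lemma T_proj_inner2:
  "y' \<in> carrier N \<Longrightarrow> cq_linear M T (\<lambda>x'. if b then x' \<boxtimes> y' else \<zero>\<^bsub>T\<^esub>)"
  by (cases b) (auto intro: pure_linear_left cq_linear_zero_map modules)

lemma T_proj_outer:
  assumes "y \<in> carrier N"
  shows "cq_linear M T (\<lambda>x'. gsum N T (\<lambda>\<beta> y'. if \<alpha> + \<beta> = \<gamma> then x' \<boxtimes> y' else \<zero>\<^bsub>T\<^esub>) y)"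
  using assms by (intro N.gsum_param_linear modules T_proj_inner2)

lemma T_proj_bilinear:
  "cq_bilinear M N T (\<lambda>x y. gsum M T (\<lambda>\<alpha> x'. gsum N T (\<lambda>\<beta> y'.
      if \<alpha> + \<beta> = \<gamma> then x' \<boxtimes> y' else \<zero>\<^bsub>T\<^esub>) y) x)"
  unfolding cq_bilinear_def
  by (intro conjI ballI M.gsum_param_linear M.gsum_linear N.gsum_linear modules T_proj_inner1
      T_proj_outer)

lemma T_proj_pure:
  assumes "x \<in> hom_part M \<alpha>" "y \<in> hom_part N \<beta>"
  shows "T_proj \<gamma> (x \<boxtimes> y) = (if \<alpha> + \<beta> = \<gamma> then x \<boxtimes> y else \<zero>\<^bsub>T\<^esub>)"
proof -
  have c: "x \<in> carrier M" "y \<in> carrier N" using assms M.hom_carrier N.hom_carrier by auto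
  have "T_proj \<gamma> (x \<boxtimes> y) = gsum M T (\<lambda>\<alpha> x'. gsum N T (\<lambda>\<beta> y'.
      if \<alpha> + \<beta> = \<gamma> then x' \<boxtimes> y' else \<zero>\<^bsub>T\<^esub>) y) x"
    unfolding T_proj_def by (rule tensor_lift_pure[OF modules(3) T_proj_bilinear c])
  also have "\<dots> = gsum N T (\<lambda>\<beta> y'. if \<alpha> + \<beta> = \<gamma> then x \<boxtimes> y' else \<zero>\<^bsub>T\<^esub>) y"
    by (rule M.gsum_hom[OF modules(3) T_proj_outer assms(1)]) fact
  also have "\<dots> = (if \<alpha> + \<beta> = \<gamma> then x \<boxtimes> y else \<zero>\<^bsub>T\<^esub>)"
    by (rule N.gsum_hom[OF modules(3) T_proj_inner1 assms(2)]) fact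
  finally show ?thesis .
qed

lemma T_proj_linear: "cq_linear T T (T_proj \<gamma>)"
  unfolding T_proj_def by (rule tensor_lift_linear[OF modules(3) T_proj_bilinear])

lemma T_direct_sum:
  assumes "X \<in> carrier T"
  shows "\<exists>!f. hom_decomp T X f"
proof (rule T.direct_sumI[where \<pi> = T_proj, OF T_hom_submodule _ T_proj_linear _ _ assms])
  fix Q :: "('a \<times> 'b \<Rightarrow>\<^sub>0 cq) set \<Rightarrow> bool" and X
  assume X: "X \<in> carrier T" and Q: "\<And>\<gamma> Y. Y \<in> hom_part T \<gamma> \<Longrightarrow> Q Y"
    "\<And>Y Z. Y \<in> carrier T \<Longrightarrow> Z \<in> carrier T \<Longrightarrow> Q Y \<Longrightarrow> Q Z \<Longrightarrow> Q (Y \<oplus>\<^bsub>T\<^esub> Z)"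
  from X show "Q X"
    by (induction rule: homogeneous_induct) (auto intro: Q(1)[OF pure_hom[OF _ _ refl]] Q(2))
next
  fix \<gamma> X assume "X \<in> hom_part T \<gamma>"
  then show "T_proj \<gamma> X = X"
    by (induction rule: T_hom_induct)
      (simp_all add: T_proj_pure cq_linear_add[OF T_proj_linear])
next
  fix \<gamma> \<delta> X assume "X \<in> hom_part T \<delta>" "\<gamma> \<noteq> \<delta>"
  then show "T_proj \<gamma> X = \<zero>\<^bsub>T\<^esub>"
    by (induction rule: T_hom_induct)
      (auto simp: T_proj_pure cq_linear_add[OF T_proj_linear])
qed

lemma T_gamma_algebra: "gamma_algebra T"
proof (intro gamma_algebra.intro gamma_algebra_axioms.intro)
  show "\<one>\<^bsub>T\<^esub> \<in> hom_part T 0"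
    using pure_hom[OF M.one_hom_part N.one_hom_part] by (simp add: tensor_alg_simps(3))
qed (assumption | rule T_ring T.module_axioms T_smult_left T_smult_right T_hom_submodule
    T_mult_hom T_direct_sum)+

end

sublocale tensor_algebras \<subseteq> T: gamma_algebra "tensor_alg \<omega> M N"
  by (rule T_gamma_algebra)

section \<open>Maps between tensor products and the opposite algebra\<close>

text \<open>Serves the algebras that share their additive group with a known structure and differ in
  multiplication, scalars or grading.\<close>

lemma abelian_group_cong:
  assumes "abelian_group R" "carrier R' = carrier R" "add R' = add R" "zero R' = zero R"
  shows "abelian_group R'"
proof -
  interpret abelian_group R by fact
  show ?thesis
    by (rule abelian_groupI)
      (auto simp: assms(2-4) a_ac intro: bexI[of _ "\<ominus>\<^bsub>R\<^esub> _"] l_neg)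
qed

lemma Cq_alg_simps [simp]:
  "carrier Cq_alg = UNIV" "mult Cq_alg = (*)" "one Cq_alg = 1" "zero Cq_alg = 0"
  "add Cq_alg = (+)" "smult Cq_alg = (*)"
  "hom_part Cq_alg \<gamma> = (if \<gamma> = 0 then UNIV else {0})"
  by (simp_all add: Cq_alg_def)

lemma Cq_alg_gamma_algebra: "gamma_algebra (Cq_alg :: (cq, 'g::ab_group_add) graded_algebra)"
proof -
  let ?C = "Cq_alg :: (cq, 'g) graded_algebra"
  have ag: "abelian_group ?C"
    by (rule abelian_group_cong[of Cq]) (use cring_Cq in \<open>simp_all add: cring.axioms ring.axioms\<close>)
  have mod: "cq_module ?C"
    by (intro cq_module.intro moduleI cring_Cq ag) (simp_all add: algebra_simps)
  then interpret cq_module ?C .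
  have sub: "submodule (hom_part ?C \<gamma>) Cq ?C" for \<gamma>
    by (rule submoduleI) (auto simp: smult_minus_one split: if_splits)
  show ?thesis
  proof (intro gamma_algebra.intro gamma_algebra_axioms.intro module_axioms sub)
    show "ring ?C"
      by (intro ringI ag monoidI) (simp_all add: algebra_simps)
    fix x assume "x \<in> carrier ?C"
    then show "\<exists>!f. hom_decomp ?C x f"
    proof (rule direct_sumI[where \<pi> = "\<lambda>\<gamma> x. if \<gamma> = 0 then x else 0", OF sub, rotated -1])
      show "Q x" if "\<And>\<gamma> y. y \<in> hom_part ?C \<gamma> \<Longrightarrow> Q y" for Q x
        using that[of x 0] by simp
    qed (auto simp: cq_linear_def split: if_splits)
  qed (auto split: if_splits)
qed

text \<open>Both sides of multiplicativity are additive in each argument and homogeneous pure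
  tensors generate \<open>T\<close>. The condition on products is stated with
  \<open>mult_pure\<close> already applied, so the product of \<open>T\<close> does not occur in
  it.\<close>

lemma (in tensor_algebras) tensor_gamma_homI:
  assumes P: "gamma_algebra P" and lin: "cq_linear T P \<Phi>"
    and deg: "\<And>\<alpha> \<beta> x y. x \<in> hom_part M \<alpha> \<Longrightarrow> y \<in> hom_part N \<beta> \<Longrightarrow> \<Phi> (x \<boxtimes> y) \<in> hom_part P (\<alpha> + \<beta>)"
    and mul: "\<And>\<alpha> \<beta> \<gamma> \<delta> a b c d. a \<in> hom_part M \<alpha> \<Longrightarrow> b \<in> hom_part N \<beta> \<Longrightarrow>
       c \<in> hom_part M \<gamma> \<Longrightarrow> d \<in> hom_part N \<delta> \<Longrightarrow>
       w \<beta> \<gamma> \<odot>\<^bsub>P\<^esub> \<Phi> ((a \<otimes>\<^bsub>M\<^esub> c) \<boxtimes> (b \<otimes>\<^bsub>N\<^esub> d)) = \<Phi> (a \<boxtimes> b) \<otimes>\<^bsub>P\<^esub> \<Phi> (c \<boxtimes> d)"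
    and one: "\<Phi> (\<one>\<^bsub>M\<^esub> \<boxtimes> \<one>\<^bsub>N\<^esub>) = \<one>\<^bsub>P\<^esub>"
  shows "gamma_hom T P \<Phi>"
proof (rule gamma_homI[OF lin])
  interpret P: gamma_algebra P by fact
  fix \<gamma> X assume "X \<in> hom_part T \<gamma>"
  then show "\<Phi> X \<in> hom_part P \<gamma>"
    by (induction rule: T_hom_induct) (auto simp: cq_linear_add[OF lin] P.hom_add dest: deg)
next
  interpret P: gamma_algebra P by fact
  note [simp] = cq_linear_add[OF lin] cq_linear_closed[OF lin] P.l_distr P.r_distr
    T.l_distr T.r_distr
  fix X Y assume X: "X \<in> carrier T" and Y: "Y \<in> carrier T"
  from X show "\<Phi> (X \<otimes>\<^bsub>T\<^esub> Y) = \<Phi> X \<otimes>\<^bsub>P\<^esub> \<Phi> Y"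
  proof (induction X rule: homogeneous_induct)
    case ab: (pure \<alpha> \<beta> a b)
    then have abT: "a \<boxtimes> b \<in> carrier T" using M.hom_carrier N.hom_carrier by auto
    from Y show ?case
    proof (induction rule: homogeneous_induct)
      case (pure \<gamma> \<delta> c d)
      then show ?case
        using ab mul[OF ab pure] M.hom_carrier N.hom_carrier
        by (simp add: mult_pure[OF _ ab(2) pure(1)] cq_linear_smult[OF lin])
    qed (use abT in simp)
  qed (use Y in simp)
qed (use one in \<open>simp add: tensor_alg_simps(3)\<close>)

lemma
  assumes tens: "tensor_modules M N" "tensor_modules M' N'" and f: "cq_linear M M' f" and g: "cq_linear N N' g"
  shows tensor_map_linear:
      "cq_linear (tensor_alg \<omega> M N) (tensor_alg \<omega> M' N') (tensor_map \<omega> M' N' f g)"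
    and tensor_map_pure: "x \<in> carrier M \<Longrightarrow> y \<in> carrier N \<Longrightarrow>
      tensor_map \<omega> M' N' f g (pure_tensor M N x y) = pure_tensor M' N' (f x) (g y)"
proof -
  interpret A: tensor_modules \<omega> M N by fact
  interpret B: tensor_modules \<omega> M' N' by fact
  have bil: "cq_bilinear M N (tensor_alg \<omega> M' N') (\<lambda>x y. pure_tensor M' N' (f x) (g y))"
    using cq_linear_comp[OF f B.pure_linear_left] cq_linear_comp[OF g B.pure_linear_right]
      cq_linear_closed[OF f] cq_linear_closed[OF g]
    by (simp add: cq_bilinear_def)
  show "cq_linear (tensor_alg \<omega> M N) (tensor_alg \<omega> M' N') (tensor_map \<omega> M' N' f g)"
    unfolding tensor_map_def by (rule A.tensor_lift_linear[OF B.T.cq_module_axioms bil])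
  show "x \<in> carrier M \<Longrightarrow> y \<in> carrier N \<Longrightarrow>
      tensor_map \<omega> M' N' f g (pure_tensor M N x y) = pure_tensor M' N' (f x) (g y)"
    unfolding tensor_map_def by (rule A.tensor_lift_pure[OF B.T.cq_module_axioms bil])
qed

text \<open>The maps preserve degrees, so interchanging the middle factors costs the same
  \<open>w \<beta> \<gamma>\<close> before and after applying them.\<close>

lemma tensor_map_gamma_hom:
  assumes tens: "tensor_algebras \<omega> M N" "tensor_algebras \<omega> M' N'"
    and f: "gamma_hom M M' f" and g: "gamma_hom N N' g"
  shows "gamma_hom (tensor_alg \<omega> M N) (tensor_alg \<omega> M' N') (tensor_map \<omega> M' N' f g)"
proof -
  interpret A: tensor_algebras \<omega> M N by fact
  interpret B: tensor_algebras \<omega> M' N' by fact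
  note tm = A.tensor_modules_axioms B.tensor_modules_axioms gamma_hom_linear[OF f] gamma_hom_linear[OF g]
  show ?thesis
  proof (rule A.tensor_gamma_homI[OF B.T.gamma_algebra_axioms tensor_map_linear[OF tm]])
    fix \<alpha> \<beta> x y assume "x \<in> hom_part M \<alpha>" "y \<in> hom_part N \<beta>"
    then show "tensor_map \<omega> M' N' f g (pure_tensor M N x y) \<in> hom_part B.T (\<alpha> + \<beta>)"
      using A.M.hom_carrier A.N.hom_carrier
        B.pure_hom[OF gamma_hom_degree[OF f] gamma_hom_degree[OF g] refl]
      by (simp add: tensor_map_pure[OF tm])
  next
    fix \<alpha> \<beta> \<gamma> \<delta> a b c d
    assume h: "a \<in> hom_part M \<alpha>" "b \<in> hom_part N \<beta>" "c \<in> hom_part M \<gamma>" "d \<in> hom_part N \<delta>"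
    then have c: "a \<in> carrier M" "b \<in> carrier N" "c \<in> carrier M" "d \<in> carrier N"
      using A.M.hom_carrier A.N.hom_carrier by auto
    show "A.w \<beta> \<gamma> \<odot>\<^bsub>B.T\<^esub> tensor_map \<omega> M' N' f g (pure_tensor M N (a \<otimes>\<^bsub>M\<^esub> c) (b \<otimes>\<^bsub>N\<^esub> d)) =
       tensor_map \<omega> M' N' f g (pure_tensor M N a b) \<otimes>\<^bsub>B.T\<^esub>
       tensor_map \<omega> M' N' f g (pure_tensor M N c d)"
      using c h
      by (simp add: tensor_map_pure[OF tm] gamma_hom_mult[OF f] gamma_hom_mult[OF g]
          gamma_hom_closed[OF f] gamma_hom_closed[OF g]
          B.mult_pure[OF _ gamma_hom_degree[OF g h(2)] gamma_hom_degree[OF f h(3)]])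
  next
    show "tensor_map \<omega> M' N' f g (pure_tensor M N \<one>\<^bsub>M\<^esub> \<one>\<^bsub>N\<^esub>) = \<one>\<^bsub>B.T\<^esub>"
      by (simp add: tensor_map_pure[OF tm] gamma_hom_one[OF f] gamma_hom_one[OF g]
          tensor_alg_simps(3))
  qed
qed

section \<open>Reassociation of triple tensor products\<close>

locale three_algebras = com_factor \<omega> + M: gamma_algebra M + N: gamma_algebra N + P: gamma_algebra P
  for \<omega> :: "'g::ab_group_add \<Rightarrow> 'g \<Rightarrow> complex"
    and M :: "('a, 'g) graded_algebra" and N :: "('b, 'g) graded_algebra"
    and P :: "('c, 'g) graded_algebra"

sublocale three_algebras \<subseteq> MN: tensor_algebras \<omega> M N ..
sublocale three_algebras \<subseteq> NP: tensor_algebras \<omega> N P ..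
sublocale three_algebras \<subseteq> MN_P: tensor_algebras \<omega> "tensor_alg \<omega> M N" P ..
sublocale three_algebras \<subseteq> M_NP: tensor_algebras \<omega> M "tensor_alg \<omega> N P" ..

context three_algebras
begin

lemma assoc_inner_bilinear:
  assumes "z \<in> carrier P"
  shows "cq_bilinear M N M_NP.T (\<lambda>x y. M_NP.pure x (NP.pure y z))"
  unfolding cq_bilinear_def
  using assms by (auto intro!: M_NP.pure_linear_left
      cq_linear_comp[OF NP.pure_linear_left M_NP.pure_linear_right])

lemma assoc_outer_bilinear:
  "cq_bilinear MN.T P M_NP.T (\<lambda>X z. tensor_lift M_NP.T (\<lambda>x y. M_NP.pure x (NP.pure y z)) X)"
  unfolding cq_bilinear_def
  by (auto intro!: MN.tensor_lift_linear MN.tensor_lift_param_linear assoc_inner_bilinear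
      M_NP.T.cq_module_axioms P.cq_module_axioms
      cq_linear_comp[OF NP.pure_linear_right M_NP.pure_linear_right])

lemma tensor_assoc_linear: "cq_linear MN_P.T M_NP.T (tensor_assoc \<omega> M N P)"
  unfolding tensor_assoc_def Let_def
  by (intro MN_P.tensor_lift_linear assoc_outer_bilinear M_NP.T.cq_module_axioms)

lemma tensor_assoc_pure:
  assumes "x \<in> carrier M" "y \<in> carrier N" "z \<in> carrier P"
  shows "tensor_assoc \<omega> M N P (MN_P.pure (MN.pure x y) z) = M_NP.pure x (NP.pure y z)"
  unfolding tensor_assoc_def Let_def
  using assms
  by (subst MN_P.tensor_lift_pure[OF M_NP.T.cq_module_axioms assoc_outer_bilinear])
    (simp_all add: MN.tensor_lift_pure[OF M_NP.T.cq_module_axioms assoc_inner_bilinear])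

text \<open>In both bracketings \<open>y\<close> and \<open>z\<close> move past \<open>x'\<close>,
  and \<open>z\<close> moves past \<open>y'\<close>; the factors are distributed differently over
  the two levels, but their product is the same.\<close>

lemma tensor_assoc_gamma_hom: "gamma_hom MN_P.T M_NP.T (tensor_assoc \<omega> M N P)"
proof (rule MN_P.tensor_gamma_homI[OF M_NP.T.gamma_algebra_axioms tensor_assoc_linear])
  let ?F = "tensor_assoc \<omega> M N P"
  note lin = tensor_assoc_linear
  fix \<alpha> \<beta> X z assume X: "X \<in> hom_part MN.T \<alpha>" and z: "z \<in> hom_part P \<beta>"
  note zc = P.hom_carrier[OF z]
  from X show "?F (MN_P.pure X z) \<in> hom_part M_NP.T (\<alpha> + \<beta>)"
  proof (induction rule: MN.T_hom_induct)
    case (pure \<alpha>1 \<alpha>2 x y)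
    then show ?case
      using zc M.hom_carrier N.hom_carrier
      by (simp add: tensor_assoc_pure)
        (intro M_NP.pure_hom[OF _ NP.pure_hom[OF _ z refl]], auto simp: algebra_simps)
  next
    case (add X Y)
    then show ?case
      using zc by (simp add: MN_P.pure_add_left cq_linear_add[OF lin] M_NP.T.hom_add)
  qed
next
  let ?F = "tensor_assoc \<omega> M N P"
  note lin = tensor_assoc_linear
  fix \<alpha> \<beta> \<gamma> \<delta> X z X' z'
  assume X: "X \<in> hom_part MN.T \<alpha>" and z: "z \<in> hom_part P \<beta>"
    and X': "X' \<in> hom_part MN.T \<gamma>" and z': "z' \<in> hom_part P \<delta>"
  note zc = P.hom_carrier[OF z] P.hom_carrier[OF z']
  note simps = MN_P.pure_add_left cq_linear_add[OF lin] cq_linear_closed[OF lin] MN.T.l_distr MN.T.r_distr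
    M_NP.T.l_distr M_NP.T.r_distr M_NP.T.smult_add_right
  from X show "w \<beta> \<gamma> \<odot>\<^bsub>M_NP.T\<^esub> ?F (MN_P.pure (X \<otimes>\<^bsub>MN.T\<^esub> X') (z \<otimes>\<^bsub>P\<^esub> z'))
     = ?F (MN_P.pure X z) \<otimes>\<^bsub>M_NP.T\<^esub> ?F (MN_P.pure X' z')"
  proof (induction rule: MN.T_hom_induct)
    case (add X Y)
    then show ?case using zc MN.T.hom_carrier[OF X'] by (simp add: simps)
  next
    case xy: (pure \<alpha>1 \<alpha>2 x y)
    note c1 = M.hom_carrier[OF xy(1)] N.hom_carrier[OF xy(2)]
    from X' show ?case
    proof (induction rule: MN.T_hom_induct)
      case (add X Y)
      then show ?case using zc c1 by (simp add: simps)
    next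
      case xy': (pure \<gamma>1 \<gamma>2 x' y')
      note c2 = M.hom_carrier[OF xy'(1)] N.hom_carrier[OF xy'(2)]
      show ?case
        using c1 c2 zc xy'(3)[symmetric]
        by (simp add: MN.mult_pure[OF _ xy(2) xy'(1)] tensor_assoc_pure MN_P.pure_smult_left
            cq_linear_smult[OF lin] M_NP.mult_pure[OF _ NP.pure_hom[OF xy(2) z refl] xy'(1)]
            NP.mult_pure[OF _ z xy'(2)] M_NP.pure_smult_right M_NP.T.smult_smult
            w_add_left w_add_right mult_ac)
    qed
  qed
next
  show "tensor_assoc \<omega> M N P (MN_P.pure \<one>\<^bsub>MN.T\<^esub> \<one>\<^bsub>P\<^esub>) = \<one>\<^bsub>M_NP.T\<^esub>"
    by (simp add: tensor_alg_simps(3) tensor_assoc_pure)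
qed

end

text \<open>The antipode is a homomorphism into this algebra.\<close>

definition op_algebra ::
  "('g \<Rightarrow> 'g \<Rightarrow> complex) \<Rightarrow> ('a, 'g) graded_algebra \<Rightarrow> ('a, 'g) graded_algebra" where
  "op_algebra \<omega> H = H\<lparr>mult := \<lambda>x y. gsum H H (\<lambda>\<alpha> x'. gsum H H (\<lambda>\<beta> y'.
     cq_of (\<omega> \<alpha> \<beta>) \<odot>\<^bsub>H\<^esub> (y' \<otimes>\<^bsub>H\<^esub> x')) y) x\<rparr>"

lemma op_algebra_simps [simp]:
  "carrier (op_algebra \<omega> H) = carrier H" "one (op_algebra \<omega> H) = one H"
  "zero (op_algebra \<omega> H) = zero H" "add (op_algebra \<omega> H) = add H"
  "smult (op_algebra \<omega> H) = smult H" "hom_part (op_algebra \<omega> H) = hom_part H"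
  by (simp_all add: op_algebra_def)

lemma op_algebra_a_inv [simp]: "a_inv (op_algebra \<omega> H) = a_inv H"
  by (rule ext) (simp add: a_inv_def m_inv_def)

lemma op_algebra_finsum [simp]: "finsum (op_algebra \<omega> H) f A = finsum H f A"
  by (simp add: finsum_def)

section \<open>The opposite algebra is a graded algebra\<close>

locale com_factor_algebra = com_factor \<omega> + gamma_algebra H
  for \<omega> :: "'g::ab_group_add \<Rightarrow> 'g \<Rightarrow> complex" and H :: "('a, 'g) graded_algebra" (structure)
begin

abbreviation opH where "opH \<equiv> op_algebra \<omega> H"
abbreviation op_mult (infixl \<open>\<diamondop>\<close> 70) where "x \<diamondop> y \<equiv> x \<otimes>\<^bsub>opH\<^esub> y"

lemma op_inner_linear:
  "x' \<in> carrier H \<Longrightarrow> cq_linear H H (\<lambda>y'. c \<odot> (y' \<otimes> x'))"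
  "x' \<in> carrier H \<Longrightarrow> cq_linear H H (\<lambda>y'. c \<odot> (x' \<otimes> y'))"
  by (intro cq_linear_smult_map cq_module_axioms mult_linear_left mult_linear_right; assumption)+

lemma op_outer_linear:
  "y \<in> carrier H \<Longrightarrow> cq_linear H H (\<lambda>x'. gsum H H (\<lambda>\<beta> y'. w \<alpha> \<beta> \<odot> (y' \<otimes> x')) y)"
  by (intro gsum_param_linear cq_module_axioms op_inner_linear)

lemma op_linear_left: "y \<in> carrier H \<Longrightarrow> cq_linear H H (\<lambda>x. x \<diamondop> y)"
  unfolding op_algebra_def by (simp, intro gsum_linear cq_module_axioms op_outer_linear)

lemma op_linear_right: "x \<in> carrier H \<Longrightarrow> cq_linear H H (\<lambda>y. x \<diamondop> y)"
  unfolding op_algebra_def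
  by (simp, intro gsum_param_linear gsum_linear cq_module_axioms op_inner_linear)

lemma op_mult_hom:
  assumes "x \<in> hom_part H \<alpha>" "y \<in> hom_part H \<beta>"
  shows "x \<diamondop> y = w \<alpha> \<beta> \<odot> (y \<otimes> x)"
  using assms hom_carrier unfolding op_algebra_def
  by (simp add: gsum_hom[OF cq_module_axioms op_outer_linear]
      gsum_hom[OF cq_module_axioms op_inner_linear(1)])

lemma op_closed: "x \<in> carrier H \<Longrightarrow> y \<in> carrier H \<Longrightarrow> x \<diamondop> y \<in> carrier H"
  by (rule cq_linear_closed[OF op_linear_left])

lemma op_smult_left:
  "x \<in> carrier H \<Longrightarrow> y \<in> carrier H \<Longrightarrow> (c \<odot> x) \<diamondop> y = c \<odot> (x \<diamondop> y)"
  by (rule cq_linear_smult[OF op_linear_left])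

lemma op_smult_right:
  "x \<in> carrier H \<Longrightarrow> y \<in> carrier H \<Longrightarrow> x \<diamondop> (c \<odot> y) = c \<odot> (x \<diamondop> y)"
  by (rule cq_linear_smult[OF op_linear_right])

lemma op_l_distr:
  "x \<in> carrier H \<Longrightarrow> y \<in> carrier H \<Longrightarrow> z \<in> carrier H \<Longrightarrow> (x \<oplus> y) \<diamondop> z = x \<diamondop> z \<oplus> y \<diamondop> z"
  by (rule cq_linear_add[OF op_linear_left])

lemma op_r_distr:
  "x \<in> carrier H \<Longrightarrow> y \<in> carrier H \<Longrightarrow> z \<in> carrier H \<Longrightarrow> z \<diamondop> (x \<oplus> y) = z \<diamondop> x \<oplus> z \<diamondop> y"
  by (rule cq_linear_add[OF op_linear_right])

lemma op_degree: "x \<in> hom_part H \<alpha> \<Longrightarrow> y \<in> hom_part H \<beta> \<Longrightarrow> x \<diamondop> y \<in> hom_part H (\<alpha> + \<beta>)"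
  by (simp add: op_mult_hom hom_smult hom_mult add.commute)

text \<open>Both bracketings reverse a homogeneous triple and interchange each pair once, with total
  factor \<open>w \<alpha> \<beta> * w \<alpha> \<gamma> * w \<beta> \<gamma>\<close>.\<close>

lemma op_assoc:
  assumes "x \<in> carrier H" "y \<in> carrier H" "z \<in> carrier H"
  shows "x \<diamondop> y \<diamondop> z = x \<diamondop> (y \<diamondop> z)"
  using assms(1)
proof (induction rule: hom_induct)
  case (add x x')
  then show ?case using assms by (simp add: op_l_distr op_closed)
next
  case x: (hom \<alpha> x)
  from assms(2) show ?case
  proof (induction rule: hom_induct)
    case (add y y')
    then show ?case using assms hom_carrier[OF x] by (simp add: op_l_distr op_r_distr op_closed)
  next
    case y: (hom \<beta> y)
    from assms(3) show ?case
    proof (induction rule: hom_induct)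
      case (add z z')
      then show ?case
        using hom_carrier[OF x] hom_carrier[OF y] by (simp add: op_r_distr op_closed)
    next
      case z: (hom \<gamma> z)
      note c = hom_carrier[OF x] hom_carrier[OF y] hom_carrier[OF z]
      show ?case
        using c by (simp add: op_mult_hom[OF x y] op_mult_hom[OF y z] op_smult_left op_smult_right
            op_mult_hom[OF hom_mult[OF y x refl] z] op_mult_hom[OF x hom_mult[OF z y refl]]
            smult_smult m_assoc w_add_left w_add_right mult_ac)
    qed
  qed
qed

lemma op_one_left: "x \<in> carrier H \<Longrightarrow> \<one> \<diamondop> x = x"
  by (induction rule: hom_induct)
    (simp_all add: op_mult_hom[OF one_hom_part] hom_carrier op_r_distr)

lemma op_one_right: "x \<in> carrier H \<Longrightarrow> x \<diamondop> \<one> = x"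
  by (induction rule: hom_induct)
    (simp_all add: op_mult_hom[OF _ one_hom_part] hom_carrier op_l_distr)

lemma op_gamma_algebra: "gamma_algebra opH"
proof -
  have ag: "abelian_group opH"
    by (rule abelian_group_cong[OF M.abelian_group_axioms]) simp_all
  have mod: "cq_module opH"
    by (intro cq_module.intro moduleI cring_Cq ag)
      (simp_all add: smult_add smult_add_right smult_smult)
  then interpret O: cq_module opH .
  have sub: "submodule (hom_part opH \<gamma>) Cq opH" for \<gamma>
    by (rule O.submoduleI) (auto simp: hom_carrier hom_uminus hom_add hom_smult)
  have dec: "hom_decomp opH x f \<longleftrightarrow> hom_decomp H x f" for x f
    by (simp add: hom_decomp_def)
  show ?thesis
  proof (intro gamma_algebra.intro gamma_algebra_axioms.intro O.module_axioms sub)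
    show "ring opH"
      by (intro ringI ag monoidI)
        (simp_all add: op_l_distr op_r_distr op_closed op_assoc op_one_left op_one_right)
    show "\<exists>!f. hom_decomp opH x f" if "x \<in> carrier opH" for x
      using direct_sum[of x] that by (simp add: dec)
  qed (simp_all add: op_smult_left op_smult_right op_degree one_hom_part)
qed

end

sublocale com_factor_algebra \<subseteq> opH: gamma_algebra "op_algebra \<omega> H"
  by (rule op_gamma_algebra)

section \<open>Graded quotients and free algebras\<close>

text \<open>Closure under negation need not be assumed: scalar multiples are products with multiples
  of the unit.\<close>

lemma (in gamma_algebra) idealI_submodule:
  assumes "J \<subseteq> carrier H" "\<zero> \<in> J" "\<And>x y. x \<in> J \<Longrightarrow> y \<in> J \<Longrightarrow> x \<oplus> y \<in> J"
    "\<And>a x. x \<in> J \<Longrightarrow> a \<in> carrier H \<Longrightarrow> a \<otimes> x \<in> J"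
    "\<And>a x. x \<in> J \<Longrightarrow> a \<in> carrier H \<Longrightarrow> x \<otimes> a \<in> J"
  shows "ideal J H"
proof -
  have c: "x \<in> carrier H" if "x \<in> J" for x using assms(1) that by auto
  have sm: "c \<odot> x \<in> J" if "x \<in> J" for c x
    using assms(4)[OF that, of "c \<odot> \<one>"] c[OF that] by (simp add: smult_mult_left)
  have "submodule J Cq H"
    by (rule submoduleI) (use assms sm c in \<open>auto simp: smult_minus_one\<close>)
  then show ?thesis
    using assms(4,5) by (intro idealI ring_axioms submodule.axioms(1)) auto
qed

lemma (in gamma_algebra) ideal_smult:
  assumes "ideal J H" "x \<in> J"
  shows "c \<odot> x \<in> J"
proof -
  interpret J: ideal J H by fact
  have "(c \<odot> \<one>) \<otimes> x \<in> J" using assms(2) by (intro J.I_l_closed) auto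
  then show ?thesis using J.a_Hcarr[OF assms(2)] by (simp add: smult_mult_left)
qed

lemma (in gamma_algebra) hom_comp_linear: "cq_linear H H (\<lambda>x. hom_comp H x \<gamma>)"
  by (rule cq_linearI) (simp_all add: hom_comp_add hom_comp_smult)

lemma (in gamma_algebra) hom_comp_mult_left:
  assumes a: "a \<in> hom_part H \<alpha>" and x: "x \<in> carrier H"
  shows "hom_comp H (a \<otimes> x) \<gamma> = a \<otimes> hom_comp H x (\<gamma> - \<alpha>)"
proof (rule linear_eqI[OF _ _ _ x])
  note c = hom_carrier[OF a]
  show "cq_linear H H (\<lambda>x. hom_comp H (a \<otimes> x) \<gamma>)"
    by (rule cq_linear_comp[OF mult_linear_right[OF c] hom_comp_linear])
  show "cq_linear H H (\<lambda>x. a \<otimes> hom_comp H x (\<gamma> - \<alpha>))"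
    by (rule cq_linear_comp[OF hom_comp_linear mult_linear_right[OF c]])
  show "hom_comp H (a \<otimes> x) \<gamma> = a \<otimes> hom_comp H x (\<gamma> - \<alpha>)" if "x \<in> hom_part H \<beta>" for \<beta> x
    using c hom_carrier[OF that] that a
    by (auto simp: hom_comp_of_hom[OF hom_mult[OF a that refl]] hom_comp_of_hom algebra_simps)
qed

lemma (in gamma_algebra) hom_comp_mult_right:
  assumes a: "a \<in> hom_part H \<alpha>" and x: "x \<in> carrier H"
  shows "hom_comp H (x \<otimes> a) \<gamma> = hom_comp H x (\<gamma> - \<alpha>) \<otimes> a"
proof (rule linear_eqI[OF _ _ _ x])
  note c = hom_carrier[OF a]
  show "cq_linear H H (\<lambda>x. hom_comp H (x \<otimes> a) \<gamma>)"
    by (rule cq_linear_comp[OF mult_linear_left[OF c] hom_comp_linear])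
  show "cq_linear H H (\<lambda>x. hom_comp H x (\<gamma> - \<alpha>) \<otimes> a)"
    by (rule cq_linear_comp[OF hom_comp_linear mult_linear_left[OF c]])
  show "hom_comp H (x \<otimes> a) \<gamma> = hom_comp H x (\<gamma> - \<alpha>) \<otimes> a" if "x \<in> hom_part H \<beta>" for \<beta> x
    using c hom_carrier[OF that] that a
    by (auto simp: hom_comp_of_hom[OF hom_mult[OF that a refl]] hom_comp_of_hom algebra_simps)
qed

text \<open>The elements all of whose components lie in \<open>Idl R\<close> form an ideal
  themselves. It contains \<open>R\<close>, whose elements are their own only components, so
  minimality of \<open>Idl R\<close> applies.\<close>

lemma (in gamma_algebra) genideal_graded:
  assumes R: "\<And>r. r \<in> R \<Longrightarrow> \<exists>\<gamma>. r \<in> hom_part H \<gamma>" and x: "x \<in> Idl R"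
  shows "hom_comp H x \<gamma> \<in> Idl R"
proof -
  have Rc: "R \<subseteq> carrier H" using R hom_carrier by blast
  interpret J: ideal "Idl R" H by (rule genideal_ideal[OF Rc])
  let ?K = "{x \<in> carrier H. \<forall>\<gamma>. hom_comp H x \<gamma> \<in> Idl R}"
  have zero: "hom_comp H \<zero> \<gamma> = \<zero>" for \<gamma>
    using hom_comp_of_hom[OF hom_zero[of 0]] by simp
  have "ideal ?K H"
  proof (rule idealI_submodule)
    show "x \<oplus> y \<in> ?K" if "x \<in> ?K" "y \<in> ?K" for x y
      using that by (auto simp: hom_comp_add)
    show "a \<otimes> x \<in> ?K" if x: "x \<in> ?K" and a: "a \<in> carrier H" for a x
      using a
    proof (induction rule: hom_induct)
      case (hom \<alpha> a)
      then show ?case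
        using x hom_carrier[OF hom] by (simp add: hom_comp_mult_left J.I_l_closed)
    next
      case (add a b)
      then show ?case using x by (simp add: l_distr hom_comp_add J.a_closed)
    qed
    show "x \<otimes> a \<in> ?K" if x: "x \<in> ?K" and a: "a \<in> carrier H" for a x
      using a
    proof (induction rule: hom_induct)
      case (hom \<alpha> a)
      then show ?case
        using x hom_carrier[OF hom] by (simp add: hom_comp_mult_right J.I_r_closed)
    next
      case (add a b)
      then show ?case using x by (simp add: r_distr hom_comp_add J.a_closed)
    qed
  qed (auto simp: zero J.zero_closed)
  moreover have "R \<subseteq> ?K"
  proof
    fix r assume r: "r \<in> R"
    then obtain \<delta> where "r \<in> hom_part H \<delta>" using R by blast
    with r show "r \<in> ?K"
      using genideal_self'[of r] genideal_self[OF Rc] hom_carrier by (auto simp: hom_comp_of_hom J.zero_closed)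
  qed
  ultimately have "Idl R \<subseteq> ?K" by (rule genideal_minimal)
  with x show ?thesis by auto
qed

section \<open>Quotients by graded ideals\<close>

locale graded_ideal = gamma_algebra H + J: ideal J H
  for J and H :: "('a, 'g::ab_group_add) graded_algebra" (structure) +
  assumes graded: "x \<in> J \<Longrightarrow> hom_comp H x \<gamma> \<in> J"
begin

abbreviation Q where "Q \<equiv> quot_algebra H J"

lemma coset_eq_iff:
  "x \<in> carrier H \<Longrightarrow> y \<in> carrier H \<Longrightarrow> J +> x = J +> y \<longleftrightarrow> x \<ominus> y \<in> J"
  using quotient_eq_iff_same_a_r_cos[OF J.ideal_axioms] by simp

lemma Q_carrier: "carrier Q = (\<lambda>x. J +> x) ` carrier H"
  by (auto simp: quot_algebra_def FactRing_simps)

lemma Q_cases: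
  assumes "X \<in> carrier Q"
  obtains x where "x \<in> carrier H" "X = J +> x"
  using assms by (auto simp: Q_carrier)

lemma coset_closed: "x \<in> carrier H \<Longrightarrow> J +> x \<in> carrier Q"
  by (simp add: Q_carrier)

text \<open>A linear map that preserves \<open>J\<close> sends all members of a coset into one
  coset, so the union has a single member. This evaluates the scalar multiplication of
  \<open>quot_algebra\<close>, which is encoded as such a union.\<close>

lemma Union_coset:
  assumes f: "cq_linear H H f" "\<And>x. x \<in> J \<Longrightarrow> f x \<in> J" and x: "x \<in> carrier H"
  shows "(\<Union>y\<in>J +> x. J +> f y) = J +> f x"
proof -
  have "J +> f y = J +> f x" if y: "y \<in> J +> x" for y
  proof -
    have yc: "y \<in> carrier H" using J.a_elemrcos_carrier[OF x y] .
    have "y \<ominus> x \<in> J" using J.a_rcos_module_minus[OF _ x yc] y ring_axioms by simp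
    then have "f (y \<ominus> x) \<in> J" by (rule f(2))
    then show ?thesis
      using yc x cq_linear_closed[OF f(1)]
      by (simp add: coset_eq_iff cq_linear_diff[OF cq_module_axioms cq_module_axioms f(1)])
  qed
  then have "(\<Union>y\<in>J +> x. J +> f y) = (\<Union>y\<in>J +> x. J +> f x)"
    by (rule SUP_cong[OF refl])
  also have "\<dots> = J +> f x"
    using J.a_rcos_self[OF x] by (metis UN_constant empty_iff)
  finally show ?thesis .
qed

lemma coset_ops:
  shows coset_add: "x \<in> carrier H \<Longrightarrow> y \<in> carrier H \<Longrightarrow> (J +> x) \<oplus>\<^bsub>Q\<^esub> (J +> y) = J +> (x \<oplus> y)"
    and coset_mult: "x \<in> carrier H \<Longrightarrow> y \<in> carrier H \<Longrightarrow> (J +> x) \<otimes>\<^bsub>Q\<^esub> (J +> y) = J +> (x \<otimes> y)"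
    and coset_smult: "x \<in> carrier H \<Longrightarrow> c \<odot>\<^bsub>Q\<^esub> (J +> x) = J +> (c \<odot> x)"
    and coset_one: "\<one>\<^bsub>Q\<^esub> = J +> \<one>"
    and coset_zero: "\<zero>\<^bsub>Q\<^esub> = J +> \<zero>"
proof -
  show "x \<in> carrier H \<Longrightarrow> y \<in> carrier H \<Longrightarrow> (J +> x) \<oplus>\<^bsub>Q\<^esub> (J +> y) = J +> (x \<oplus> y)"
    by (simp add: quot_algebra_def FactRing_def J.a_rcos_sum)
  show "x \<in> carrier H \<Longrightarrow> y \<in> carrier H \<Longrightarrow> (J +> x) \<otimes>\<^bsub>Q\<^esub> (J +> y) = J +> (x \<otimes> y)"
    by (simp add: quot_algebra_def FactRing_def J.rcoset_mult_add)
  show "x \<in> carrier H \<Longrightarrow> c \<odot>\<^bsub>Q\<^esub> (J +> x) = J +> (c \<odot> x)"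
    by (simp add: quot_algebra_def, rule Union_coset)
      (auto intro: cq_linear_smult_map cq_linear_id cq_module_axioms ideal_smult J.ideal_axioms)
  show "\<one>\<^bsub>Q\<^esub> = J +> \<one>" by (simp add: quot_algebra_def FactRing_def)
  have "\<zero>\<^bsub>Q\<^esub> = J" by (simp add: quot_algebra_def FactRing_def)
  also have "J = J +> \<zero>"
    using J.a_subset by (simp add: M.a_coset_add_zero)
  finally show "\<zero>\<^bsub>Q\<^esub> = J +> \<zero>" .
qed

lemma Q_hom_part: "hom_part Q \<gamma> = (\<lambda>x. J +> x) ` hom_part H \<gamma>"
  by (simp add: quot_algebra_def)

text \<open>Written as a union over the coset, like scalar multiplication, so that
  \<open>Union_coset\<close> evaluates it; \<open>graded\<close> provides the invariance of
  \<open>J\<close>.\<close>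

definition Q_proj where "Q_proj \<gamma> X = (\<Union>x\<in>X. J +> hom_comp H x \<gamma>)"

lemma Q_proj_coset: "x \<in> carrier H \<Longrightarrow> Q_proj \<gamma> (J +> x) = J +> hom_comp H x \<gamma>"
  unfolding Q_proj_def by (rule Union_coset[OF hom_comp_linear graded])

lemma Q_module: "cq_module Q"
proof -
  have "abelian_group Q"
    by (rule abelian_group_cong[OF ring.is_abelian_group[OF J.quotient_is_ring]])
      (simp_all add: quot_algebra_def)
  then show ?thesis
    by (intro cq_module.intro moduleI cring_Cq)
      (auto elim!: Q_cases simp: coset_ops coset_closed smult_add smult_add_right smult_smult)
qed

lemma Q_ring: "ring Q"
  by (rule ringI; (rule monoidI)?)
    (use Q_module in \<open>auto elim!: Q_cases simp: coset_ops coset_closed m_assoc l_distr r_distr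
      cq_module_def module_def\<close>)

lemma Q_gamma_algebra: "gamma_algebra Q"
proof -
  interpret Q: cq_module Q by (rule Q_module)
  have sub: "submodule (hom_part Q \<gamma>) Cq Q" for \<gamma>
    by (rule Q.submoduleI)
      (auto simp: Q_hom_part coset_ops hom_carrier Q.smult_minus_one Q_carrier
        intro!: imageI hom_add hom_smult)
  show ?thesis
  proof (intro gamma_algebra.intro gamma_algebra_axioms.intro Q.module_axioms Q_ring sub)
    fix X assume X: "X \<in> carrier Q"
    show "\<exists>!f. hom_decomp Q X f"
    proof (rule Q.direct_sumI[where \<pi> = Q_proj, OF sub _ _ _ _ X])
      fix P and Y :: "'a set"
      assume Y: "Y \<in> carrier Q" and P: "\<And>\<gamma> y. y \<in> hom_part Q \<gamma> \<Longrightarrow> P y"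
        "\<And>y z. y \<in> carrier Q \<Longrightarrow> z \<in> carrier Q \<Longrightarrow> P y \<Longrightarrow> P z \<Longrightarrow> P (y \<oplus>\<^bsub>Q\<^esub> z)"
      from Y obtain y where y: "y \<in> carrier H" "Y = J +> y" by (rule Q_cases)
      from y(1) have "P (J +> y)"
      proof (induction rule: hom_induct)
        case (hom \<gamma> x)
        then show ?case by (intro P(1)[of _ \<gamma>]) (simp add: Q_hom_part)
      next
        case (add x z)
        then show ?case using P(2)[of "J +> x" "J +> z"] by (simp add: coset_ops coset_closed)
      qed
      then show "P Y" using y by simp
    next
      show "cq_linear Q Q (Q_proj \<gamma>)" for \<gamma>
        by (rule cq_linearI)
          (auto elim!: Q_cases simp: coset_ops coset_closed Q_proj_coset hom_comp_add hom_comp_smult)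
    next
      show "Q_proj \<gamma> Y = Y" if "Y \<in> hom_part Q \<gamma>" for \<gamma> Y
        using that by (auto simp: Q_hom_part Q_proj_coset hom_carrier hom_comp_of_hom)
    next
      show "Q_proj \<gamma> Y = \<zero>\<^bsub>Q\<^esub>" if "Y \<in> hom_part Q \<delta>" "\<gamma> \<noteq> \<delta>" for \<gamma> \<delta> Y
        using that by (auto simp: Q_hom_part Q_proj_coset hom_carrier hom_comp_of_hom coset_zero)
    qed
  qed (auto elim!: Q_cases simp: coset_ops coset_closed Q_hom_part smult_mult_left smult_mult_right
      one_hom_part hom_carrier intro!: imageI mult_hom_part)
qed

lemma Q_hom_lift:
  assumes P: "gamma_algebra P" and f: "gamma_hom H P f" and J: "\<And>x. x \<in> J \<Longrightarrow> f x = \<zero>\<^bsub>P\<^esub>"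
  shows "\<exists>h. gamma_hom Q P h \<and> (\<forall>x\<in>carrier H. h (J +> x) = f x)"
proof -
  interpret P: gamma_algebra P by fact
  define h where "h X = f (SOME x. x \<in> X)" for X
  have h: "h (J +> x) = f x" if x: "x \<in> carrier H" for x
  proof -
    let ?y = "SOME y. y \<in> J +> x"
    have y: "?y \<in> J +> x" using J.a_rcos_self[OF x] by (rule someI)
    have yc: "?y \<in> carrier H" using J.a_elemrcos_carrier[OF x y] .
    have "?y \<ominus> x \<in> J" using J.a_rcos_module_minus[OF _ x yc] y ring_axioms by simp
    then have "f (?y \<ominus> x) = \<zero>\<^bsub>P\<^esub>" by (rule J)
    then have "f ?y \<ominus>\<^bsub>P\<^esub> f x = \<zero>\<^bsub>P\<^esub>"
      using x yc cq_linear_diff[OF cq_module_axioms P.cq_module_axioms gamma_hom_linear[OF f]] by simp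
    then show ?thesis
      using gamma_hom_closed[OF f] x yc by (simp add: h_def P.diff_eq_zero_iff)
  qed
  have "gamma_hom Q P h"
    by (intro gamma_homI cq_linearI)
      (auto elim!: Q_cases simp: coset_ops h Q_hom_part hom_carrier gamma_hom_closed[OF f]
        gamma_hom_add[OF f] gamma_hom_smult[OF f] gamma_hom_mult[OF f] gamma_hom_one[OF f]
        gamma_hom_degree[OF f])
  with h show ?thesis by blast
qed

end

section \<open>Free algebras and their grading\<close>

lemma letters_simps [simp]: "letters (u + v) = letters u @ letters v" "letters 0 = []"
  by (simp_all add: plus_fword_def zero_fword_def)

lemma scal_mult: "scal c * p = fscale c p"
  by (simp add: scal_def mult_map_scale_conv_mult)

lemma fscale_mult_right: "p * fscale c q = fscale c (p * (q :: 'x free))"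
proof -
  have [simp]: "fscale c 0 = 0" for c :: cq by (rule poly_mapping_eqI) simp
  have fs: "fscale c (sum f A) = (\<Sum>a\<in>A. fscale c (f a))" for c A and f :: "'b \<Rightarrow> 'x free"
    by (induction A rule: infinite_finite_induct) (simp_all add: fscale_simps)
  let ?s = "\<lambda>p :: 'x free. \<Sum>k\<in>Poly_Mapping.keys p. Poly_Mapping.single k (Poly_Mapping.lookup p k)"
  have "?s p * fscale c (?s q) = fscale c (?s p * ?s q)"
    by (simp add: fs fscale_simps sum_product mult_single mult.left_commute)
  then show ?thesis by (simp flip: poly_mapping_eq_sum_single)
qed

lemma fscale_mult_left: "fscale c q * p = fscale c (q * (p :: 'x free))"
  by (simp flip: scal_mult add: mult.assoc)

lemma free_algebra_simps [simp]:
  "carrier (free_algebra X deg) = free_carrier X" "mult (free_algebra X deg) = (*)"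
  "one (free_algebra X deg) = 1" "zero (free_algebra X deg) = 0" "add (free_algebra X deg) = (+)"
  "smult (free_algebra X deg) = fscale"
  by (auto simp: free_algebra_def scal_mult)

abbreviation wdeg :: "('x \<Rightarrow> 'g::ab_group_add) \<Rightarrow> 'x fword \<Rightarrow> 'g" where
  "wdeg deg u \<equiv> sum_list (map deg (letters u))"

lemma free_hom_part: "hom_part (free_algebra X deg) \<gamma> =
    {p \<in> free_carrier X. \<forall>u \<in> Poly_Mapping.keys p. wdeg deg u = \<gamma>}"
  by (simp add: free_algebra_def)

lemma free_carrier_simps [simp]:
  "0 \<in> free_carrier X" "1 \<in> free_carrier X"
  "p \<in> free_carrier X \<Longrightarrow> q \<in> free_carrier X \<Longrightarrow> p + q \<in> free_carrier X"
  "p \<in> free_carrier X \<Longrightarrow> q \<in> free_carrier X \<Longrightarrow> p * q \<in> free_carrier X"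
  "p \<in> free_carrier X \<Longrightarrow> fscale c p \<in> free_carrier X"
  "x \<in> X \<Longrightarrow> letter x \<in> free_carrier X"
  using keys_add[of p q] keys_mult[of p q] keys_fscale[of c p]
  by (fastforce simp: free_carrier_def letter_def)+

lemma free_carrier_more [simp]:
  shows free_carrier_scal: "scal c \<in> free_carrier X"
    and free_carrier_diff: "p \<in> free_carrier X \<Longrightarrow> q \<in> free_carrier X \<Longrightarrow> p - q \<in> free_carrier X"
    and free_carrier_power: "p \<in> free_carrier X \<Longrightarrow> p ^ n \<in> free_carrier X"
    and free_carrier_sum: "(\<And>a. a \<in> A \<Longrightarrow> f a \<in> free_carrier X) \<Longrightarrow> sum f A \<in> free_carrier X"
  subgoal by (simp add: free_carrier_def scal_def)
  subgoal by (simp add: minus_eq_fscale)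
  subgoal by (induction n) simp_all
  subgoal by (induction A rule: infinite_finite_induct) simp_all
  done

lemma free_induct [consumes 1, case_names single add]:
  assumes "p \<in> free_carrier X"
    "\<And>u c. set (letters u) \<subseteq> X \<Longrightarrow> Q (Poly_Mapping.single u c)"
    "\<And>p q. p \<in> free_carrier X \<Longrightarrow> q \<in> free_carrier X \<Longrightarrow> Q p \<Longrightarrow> Q q \<Longrightarrow> Q (p + q)"
  shows "Q p"
proof -
  let ?s = "\<lambda>k. Poly_Mapping.single k (Poly_Mapping.lookup p k)"
  have "Q (sum ?s K)" if "finite K" "K \<subseteq> Poly_Mapping.keys p" for K
    using that
  proof (induction K rule: finite_induct)
    case empty
    then show ?case using assms(2)[of 0 0] by simp
  next
    case (insert k K)
    then have "set (letters k') \<subseteq> X" if "k' \<in> insert k K" for k'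
      using that assms(1) by (auto simp: free_carrier_def)
    then have "?s k' \<in> free_carrier X" "Q (?s k')" if "k' \<in> insert k K" for k'
      using that assms(2) by (auto simp: free_carrier_def)
    with insert show ?case by (simp add: assms(3))
  qed
  from this[OF finite_keys order_refl] show ?thesis by (simp flip: poly_mapping_eq_sum_single)
qed

definition free_proj :: "('x \<Rightarrow> 'g::ab_group_add) \<Rightarrow> 'g \<Rightarrow> 'x free \<Rightarrow> 'x free" where
  "free_proj deg \<gamma> = Poly_Mapping.mapp (\<lambda>u c. c when wdeg deg u = \<gamma>)"

lemma lookup_free_proj:
  "Poly_Mapping.lookup (free_proj deg \<gamma> p) u = (Poly_Mapping.lookup p u when wdeg deg u = \<gamma>)"
  by (auto simp: free_proj_def lookup_mapp when_def in_keys_iff)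

lemma free_gamma_algebra: "gamma_algebra (free_algebra X deg)"
proof -
  let ?F = "free_algebra X deg"
  have ag: "abelian_group ?F"
  proof (rule abelian_groupI)
    fix p assume "p \<in> carrier ?F"
    then show "\<exists>q\<in>carrier ?F. q \<oplus>\<^bsub>?F\<^esub> p = \<zero>\<^bsub>?F\<^esub>"
      using free_carrier_diff[of 0 X p] by (intro bexI[of _ "0 - p"]) auto
  qed (auto simp: add_ac)
  have mod: "cq_module ?F"
    by (intro cq_module.intro moduleI cring_Cq ag) (simp_all add: fscale_simps)
  then interpret cq_module ?F .
  have inv: "a_inv ?F p = fscale (- 1) p" if "p \<in> carrier ?F" for p
    using that by (simp only: smult_minus_one free_algebra_simps)
  have sub: "submodule (hom_part ?F \<gamma>) Cq ?F" for \<gamma>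
  proof (rule submoduleI)
    show sm: "c \<odot>\<^bsub>?F\<^esub> p \<in> hom_part ?F \<gamma>" if "p \<in> hom_part ?F \<gamma>" for c p
      using that keys_fscale[of c p] by (auto simp: free_hom_part)
    show "\<ominus>\<^bsub>?F\<^esub> p \<in> hom_part ?F \<gamma>" if "p \<in> hom_part ?F \<gamma>" for p
      using sm[OF that, of "- 1"] that by (simp add: inv free_hom_part)
    show "p \<oplus>\<^bsub>?F\<^esub> q \<in> hom_part ?F \<gamma>" if "p \<in> hom_part ?F \<gamma>" "q \<in> hom_part ?F \<gamma>" for p q
      using that keys_add[of p q] by (auto simp: free_hom_part)
  qed (auto simp: free_hom_part)
  show ?thesis
  proof (intro gamma_algebra.intro gamma_algebra_axioms.intro module_axioms sub)
    show "ring ?F"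
      by (intro ringI ag monoidI) (auto simp: algebra_simps)
    show "\<one>\<^bsub>?F\<^esub> \<in> hom_part ?F 0"
      by (auto simp: free_hom_part)
    show "p \<otimes>\<^bsub>?F\<^esub> q \<in> hom_part ?F (\<alpha> + \<beta>)" if "p \<in> hom_part ?F \<alpha>" "q \<in> hom_part ?F \<beta>" for p q \<alpha> \<beta>
      using that keys_mult[of p q] by (auto simp: free_hom_part)
    fix p assume p: "p \<in> carrier ?F"
    show "\<exists>!f. hom_decomp ?F p f"
    proof (rule direct_sumI[where \<pi> = "free_proj deg", OF sub _ _ _ _ p])
      fix Q and p :: "'a free"
      assume p: "p \<in> carrier ?F" and Q: "\<And>\<gamma> p. p \<in> hom_part ?F \<gamma> \<Longrightarrow> Q p"
        "\<And>p q. p \<in> carrier ?F \<Longrightarrow> q \<in> carrier ?F \<Longrightarrow> Q p \<Longrightarrow> Q q \<Longrightarrow> Q (p \<oplus>\<^bsub>?F\<^esub> q)"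
      from p show "Q p"
        unfolding free_algebra_simps
      proof (induction rule: free_induct)
        case (single u c)
        then show ?case by (intro Q(1)[of _ "wdeg deg u"]) (auto simp: free_hom_part free_carrier_def)
      qed (use Q(2) in simp)
    next
      show "cq_linear ?F ?F (free_proj deg \<gamma>)" for \<gamma>
      proof (rule cq_linearI)
        show "free_proj deg \<gamma> p \<in> carrier ?F" if "p \<in> carrier ?F" for p
          using that by (auto simp: free_carrier_def free_proj_def dest!: subsetD[OF keys_mapp_subset])
      qed (auto intro!: poly_mapping_eqI simp: lookup_free_proj lookup_add when_def)
    next
      show "free_proj deg \<gamma> p = p" if "p \<in> hom_part ?F \<gamma>" for \<gamma> p
        using that by (intro poly_mapping_eqI) (auto simp: lookup_free_proj when_def free_hom_part in_keys_iff)
    next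
      show "free_proj deg \<gamma> p = \<zero>\<^bsub>?F\<^esub>" if "p \<in> hom_part ?F \<delta>" "\<gamma> \<noteq> \<delta>" for \<gamma> \<delta> p
        using that by (intro poly_mapping_eqI) (auto simp: lookup_free_proj when_def free_hom_part in_keys_iff)
    qed
  qed (auto simp: fscale_mult_left fscale_mult_right)
qed

text \<open>Values are required at all letters, so that \<open>ev\<close> is total on
  \<open>'x free\<close> and its laws carry no side conditions on the letters involved.\<close>

locale evaluation = P: gamma_algebra P
  for P :: "('b, 'g::ab_group_add) graded_algebra" and g :: "'x \<Rightarrow> 'b" and deg :: "'x \<Rightarrow> 'g" +
  assumes g_hom: "g x \<in> hom_part P (deg x)"
begin

lemma g_closed [simp]: "g x \<in> carrier P"
  by (rule P.hom_carrier[OF g_hom])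

definition ev_word :: "'x fword \<Rightarrow> 'b" where
  "ev_word u = foldr (\<lambda>x a. g x \<otimes>\<^bsub>P\<^esub> a) (letters u) \<one>\<^bsub>P\<^esub>"

definition ev :: "'x free \<Rightarrow> 'b" where
  "ev p = (\<Oplus>\<^bsub>P\<^esub>u\<in>Poly_Mapping.keys p. Poly_Mapping.lookup p u \<odot>\<^bsub>P\<^esub> ev_word u)"

lemma foldr_closed [simp]: "foldr (\<lambda>x a. g x \<otimes>\<^bsub>P\<^esub> a) xs \<one>\<^bsub>P\<^esub> \<in> carrier P"
  by (induction xs) simp_all

lemma ev_word_closed [simp]: "ev_word u \<in> carrier P"
  by (simp add: ev_word_def)

lemma ev_word_hom: "ev_word u \<in> hom_part P (wdeg deg u)"
proof -
  have "foldr (\<lambda>x a. g x \<otimes>\<^bsub>P\<^esub> a) xs \<one>\<^bsub>P\<^esub> \<in> hom_part P (sum_list (map deg xs))" for xs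
    by (induction xs) (auto intro: P.mult_hom_part g_hom P.one_hom_part)
  then show ?thesis by (simp add: ev_word_def)
qed

lemma ev_word_add: "ev_word (u + v) = ev_word u \<otimes>\<^bsub>P\<^esub> ev_word v"
proof -
  have "foldr (\<lambda>x a. g x \<otimes>\<^bsub>P\<^esub> a) (xs @ ys) \<one>\<^bsub>P\<^esub> =
      foldr (\<lambda>x a. g x \<otimes>\<^bsub>P\<^esub> a) xs \<one>\<^bsub>P\<^esub> \<otimes>\<^bsub>P\<^esub> foldr (\<lambda>x a. g x \<otimes>\<^bsub>P\<^esub> a) ys \<one>\<^bsub>P\<^esub>" for xs ys
    by (induction xs) (simp_all add: P.m_assoc del: foldr_append)
  then show ?thesis by (simp add: ev_word_def)
qed

lemma ev_superset:
  assumes "finite K" "Poly_Mapping.keys p \<subseteq> K"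
  shows "ev p = (\<Oplus>\<^bsub>P\<^esub>u\<in>K. Poly_Mapping.lookup p u \<odot>\<^bsub>P\<^esub> ev_word u)"
  unfolding ev_def by (rule P.finsum_superset) (use assms in \<open>auto simp: in_keys_iff\<close>)

lemma ev_closed [simp]: "ev p \<in> carrier P"
  by (auto simp: ev_def intro!: P.M.finsum_closed)

lemma ev_add: "ev (p + q) = ev p \<oplus>\<^bsub>P\<^esub> ev q"
proof -
  let ?K = "Poly_Mapping.keys p \<union> Poly_Mapping.keys q"
  show ?thesis
    using keys_add[of p q]
    by (simp add: ev_superset[of ?K] lookup_add P.smult_add P.M.finsum_addf)
qed

lemma ev_fscale: "ev (fscale c p) = c \<odot>\<^bsub>P\<^esub> ev p"
  using keys_fscale[of c p]
  by (simp add: ev_superset[of "Poly_Mapping.keys p"] P.finsum_smult_ldistr P.smult_smult)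

lemma ev_single: "ev (Poly_Mapping.single u c) = c \<odot>\<^bsub>P\<^esub> ev_word u"
  by (subst ev_superset[of "{u}"]) (auto simp: P.M.finsum_insert)

lemma ev_zero: "ev 0 = \<zero>\<^bsub>P\<^esub>"
  by (simp add: ev_def)

lemma ev_mult: "ev (p * q) = ev p \<otimes>\<^bsub>P\<^esub> ev q"
proof -
  have UNIV: "r \<in> free_carrier UNIV" for r :: "'x free" by (simp add: free_carrier_def)
  from UNIV[of p] show ?thesis
  proof (induction rule: free_induct)
    case (single u c)
    from UNIV[of q] show ?case
    proof (induction rule: free_induct)
      case (single v d)
      show ?case
        by (simp add: mult_single ev_single ev_word_add P.smult_mult_left P.smult_mult_right
            P.smult_smult mult.commute)
    qed (simp add: distrib_left ev_add P.r_distr)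
  qed (simp add: distrib_right ev_add P.l_distr)
qed

lemma ev_one: "ev 1 = \<one>\<^bsub>P\<^esub>"
  using ev_single[of 0 1] by (simp add: ev_word_def)

lemma ev_letter: "ev (letter x) = g x"
  by (simp add: letter_def ev_single ev_word_def)

lemma ev_diff: "ev (p - q) = ev p \<ominus>\<^bsub>P\<^esub> ev q"
  by (simp add: minus_eq_fscale ev_add ev_fscale a_minus_def P.smult_minus_one)

lemma ev_scal: "ev (scal c) = c \<odot>\<^bsub>P\<^esub> \<one>\<^bsub>P\<^esub>"
  by (simp add: scal_def ev_single ev_word_def)

lemma ev_power: "ev (p ^ n) = ev p [^]\<^bsub>P\<^esub> n"
  by (induction n) (simp_all add: ev_one ev_mult power_Suc2 P.nat_pow_Suc del: power_Suc)

lemma ev_sum: "finite A \<Longrightarrow> ev (sum f A) = (\<Oplus>\<^bsub>P\<^esub>a\<in>A. ev (f a))"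
  by (induction A rule: finite_induct) (simp_all add: ev_zero ev_add P.M.finsum_insert)

lemma ev_gamma_hom: "gamma_hom (free_algebra X deg) P ev"
proof (intro gamma_homI cq_linearI)
  fix \<gamma> p assume p: "p \<in> hom_part (free_algebra X deg) \<gamma>"
  show "ev p \<in> hom_part P \<gamma>"
    unfolding ev_def
    by (rule P.finsum_induct)
      (use p ev_word_hom in \<open>auto simp: free_hom_part intro!: P.hom_smult P.hom_add\<close>)
qed (simp_all add: ev_add ev_fscale ev_mult ev_one)

end

section \<open>Quantum Serre elements\<close>

lemma qint_inverse: "qint (inverse a) n = qint a n"
proof -
  have "qint (inverse a) n = (- (a ^ n - inverse a ^ n)) / (- (a - inverse a))"
    by (simp add: qint_def)
  also have "\<dots> = qint a n"
    unfolding qint_def by (rule minus_divide_divide)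
  finally show ?thesis .
qed

text \<open>This symmetry is what turns \<open>serre_el_Suc\<close> into
  \<open>serre_el_Suc'\<close>, which splits off the factor at the other end.\<close>

lemma qbinom_inverse: "qbinom (inverse a) m r = qbinom a m r"
  by (simp add: qbinom_def qfact_def qint_inverse)

lemma qfact_0 [simp]: "qfact a 0 = 1"
  by (simp add: qfact_def)

lemma qfact_Suc: "qfact a (Suc n) = qint a (Suc n) * qfact a n"
  by (simp add: qfact_def mult.commute)

text \<open>A non-zero \<open>p\<close> that is not a root of unity. Quantum integers of positive
  index are then invertible, so the quotients in \<open>qbinom\<close> are genuine.\<close>

locale generic_parameter =
  fixes p :: cq
  assumes nonzero: "p \<noteq> 0" and generic: "n > 0 \<Longrightarrow> p ^ n \<noteq> 1"
begin

lemma power_diff_nonzero: "n > 0 \<Longrightarrow> p ^ n - inverse p ^ n \<noteq> 0"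
proof
  assume n: "n > 0" and "p ^ n - inverse p ^ n = 0"
  then have "p ^ n * p ^ n = 1"
    using nonzero by (simp add: field_simps power_inverse)
  then have "p ^ (n + n) = 1" by (simp add: power_add)
  with generic[of "n + n"] n show False by simp
qed

lemma diff_nonzero: "p - inverse p \<noteq> 0"
  using power_diff_nonzero[of 1] by simp

lemma qint_nonzero: "n > 0 \<Longrightarrow> qint p n \<noteq> 0"
  using power_diff_nonzero diff_nonzero by (simp add: qint_def)

lemma qfact_nonzero: "qfact p n \<noteq> 0"
  by (simp add: qfact_def qint_nonzero)

lemma qbinom_0 [simp]: "qbinom p n 0 = 1" and qbinom_self [simp]: "qbinom p n n = 1"
  by (simp_all add: qbinom_def qfact_nonzero)

lemma qbinom_symmetric: "r \<le> n \<Longrightarrow> qbinom p n (n - r) = qbinom p n r"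
  by (simp add: qbinom_def mult.commute)

lemma qint_add: "qint p (a + b) = p ^ b * qint p a + inverse p ^ a * qint p b"
proof -
  have "p ^ b * (p ^ a - inverse p ^ a) + inverse p ^ a * (p ^ b - inverse p ^ b)
      = p ^ (a + b) - inverse p ^ (a + b)"
    by (simp add: algebra_simps power_add)
  then show ?thesis
    by (simp only: qint_def times_divide_eq_right add_divide_distrib[symmetric])
qed

text \<open>The Pascal rule for quantum binomials, from writing \<open>[n + 1]\<close> as
  \<open>p ^ (r + 1) [n - r] + inverse p ^ (n - r) [r + 1]\<close>.\<close>

lemma qbinom_Suc:
  assumes "r < n"
  shows "qbinom p (Suc n) (Suc r) = p ^ Suc r * qbinom p n (Suc r) + inverse p ^ (n - r) * qbinom p n r"
proof -
  \<comment> \<open>With \<open>n = Suc (k + r)\<close> the truncated differences inside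
    \<open>qbinom\<close> become \<open>k\<close> and \<open>Suc k\<close>.\<close>
  define k where "k = n - Suc r"
  have n: "n = Suc (k + r)" using assms by (simp add: k_def)
  have nz: "qint p (Suc k) \<noteq> 0" "qint p (Suc r) \<noteq> 0" "qfact p k \<noteq> 0" "qfact p r \<noteq> 0"
    using qint_nonzero qfact_nonzero by auto
  have "qint p (Suc n) = p ^ Suc r * qint p (Suc k) + inverse p ^ Suc k * qint p (Suc r)"
    using qint_add[of "Suc k" "Suc r"] n by (simp add: add.commute)
  then have "qbinom p (Suc n) (Suc r) = (p ^ Suc r * qint p (Suc k) + inverse p ^ Suc k * qint p (Suc r))
      * qfact p n / (qint p (Suc k) * qfact p k * (qint p (Suc r) * qfact p r))"
    using n by (simp add: qbinom_def qfact_Suc del: power_Suc)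
  also have "\<dots> = p ^ Suc r * (qfact p n / (qfact p k * (qint p (Suc r) * qfact p r)))
      + inverse p ^ Suc k * (qfact p n / (qint p (Suc k) * qfact p k * qfact p r))"
    using nz by (simp add: divide_simps distrib_right del: power_Suc)
  also have "\<dots> = p ^ Suc r * qbinom p n (Suc r) + inverse p ^ (n - r) * qbinom p n r"
    using n by (simp add: qbinom_def qfact_Suc del: power_Suc)
  finally show ?thesis .
qed

lemma generic_inverse: "generic_parameter (inverse p)"
  using nonzero generic by unfold_locales (auto simp: power_inverse)

end

text \<open>The parameters \<open>w\<close>, \<open>p\<close> and \<open>n\<close> are kept
  independent because the recursions change \<open>w\<close> together with \<open>n\<close>. The
  Serre relation is the case where \<open>w\<close> is the value of \<open>\<omega>\<close> at the
  two degrees, \<open>p\<close> is \<open>q_sub d i\<close> and \<open>n\<close> is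
  \<open>1 - A i j\<close>.\<close>

definition serre_el ::
  "('a, 'g) graded_algebra \<Rightarrow> cq \<Rightarrow> cq \<Rightarrow> nat \<Rightarrow> 'a \<Rightarrow> 'a \<Rightarrow> 'a" where
  "serre_el H w p n x u = (\<Oplus>\<^bsub>H\<^esub>r\<in>{..n}. ((- w) ^ r * qbinom p n r) \<odot>\<^bsub>H\<^esub>
     (x [^]\<^bsub>H\<^esub> (n - r) \<otimes>\<^bsub>H\<^esub> u \<otimes>\<^bsub>H\<^esub> x [^]\<^bsub>H\<^esub> r))"

lemma serre_el_inverse: "serre_el H w (inverse p) n x u = serre_el H w p n x u"
  by (simp add: serre_el_def qbinom_inverse)

lemma gamma_hom_pow:
  assumes "gamma_algebra H" "gamma_algebra P" "gamma_hom H P f" "x \<in> carrier H"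
  shows "f (x [^]\<^bsub>H\<^esub> (n :: nat)) = f x [^]\<^bsub>P\<^esub> n"
proof -
  interpret H: gamma_algebra H by fact
  interpret P: gamma_algebra P by fact
  show ?thesis
    using assms(4)
    by (induction n) (simp_all add: gamma_hom_one[OF assms(3)] gamma_hom_mult[OF assms(3)])
qed

lemma gamma_hom_serre:
  assumes "gamma_algebra H" "gamma_algebra P" "gamma_hom H P f" "x \<in> carrier H" "u \<in> carrier H"
  shows "f (serre_el H w p n x u) = serre_el P w p n (f x) (f u)"
proof -
  interpret H: gamma_algebra H by fact
  interpret P: gamma_algebra P by fact
  show ?thesis
    unfolding serre_el_def using assms(4,5)
    by (simp add: cq_linear_finsum[OF H.cq_module_axioms P.cq_module_axioms gamma_hom_linear[OF assms(3)]]
        gamma_hom_smult[OF assms(3)] gamma_hom_mult[OF assms(3)] gamma_hom_pow[OF assms(1-3)])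
qed

section \<open>Factorisation and splitting of Serre elements\<close>

context gamma_algebra
begin

lemma serre_el_closed [simp]:
  "x \<in> carrier H \<Longrightarrow> u \<in> carrier H \<Longrightarrow> serre_el H w p n x u \<in> carrier H"
  by (auto simp: serre_el_def intro!: M.finsum_closed)

lemma serre_el_0 [simp]:
  "x \<in> carrier H \<Longrightarrow> u \<in> carrier H \<Longrightarrow> serre_el H w p 0 x u = u"
  by (simp add: serre_el_def qbinom_def)

lemma serre_el_add_right:
  assumes "x \<in> carrier H" "u \<in> carrier H" "v \<in> carrier H"
  shows "serre_el H w p n x (u \<oplus> v) = serre_el H w p n x u \<oplus> serre_el H w p n x v"
  using assms unfolding serre_el_def
  by (simp add: r_distr l_distr smult_add_right M.finsum_addf)

text \<open>The left-hand side of the quantum Serre relation is a product of commuting factors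
  \<open>L\<^sub>x - w p\<^sup>n\<^sup>-\<^sup>1\<^sup>-\<^sup>2\<^sup>s R\<^sub>x\<close> (left and right multiplication by \<open>x\<close>) applied to \<open>u\<close>; this splits off
  the last one.\<close>

lemma serre_el_Suc:
  assumes "generic_parameter p" and x: "x \<in> carrier H" and u: "u \<in> carrier H"
  shows "serre_el H w p (Suc n) x u =
    x \<otimes> serre_el H (w * p) p n x u \<ominus> (w * inverse p ^ n) \<odot> (serre_el H (w * p) p n x u \<otimes> x)"
proof -
  interpret generic_parameter p by fact
  define m where "m r = x [^] (Suc n - r) \<otimes> u \<otimes> x [^] r" for r
  \<comment> \<open>The sum of length \<open>n + 1\<close> is matched with \<open>x v\<close> and
    \<open>v x\<close>, where \<open>v\<close> is the sum of length \<open>n\<close>. The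
    coefficients \<open>a\<close> come from \<open>x v\<close>; those from \<open>v x\<close> are
    \<open>b\<close>, shifted by one because the right power of \<open>x\<close> grows. Both are
    extended by zero, so that both sums run up to \<open>Suc n\<close>.\<close>
  define a where "a r = (if r \<le> n then (- (w * p)) ^ r * qbinom p n r else 0)" for r
  define b where "b r = (case r of 0 \<Rightarrow> 0 | Suc s \<Rightarrow> - (w * inverse p ^ n) * a s)" for r
  have mc [simp]: "m r \<in> carrier H" for r using x u by (simp add: m_def)
  have coeff: "(- w) ^ r * qbinom p (Suc n) r = a r + b r" if "r \<le> Suc n" for r
  proof (cases r)
    case 0
    then show ?thesis by (simp add: a_def b_def)
  next
    case (Suc s)
    show ?thesis
    \<comment> \<open>The Pascal rule covers \<open>s < n\<close>; at the top both binomials are 1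
      and only powers of \<open>w\<close> and \<open>p\<close> have to agree.\<close>
    proof (cases "s = n")
      case True
      have "(- w) ^ Suc n = - (w * inverse p ^ n) * (- (w * p)) ^ n"
      proof -
        have "inverse p ^ n * p ^ n = 1"
          using nonzero by (simp flip: power_mult_distrib)
        moreover have "- (w * inverse p ^ n) * (- (w * p)) ^ n = - w * (- w) ^ n * (inverse p ^ n * p ^ n)"
          by (simp only: minus_mult_left power_mult_distrib) (simp add: mult_ac)
        ultimately show ?thesis by (simp only: mult_1_right power_Suc)
      qed
      then show ?thesis using Suc True by (simp add: a_def b_def)
    next
      case False
      then have s: "s < n" using that Suc by simp
      have e: "inverse p ^ (n - s) = inverse p ^ n * p ^ s"
        using nonzero s by (simp add: power_diff power_inverse field_simps)
      have "(- w) ^ Suc s * qbinom p (Suc n) (Suc s)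
          = (- w) ^ Suc s * p ^ Suc s * qbinom p n (Suc s)
            - (w * inverse p ^ n) * ((- w) ^ s * p ^ s * qbinom p n s)"
        unfolding qbinom_Suc[OF s] e by (simp add: algebra_simps)
      also have "\<dots> = (- (w * p)) ^ Suc s * qbinom p n (Suc s)
            - (w * inverse p ^ n) * ((- (w * p)) ^ s * qbinom p n s)"
        by (simp only: minus_mult_left power_mult_distrib)
      finally show ?thesis using Suc s by (simp add: a_def b_def)
    qed
  qed
  have "serre_el H w p (Suc n) x u = (\<Oplus>r\<in>{..Suc n}. a r \<odot> m r \<oplus> b r \<odot> m r)"
    unfolding serre_el_def m_def[symmetric]
    by (rule M.finsum_cong') (auto simp: coeff smult_add)
  also have "\<dots> = (\<Oplus>r\<in>{..Suc n}. a r \<odot> m r) \<oplus> (\<Oplus>r\<in>{..Suc n}. b r \<odot> m r)"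
    by (rule M.finsum_addf) auto
  also have "(\<Oplus>r\<in>{..Suc n}. a r \<odot> m r) = (\<Oplus>r\<in>{..n}. a r \<odot> m r)"
  proof -
    have "a (Suc n) = 0" by (simp add: a_def)
    then show ?thesis by (simp add: M.finsum_Suc Pi_iff del: M.finsum_addf)
  qed
  also have "\<dots> = (\<Oplus>r\<in>{..n}. x \<otimes> (((- (w * p)) ^ r * qbinom p n r) \<odot> (x [^] (n - r) \<otimes> u \<otimes> x [^] r)))"
  proof (rule M.finsum_cong'[OF refl])
    fix r assume "r \<in> {..n}"
    then have "x [^] (Suc n - r) = x \<otimes> x [^] (n - r)"
      using x nat_pow_Suc2[OF x, of "n - r"] by (simp add: Suc_diff_le)
    then show "a r \<odot> m r = x \<otimes> (((- (w * p)) ^ r * qbinom p n r) \<odot> (x [^] (n - r) \<otimes> u \<otimes> x [^] r))"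
      using x u \<open>r \<in> {..n}\<close> by (simp add: a_def m_def smult_mult_right m_assoc)
  qed (use x u in auto)
  also have "\<dots> = x \<otimes> serre_el H (w * p) p n x u"
    unfolding serre_el_def using x u by (intro finsum_rdistr[symmetric]) auto
  also have "(\<Oplus>r\<in>{..Suc n}. b r \<odot> m r) = (\<Oplus>r\<in>{..n}. b (Suc r) \<odot> m (Suc r))"
  proof -
    have "b 0 \<odot> m 0 = \<zero>" by (simp add: b_def)
    then show ?thesis by (subst M.finsum_Suc2) (auto intro!: M.r_zero M.finsum_closed)
  qed
  also have "\<dots> = (\<Oplus>r\<in>{..n}. (- (w * inverse p ^ n)) \<odot>
      (((- (w * p)) ^ r * qbinom p n r) \<odot> (x [^] (n - r) \<otimes> u \<otimes> x [^] r) \<otimes> x))"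
    using x u
    by (intro M.finsum_cong') (auto simp: a_def b_def m_def smult_mult_left smult_smult m_assoc)
  also have "\<dots> = (- (w * inverse p ^ n)) \<odot> (serre_el H (w * p) p n x u \<otimes> x)"
    unfolding serre_el_def using x u
    by (subst finsum_ldistr) (auto intro!: finsum_smult_ldistr[symmetric])
  finally show ?thesis
    using x u by (simp add: a_minus_def smult_minus_left)
qed

text \<open>Inverting \<open>p\<close> leaves the Serre element unchanged and reverses the list of
  exponents, so the top factor can be the last one instead of the bottom factor.\<close>

lemma serre_el_Suc':
  assumes "generic_parameter p" and x: "x \<in> carrier H" and u: "u \<in> carrier H"
  shows "serre_el H w p (Suc n) x u =
    x \<otimes> serre_el H (w * inverse p) p n x u \<ominus> (w * p ^ n) \<odot> (serre_el H (w * inverse p) p n x u \<otimes> x)"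
  using serre_el_Suc[OF generic_parameter.generic_inverse[OF assms(1)] x u, of w n]
  by (simp add: serre_el_inverse)

lemma add_diff_cancel_middle: "x \<in> carrier H \<Longrightarrow> y \<in> carrier H \<Longrightarrow> x \<oplus> (y \<oplus> \<ominus> x) = y"
  by (metis M.a_comm M.a_assoc M.a_inv_closed M.r_neg M.r_zero)

lemma add_diff_cancel_middle':
  "x \<in> carrier H \<Longrightarrow> y \<in> carrier H \<Longrightarrow> z \<in> carrier H \<Longrightarrow> x \<oplus> (y \<oplus> (\<ominus> x \<oplus> z)) = y \<oplus> z"
  by (simp add: M.a_lcomm[of x y] r_neg2)

text \<open>The second conjunct drives the induction. The intermediate element \<open>v\<close>
  satisfies \<open>y v = c v y\<close> with exactly the constant \<open>c\<close> of the next
  factor, so \<open>y\<close> contributes nothing to that factor. Since \<open>y\<close> passes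
  \<open>x\<close> at the cost of \<open>inverse p ^ 2\<close>, the constant drops by that amount,
  as do the constants of the factors. The condition on \<open>\<kappa>\<close> fixes the start: the
  first factor has constant \<open>w p ^ (n - 1)\<close> for positive \<open>n\<close>.\<close>

lemma serre_el_split_left:
  assumes p: "generic_parameter p" and x: "x \<in> carrier H" and y: "y \<in> carrier H" and u: "u \<in> carrier H"
    and yx: "y \<otimes> x = (inverse p ^ 2) \<odot> (x \<otimes> y)" and yu: "y \<otimes> u = \<kappa> \<odot> (u \<otimes> y)"
    and \<kappa>: "w * p ^ n = \<kappa> * p"
  shows "serre_el H w p n (x \<oplus> y) u = serre_el H w p n x u \<and>
    y \<otimes> serre_el H w p n x u = (\<kappa> * inverse p ^ (2 * n)) \<odot> (serre_el H w p n x u \<otimes> y)"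
  using \<kappa>
proof (induction n arbitrary: w)
  case 0
  then show ?case using x y u yu by simp
next
  case (Suc n)
  interpret generic_parameter p by (rule p)
  define v where "v = serre_el H (w * p) p n x u"
  have v: "v \<in> carrier H" using x u by (simp add: v_def)
  define c where "c = w * inverse p ^ n"
  have IH: "serre_el H (w * p) p n (x \<oplus> y) u = v" "y \<otimes> v = (\<kappa> * inverse p ^ (2 * n)) \<odot> (v \<otimes> y)"
    using Suc.IH[of "w * p"] Suc.prems by (simp_all add: v_def mult_ac)
  have "\<kappa> = w * p ^ n" using Suc.prems nonzero by simp
  then have "\<kappa> * inverse p ^ (2 * n) = w * inverse p ^ n * (p ^ n * inverse p ^ n)"
    by (simp only: mult_2 mult_2_right power_add mult_ac)
  also have "p ^ n * inverse p ^ n = 1" using nonzero by (simp flip: power_mult_distrib)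
  finally have c: "\<kappa> * inverse p ^ (2 * n) = c" by (simp add: c_def)
  have yv: "y \<otimes> v = c \<odot> (v \<otimes> y)" using IH(2) c by simp
  have S: "serre_el H w p (Suc n) x u = x \<otimes> v \<ominus> c \<odot> (v \<otimes> x)"
    by (simp only: serre_el_Suc[OF p x u] v_def c_def)
  have "serre_el H w p (Suc n) (x \<oplus> y) u = (x \<oplus> y) \<otimes> v \<ominus> c \<odot> (v \<otimes> (x \<oplus> y))"
    using serre_el_Suc[OF p _ u, of "x \<oplus> y" w n] x y by (simp add: IH(1) c_def)
  also have "\<dots> = x \<otimes> v \<ominus> c \<odot> (v \<otimes> x)"
    using x y v
    by (simp add: l_distr r_distr yv smult_add_right a_minus_def M.minus_add M.a_ac M.r_neg1 M.r_neg2
        add_diff_cancel_middle add_diff_cancel_middle')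
  finally have 1: "serre_el H w p (Suc n) (x \<oplus> y) u = serre_el H w p (Suc n) x u"
    unfolding S .
  have d: "\<kappa> * inverse p ^ (2 * Suc n) = inverse p ^ 2 * c"
    unfolding c[symmetric] by (simp add: power_add power2_eq_square)
  have "y \<otimes> (x \<otimes> v) = (y \<otimes> x) \<otimes> v" using x y v by (simp add: m_assoc)
  also have "\<dots> = (inverse p ^ 2 * c) \<odot> (x \<otimes> v \<otimes> y)"
    using x y v by (simp add: yx smult_mult_left m_assoc yv smult_mult_right smult_smult)
  finally have t1: "y \<otimes> (x \<otimes> v) = (inverse p ^ 2 * c) \<odot> (x \<otimes> v \<otimes> y)" .
  have "y \<otimes> (v \<otimes> x) = (y \<otimes> v) \<otimes> x" using x y v by (simp add: m_assoc)
  also have "\<dots> = c \<odot> (v \<otimes> (y \<otimes> x))" using x y v by (simp add: yv smult_mult_left m_assoc)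
  also have "\<dots> = (inverse p ^ 2 * c) \<odot> (v \<otimes> x \<otimes> y)"
    using x y v by (simp add: yx smult_mult_right m_assoc smult_smult mult.commute)
  finally have t2: "y \<otimes> (v \<otimes> x) = (inverse p ^ 2 * c) \<odot> (v \<otimes> x \<otimes> y)" .
  have "y \<otimes> (x \<otimes> v \<ominus> c \<odot> (v \<otimes> x)) = y \<otimes> (x \<otimes> v) \<ominus> c \<odot> (y \<otimes> (v \<otimes> x))"
    using x y v by (simp add: a_minus_def r_distr r_minus smult_mult_right)
  also have "\<dots> = (inverse p ^ 2 * c) \<odot> ((x \<otimes> v \<ominus> c \<odot> (v \<otimes> x)) \<otimes> y)"
    using x y v
    by (simp add: t1 t2 a_minus_def l_distr l_minus smult_mult_left smult_add_right
        smult_minus_right smult_smult mult_ac)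
  finally have "y \<otimes> serre_el H w p (Suc n) x u
      = (\<kappa> * inverse p ^ (2 * Suc n)) \<odot> (serre_el H w p (Suc n) x u \<otimes> y)"
    unfolding S d .
  with 1 show ?case by simp
qed

text \<open>The mirror image, with the bottom factor first. In each step the constant
  \<open>c\<close> of the factor and the constant \<open>k\<close> in \<open>u x = k x u\<close>
  satisfy \<open>c * k = 1\<close>, so the two contributions of \<open>x\<close> cancel. The
  condition on \<open>\<kappa>\<close> expresses this for the first factor.\<close>

lemma serre_el_split_right:
  assumes p: "generic_parameter p" and x: "x \<in> carrier H" and y: "y \<in> carrier H" and v: "v \<in> carrier H"
    and yx: "y \<otimes> x = (inverse p ^ 2) \<odot> (x \<otimes> y)" and vx: "v \<otimes> x = \<kappa> \<odot> (x \<otimes> v)"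
    and \<kappa>: "w * \<kappa> * p = p ^ n"
  shows "serre_el H w p n (x \<oplus> y) v = serre_el H w p n y v \<and>
    serre_el H w p n y v \<otimes> x = (\<kappa> * inverse p ^ (2 * n)) \<odot> (x \<otimes> serre_el H w p n y v)"
  using \<kappa>
proof (induction n arbitrary: w)
  case 0
  then show ?case using x y v vx by simp
next
  case (Suc n)
  interpret generic_parameter p by (rule p)
  define u where "u = serre_el H (w * inverse p) p n y v"
  have u: "u \<in> carrier H" using y v by (simp add: u_def)
  define c where "c = w * p ^ n"
  define k where "k = \<kappa> * inverse p ^ (2 * n)"
  have IH: "serre_el H (w * inverse p) p n (x \<oplus> y) v = u" "u \<otimes> x = k \<odot> (x \<otimes> u)"
    using Suc.IH[of "w * inverse p"] Suc.prems nonzero by (simp_all add: u_def k_def field_simps)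
  have "w * \<kappa> = p ^ n" using Suc.prems nonzero by simp
  have "c * k = w * \<kappa> * p ^ n * (inverse p ^ n * inverse p ^ n)"
    by (simp only: c_def k_def mult_2 mult_2_right power_add mult_ac)
  also have "\<dots> = (p ^ n * inverse p ^ n) * (p ^ n * inverse p ^ n)"
    by (simp only: \<open>w * \<kappa> = p ^ n\<close>) (simp only: mult_ac)
  also have "p ^ n * inverse p ^ n = 1" using nonzero by (simp flip: power_mult_distrib)
  finally have ck: "c * k = 1" by simp
  have S: "serre_el H w p (Suc n) y v = y \<otimes> u \<ominus> c \<odot> (u \<otimes> y)"
    by (simp only: serre_el_Suc'[OF p y v] u_def c_def)
  have cux: "c \<odot> (u \<otimes> x) = x \<otimes> u"
    using x u ck by (simp add: IH(2) smult_smult)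
  have "serre_el H w p (Suc n) (x \<oplus> y) v = (x \<oplus> y) \<otimes> u \<ominus> c \<odot> (u \<otimes> (x \<oplus> y))"
    using serre_el_Suc'[OF p _ v, of "x \<oplus> y" w n] x y by (simp add: IH(1) c_def)
  also have "\<dots> = y \<otimes> u \<ominus> c \<odot> (u \<otimes> y)"
    using x y u
    by (simp add: l_distr r_distr smult_add_right cux a_minus_def M.minus_add M.a_ac M.r_neg1 M.r_neg2
        add_diff_cancel_middle add_diff_cancel_middle')
  finally have 1: "serre_el H w p (Suc n) (x \<oplus> y) v = serre_el H w p (Suc n) y v"
    unfolding S .
  have d: "\<kappa> * inverse p ^ (2 * Suc n) = inverse p ^ 2 * k"
    by (simp add: k_def power_add power2_eq_square)
  have "y \<otimes> u \<otimes> x = k \<odot> ((y \<otimes> x) \<otimes> u)"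
    using x y u by (simp add: m_assoc IH(2) smult_mult_right)
  also have "\<dots> = (inverse p ^ 2 * k) \<odot> (x \<otimes> (y \<otimes> u))"
    using x y u by (simp add: yx smult_mult_left m_assoc smult_smult mult.commute)
  finally have t1: "y \<otimes> u \<otimes> x = (inverse p ^ 2 * k) \<odot> (x \<otimes> (y \<otimes> u))" .
  have "u \<otimes> y \<otimes> x = inverse p ^ 2 \<odot> (u \<otimes> x \<otimes> y)"
    using x y u by (simp add: m_assoc yx smult_mult_right)
  also have "\<dots> = (inverse p ^ 2 * k) \<odot> (x \<otimes> (u \<otimes> y))"
    using x y u by (simp add: IH(2) smult_mult_left m_assoc smult_smult)
  finally have t2: "u \<otimes> y \<otimes> x = (inverse p ^ 2 * k) \<odot> (x \<otimes> (u \<otimes> y))" .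
  have "(y \<otimes> u \<ominus> c \<odot> (u \<otimes> y)) \<otimes> x = y \<otimes> u \<otimes> x \<ominus> c \<odot> (u \<otimes> y \<otimes> x)"
    using x y u by (simp add: a_minus_def l_distr l_minus smult_mult_left)
  also have "\<dots> = (inverse p ^ 2 * k) \<odot> (x \<otimes> (y \<otimes> u \<ominus> c \<odot> (u \<otimes> y)))"
    using x y u
    by (simp add: t1 t2 a_minus_def r_distr r_minus smult_mult_right smult_add_right
        smult_minus_right smult_smult mult_ac)
  finally have "serre_el H w p (Suc n) y v \<otimes> x
      = (\<kappa> * inverse p ^ (2 * Suc n)) \<odot> (x \<otimes> serre_el H w p (Suc n) y v)"
    unfolding S d .
  with 1 show ?case by simp
qed

lemma serre_el_add:
  assumes p: "generic_parameter p"
    and c: "x \<in> carrier H" "y \<in> carrier H" "u \<in> carrier H" "v \<in> carrier H"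
    and yx: "y \<otimes> x = (inverse p ^ 2) \<odot> (x \<otimes> y)"
    and yu: "y \<otimes> u = \<kappa> \<odot> (u \<otimes> y)" and \<kappa>: "w * p ^ n = \<kappa> * p"
    and vx: "v \<otimes> x = \<nu> \<odot> (x \<otimes> v)" and \<nu>: "w * \<nu> * p = p ^ n"
  shows "serre_el H w p n (x \<oplus> y) (u \<oplus> v) = serre_el H w p n x u \<oplus> serre_el H w p n y v"
  using serre_el_split_left[OF p c(1,2,3) yx yu \<kappa>] serre_el_split_right[OF p c(1,2,4) yx vx \<nu>] c
  by (simp add: serre_el_add_right)

text \<open>The factors collected when moving \<open>g\<close> and \<open>h\<close> to the right depend only on the total degree
  of a monomial in \<open>x\<close>.\<close>

lemma serre_el_twist:
  assumes c: "e \<in> carrier H" "v \<in> carrier H" "g \<in> carrier H" "h \<in> carrier H"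
    and x: "x = s \<odot> (e \<otimes> g)" and u: "u = t \<odot> (v \<otimes> h)"
    and ge: "g \<otimes> e = a \<odot> (e \<otimes> g)" and gv: "g \<otimes> v = b \<odot> (v \<otimes> g)"
    and he: "h \<otimes> e = b \<odot> (e \<otimes> h)" and gh: "g \<otimes> h = h \<otimes> g"
    and zero: "serre_el H w p n e v = \<zero>"
  shows "serre_el H w p n x u = \<zero>"
proof -
  \<comment> \<open>The scalar collected by a monomial with \<open>n\<close> factors
    \<open>x\<close>. One more factor contributes \<open>s\<close>, then \<open>a ^ n\<close> for
    passing the other letters \<open>e\<close>, and \<open>b\<close>, either from \<open>g\<close>
    passing \<open>v\<close> or from \<open>h\<close> passing \<open>e\<close>. That these two
    constants agree makes the position of the factor irrelevant.\<close>
  define K where "K = rec_nat t (\<lambda>n k. s * a ^ n * b * k)"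
  have K: "K 0 = t" "K (Suc n) = s * a ^ n * b * K n" for n by (simp_all add: K_def)
  have gpow: "g [^] n \<otimes> e = a ^ n \<odot> (e \<otimes> g [^] n)" for n :: nat
  proof (induction n)
    case (Suc n)
    have "g [^] Suc n \<otimes> e = g [^] n \<otimes> (g \<otimes> e)" using c by (simp add: m_assoc)
    also have "\<dots> = a \<odot> ((g [^] n \<otimes> e) \<otimes> g)" using c by (simp add: ge smult_mult_right m_assoc)
    also have "\<dots> = a ^ Suc n \<odot> (e \<otimes> g [^] Suc n)"
      using c by (simp add: Suc smult_mult_left smult_smult m_assoc)
    finally show ?case .
  qed (use c in simp)
  have epow: "g \<otimes> e [^] n = a ^ n \<odot> (e [^] n \<otimes> g)" for n :: nat
  proof (induction n)
    case (Suc n)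
    have "g \<otimes> e [^] Suc n = (g \<otimes> e [^] n) \<otimes> e" using c by (simp add: m_assoc)
    also have "\<dots> = a ^ n \<odot> (e [^] n \<otimes> (g \<otimes> e))" using c by (simp add: Suc smult_mult_left m_assoc)
    also have "\<dots> = a ^ Suc n \<odot> (e [^] Suc n \<otimes> g)"
      using c by (simp add: ge smult_mult_right smult_smult m_assoc mult.commute)
    finally show ?case .
  qed (use c in simp)
  have gnh: "h \<otimes> g [^] n = g [^] n \<otimes> h" for n :: nat
    using c gh by (metis group_commutes_pow)
  have right: "v \<otimes> h \<otimes> x [^] j = (\<Prod>i<j. s * a ^ i * b) \<odot> (v \<otimes> e [^] j \<otimes> g [^] j \<otimes> h)" for j :: nat
  proof (induction j)
    case (Suc j)
    have "v \<otimes> h \<otimes> x [^] Suc j = (v \<otimes> h \<otimes> x [^] j) \<otimes> (s \<odot> (e \<otimes> g))"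
      using c x by (simp add: m_assoc)
    also have "\<dots> = (s * (\<Prod>i<j. s * a ^ i * b)) \<odot> (v \<otimes> e [^] j \<otimes> g [^] j \<otimes> (h \<otimes> e) \<otimes> g)"
      using c by (simp add: Suc smult_mult_left smult_mult_right smult_smult m_assoc mult.commute)
    also have "\<dots> = (s * b * (\<Prod>i<j. s * a ^ i * b)) \<odot> (v \<otimes> e [^] j \<otimes> (g [^] j \<otimes> e) \<otimes> (h \<otimes> g))"
      using c by (simp add: he smult_mult_left smult_mult_right smult_smult m_assoc mult_ac)
    also have "\<dots> = (\<Prod>i<Suc j. s * a ^ i * b) \<odot> (v \<otimes> e [^] Suc j \<otimes> g [^] Suc j \<otimes> h)"
      using c by (simp add: gpow gh[symmetric] smult_mult_left smult_mult_right smult_smult m_assoc mult_ac)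
    finally show ?case .
  qed (use c in simp)
  have mono: "x [^] i \<otimes> u \<otimes> x [^] j = K (i + j) \<odot> (e [^] i \<otimes> v \<otimes> e [^] j \<otimes> (g [^] (i + j) \<otimes> h))"
    for i j :: nat
  proof (induction i)
    case 0
    have "K j = t * (\<Prod>i<j. s * a ^ i * b)" by (induction j) (simp_all add: K mult_ac)
    moreover have "u \<otimes> x [^] j = t \<odot> (v \<otimes> h \<otimes> x [^] j)"
      using c x by (simp add: u smult_mult_left)
    ultimately show ?case
      using c x unfolding right by (simp add: smult_smult m_assoc u)
  next
    case (Suc i)
    have xc: "x \<in> carrier H" "u \<in> carrier H" using c x u by auto
    have "x [^] Suc i \<otimes> u \<otimes> x [^] j = x \<otimes> (x [^] i \<otimes> u \<otimes> x [^] j)"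
      using xc by (simp only: nat_pow_Suc2[OF xc(1)]) (simp add: m_assoc)
    also have "\<dots> = (s \<odot> (e \<otimes> g)) \<otimes>
        (K (i + j) \<odot> (e [^] i \<otimes> v \<otimes> e [^] j \<otimes> (g [^] (i + j) \<otimes> h)))"
      by (simp only: Suc.IH) (simp only: x)
    also have "\<dots> = (s * K (i + j)) \<odot> (e \<otimes> (g \<otimes> e [^] i) \<otimes> v \<otimes> e [^] j \<otimes> (g [^] (i + j) \<otimes> h))"
      using c by (simp add: smult_mult_left smult_mult_right smult_smult m_assoc mult.commute)
    also have "\<dots> = (s * a ^ i * K (i + j)) \<odot> (e \<otimes> e [^] i \<otimes> (g \<otimes> v) \<otimes> e [^] j \<otimes> (g [^] (i + j) \<otimes> h))"
      using c by (simp add: epow smult_mult_left smult_mult_right smult_smult m_assoc mult_ac)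
    also have "\<dots> = (s * a ^ i * b * K (i + j)) \<odot> (e \<otimes> e [^] i \<otimes> v \<otimes> (g \<otimes> e [^] j) \<otimes> (g [^] (i + j) \<otimes> h))"
      using c by (simp add: gv smult_mult_left smult_mult_right smult_smult m_assoc mult_ac)
    also have "\<dots> = (s * a ^ (i + j) * b * K (i + j)) \<odot>
        ((e \<otimes> e [^] i) \<otimes> v \<otimes> e [^] j \<otimes> ((g \<otimes> g [^] (i + j)) \<otimes> h))"
      using c by (simp add: epow smult_mult_left smult_mult_right smult_smult m_assoc mult_ac power_add)
    also have "\<dots> = K (Suc i + j) \<odot> (e [^] Suc i \<otimes> v \<otimes> e [^] j \<otimes> (g [^] (Suc i + j) \<otimes> h))"
      using c by (simp only: nat_pow_Suc2[OF c(1)] nat_pow_Suc2[OF c(3)] K add_Suc)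
    finally show ?case .
  qed
  have "serre_el H w p n x u = (\<Oplus>r\<in>{..n}. K n \<odot>
      ((((- w) ^ r * qbinom p n r) \<odot> (e [^] (n - r) \<otimes> v \<otimes> e [^] r)) \<otimes> (g [^] n \<otimes> h)))"
    unfolding serre_el_def
    using c by (intro M.finsum_cong') (auto simp: mono smult_mult_left smult_smult mult_ac)
  also have "\<dots> = K n \<odot> (serre_el H w p n e v \<otimes> (g [^] n \<otimes> h))"
    unfolding serre_el_def using c
    by (subst finsum_ldistr) (auto intro!: finsum_smult_ldistr[symmetric])
  also have "\<dots> = \<zero>" using c by (simp add: zero)
  finally show ?thesis .
qed

end

section \<open>Serre elements in the opposite algebra\<close>

context com_factor_algebra
begin

text \<open>Since \<open>w \<alpha> \<alpha> = 1\<close>, equal factors are reversed without cost.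
  The degree of the power, \<open>n\<close> times \<open>\<alpha>\<close>, matters only through its
  pairings, which explains the existential.\<close>

lemma op_pow:
  assumes x: "x \<in> hom_part H \<alpha>" and \<alpha>: "w \<alpha> \<alpha> = 1"
  shows "x [^]\<^bsub>opH\<^esub> (n::nat) = x [^] n \<and> (\<forall>\<beta>. \<exists>\<gamma>. x [^] n \<in> hom_part H \<gamma> \<and>
    w \<gamma> \<alpha> = 1 \<and> w \<gamma> \<beta> = w \<alpha> \<beta> ^ n \<and> w \<beta> \<gamma> = w \<beta> \<alpha> ^ n)"
proof (induction n)
  case 0
  then show ?case using one_hom_part by (auto intro!: exI[of _ 0])
next
  case (Suc n)
  note xc = hom_carrier[OF x]
  obtain \<gamma>0 where g0: "x [^] n \<in> hom_part H \<gamma>0" "w \<gamma>0 \<alpha> = 1" using Suc by blast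
  have "x [^]\<^bsub>opH\<^esub> Suc n = x [^] n \<diamondop> x" using Suc xc by (simp add: nat_pow_Suc)
  also have "\<dots> = x \<otimes> x [^] n"
    using op_mult_hom[OF g0(1) x] g0(2) xc by simp
  also have "\<dots> = x [^] Suc n" using nat_pow_Suc2[OF xc] by simp
  finally have 1: "x [^]\<^bsub>opH\<^esub> Suc n = x [^] Suc n" .
  have "\<exists>\<gamma>. x [^] Suc n \<in> hom_part H \<gamma> \<and>
    w \<gamma> \<alpha> = 1 \<and> w \<gamma> \<beta> = w \<alpha> \<beta> ^ Suc n \<and> w \<beta> \<gamma> = w \<beta> \<alpha> ^ Suc n" for \<beta>
  proof -
    obtain \<gamma> where "x [^] n \<in> hom_part H \<gamma>" "w \<gamma> \<alpha> = 1" "w \<gamma> \<beta> = w \<alpha> \<beta> ^ n" "w \<beta> \<gamma> = w \<beta> \<alpha> ^ n"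
      using Suc by blast
    then show ?thesis
      using x by (intro exI[of _ "\<gamma> + \<alpha>"]) (simp add: hom_mult w_add_left w_add_right \<alpha> mult.commute)
  qed
  with 1 show ?case by blast
qed

text \<open>The opposite product sends the monomial with powers \<open>i\<close>, \<open>j\<close>
  to the one with powers \<open>j\<close>, \<open>i\<close>, at the cost of
  \<open>w \<alpha> \<beta> ^ i * w \<beta> \<alpha> ^ j\<close>. Summing backwards, the symmetry of
  the binomials and \<open>w \<alpha> \<beta> * w \<beta> \<alpha> = 1\<close> give back the
  original Serre element up to the sign \<open>(- 1) ^ n\<close>.\<close>

lemma op_serre:
  assumes p: "generic_parameter p"
    and x: "x \<in> hom_part H \<alpha>" and \<alpha>: "w \<alpha> \<alpha> = 1" and u: "u \<in> hom_part H \<beta>"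
    and zero: "serre_el H (w \<alpha> \<beta>) p n x u = \<zero>"
  shows "serre_el opH (w \<alpha> \<beta>) p n x u = \<zero>"
proof -
  interpret generic_parameter p by (rule p)
  note c = hom_carrier[OF x] hom_carrier[OF u]
  let ?W = "w \<alpha> \<beta>" and ?V = "w \<beta> \<alpha>"
  have WV: "?V * ?W = 1" "?W * ?V = 1" by (simp_all add: w_inverse)
  have mono: "x [^]\<^bsub>opH\<^esub> i \<diamondop> u \<diamondop> x [^]\<^bsub>opH\<^esub> j = (?W ^ i * ?V ^ j) \<odot> (x [^] j \<otimes> u \<otimes> x [^] i)"
    for i j :: nat
  proof -
    obtain \<gamma> where g: "x [^] i \<in> hom_part H \<gamma>" "w \<gamma> \<alpha> = 1" "w \<gamma> \<beta> = ?W ^ i" "w \<beta> \<gamma> = ?V ^ i"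
      using op_pow[OF x \<alpha>, of i] by blast
    \<comment> \<open>\<open>op_pow\<close> controls the pairing with one degree at a time, so
      \<open>x [^] j\<close> receives one degree tested against \<open>\<gamma>\<close> and one
      tested against \<open>\<beta>\<close>.\<close>
    obtain \<delta> where dl: "x [^] j \<in> hom_part H \<delta>" "w \<delta> \<gamma> = w \<alpha> \<gamma> ^ j" "w \<gamma> \<delta> = w \<gamma> \<alpha> ^ j"
      using op_pow[OF x \<alpha>, of j] by blast
    obtain \<delta>' where dl': "x [^] j \<in> hom_part H \<delta>'" "w \<beta> \<delta>' = ?V ^ j" "w \<delta>' \<alpha> = 1"
      using op_pow[OF x \<alpha>, of j] by blast
    have pw: "x [^]\<^bsub>opH\<^esub> i = x [^] i" "x [^]\<^bsub>opH\<^esub> j = x [^] j" using op_pow[OF x \<alpha>] by auto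
    have cc: "x [^] i \<in> carrier H" "x [^] j \<in> carrier H" using c by auto
    have pj: "x [^] i \<diamondop> x [^] j = x [^] j \<otimes> x [^] i"
      using op_mult_hom[OF g(1) dl(1)] dl(3) g(2) cc by simp
    have uj: "u \<diamondop> x [^] j = ?V ^ j \<odot> (x [^] j \<otimes> u)"
      using op_mult_hom[OF u dl'(1)] dl'(2) by simp
    show ?thesis
    proof (cases "x [^] j \<otimes> u = \<zero>")
      case True
      then show ?thesis
        using cc c by (simp add: pw op_assoc uj cq_linear_zero[OF cq_module_axioms cq_module_axioms op_linear_right])
    next
      case False
      have xju: "x [^] j \<otimes> u \<in> hom_part H (\<delta> + \<beta>)" by (rule hom_mult[OF dl(1) u refl])
      have "x [^] i \<diamondop> (x [^] j \<otimes> u) = w \<gamma> (\<delta> + \<beta>) \<odot> (x [^] j \<otimes> u \<otimes> x [^] i)"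
        by (rule op_mult_hom[OF g(1) xju])
      then show ?thesis
        using cc c by (simp add: pw op_assoc uj op_smult_right w_add_right g dl(3) smult_smult mult.commute)
    qed
  qed
  have "serre_el opH ?W p n x u = (\<Oplus>r\<in>{..n}. ((- ?W) ^ r * qbinom p n r * (?W ^ (n - r) * ?V ^ r)) \<odot>
      (x [^] r \<otimes> u \<otimes> x [^] (n - r)))"
    unfolding serre_el_def using c by (simp add: mono smult_smult)
  also have "\<dots> = (\<Oplus>r\<in>(\<lambda>r. n - r) ` {..n}. ((- ?W) ^ r * qbinom p n r * (?W ^ (n - r) * ?V ^ r)) \<odot>
      (x [^] r \<otimes> u \<otimes> x [^] (n - r)))"
  proof -
    have "r \<in> (\<lambda>r. n - r) ` {..n}" if "r \<le> n" for r
      using that by (intro image_eqI[of _ _ "n - r"]) auto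
    then have "(\<lambda>r. n - r) ` {..n} = {..n}" by auto
    then show ?thesis by simp
  qed
  also have "\<dots> = (\<Oplus>r\<in>{..n}. ((- ?W) ^ (n - r) * qbinom p n (n - r) * (?W ^ (n - (n - r)) * ?V ^ (n - r))) \<odot>
      (x [^] (n - r) \<otimes> u \<otimes> x [^] (n - (n - r))))"
    using c by (intro M.finsum_reindex) (auto simp: inj_on_def)
  also have "\<dots> = (\<Oplus>r\<in>{..n}. (- 1) ^ n \<odot> (((- ?W) ^ r * qbinom p n r) \<odot> (x [^] (n - r) \<otimes> u \<otimes> x [^] r)))"
  proof (rule M.finsum_cong'[OF refl])
    fix r assume r: "r \<in> {..n}"
    have "(- ?W) ^ (n - r) * ?V ^ (n - r) = (- 1) ^ (n - r)"
      using WV by (simp flip: power_mult_distrib)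
    moreover have "(- 1 :: cq) ^ n * (- ?W) ^ r = (- 1) ^ (n - r) * ?W ^ r"
    proof -
      have "(- 1 :: cq) ^ n = (- 1) ^ (n - r) * (- 1) ^ r"
        using r by (simp flip: power_add)
      then show ?thesis by (simp add: mult.assoc flip: power_mult_distrib)
    qed
    moreover have "(- ?W) ^ (n - r) * qbinom p n r * (?W ^ r * ?V ^ (n - r))
        = (- ?W) ^ (n - r) * ?V ^ (n - r) * ?W ^ r * qbinom p n r"
      by (simp only: mult_ac)
    ultimately have eq: "(- ?W) ^ (n - r) * qbinom p n r * (?W ^ r * ?V ^ (n - r))
        = (- 1) ^ n * ((- ?W) ^ r * qbinom p n r)"
      by (simp only: mult.assoc[symmetric])
    have r': "n - (n - r) = r" "qbinom p n (n - r) = qbinom p n r"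
      using r by (simp_all add: qbinom_symmetric)
    have "x [^] (n - r) \<otimes> u \<otimes> x [^] r \<in> carrier H" using c by simp
    then show "((- ?W) ^ (n - r) * qbinom p n (n - r) * (?W ^ (n - (n - r)) * ?V ^ (n - r))) \<odot>
      (x [^] (n - r) \<otimes> u \<otimes> x [^] (n - (n - r))) =
      (- 1) ^ n \<odot> (((- ?W) ^ r * qbinom p n r) \<odot> (x [^] (n - r) \<otimes> u \<otimes> x [^] r))"
      by (simp only: r' smult_smult eq)
  qed (use c in auto)
  also have "\<dots> = (- 1) ^ n \<odot> serre_el H ?W p n x u"
    unfolding serre_el_def using c by (intro finsum_smult_ldistr[symmetric]) auto
  also have "\<dots> = \<zero>" by (simp add: zero)
  finally show ?thesis .
qed

end

section \<open>The presentation\<close>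

lemma cq_of_minus: "cq_of (- a) = - cq_of a"
  by (simp add: cq_of_def)

lemma cq_of_power: "cq_of (a ^ n) = cq_of a ^ n"
  by (induction n) simp_all

text \<open>Words may grow on either side. The disjunction leaves the choice to the application,
  since the two antipode identities propagate in opposite directions.\<close>

lemma free_gen_induct [consumes 1, case_names one add scale mult]:
  assumes "p \<in> free_carrier X" "Q 1"
    "\<And>p q. p \<in> free_carrier X \<Longrightarrow> q \<in> free_carrier X \<Longrightarrow> Q p \<Longrightarrow> Q q \<Longrightarrow> Q (p + q)"
    "\<And>c p. p \<in> free_carrier X \<Longrightarrow> Q p \<Longrightarrow> Q (fscale c p)"
    "(\<forall>x\<in>X. \<forall>p\<in>free_carrier X. Q p \<longrightarrow> Q (letter x * p)) \<or>
     (\<forall>x\<in>X. \<forall>p\<in>free_carrier X. Q p \<longrightarrow> Q (p * letter x))"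
  shows "Q p"
  using assms(1)
proof (induction rule: free_induct)
  case (single u c)
  have *: "Poly_Mapping.single (FWord xs) 1 \<in> free_carrier X" if "set xs \<subseteq> X" for xs
    using that by (simp add: free_carrier_def)
  have nil: "Poly_Mapping.single (FWord []) 1 = (1 :: 'a free)"
    by (simp flip: zero_fword_def)
  have "Q (Poly_Mapping.single (FWord xs) 1)" if "set xs \<subseteq> X" for xs
    using assms(5)
  proof
    assume left: "\<forall>x\<in>X. \<forall>p\<in>free_carrier X. Q p \<longrightarrow> Q (letter x * p)"
    show ?thesis using that
    proof (induction xs)
      case (Cons x xs)
      have "Poly_Mapping.single (FWord (x # xs)) 1 = letter x * Poly_Mapping.single (FWord xs) 1"
        by (simp add: letter_def mult_single plus_fword_def)
      with Cons left * show ?case by auto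
    qed (simp add: nil assms(2))
  next
    assume right: "\<forall>x\<in>X. \<forall>p\<in>free_carrier X. Q p \<longrightarrow> Q (p * letter x)"
    show ?thesis using that
    proof (induction xs rule: rev_induct)
      case (snoc x xs)
      have "Poly_Mapping.single (FWord (xs @ [x])) 1 = Poly_Mapping.single (FWord xs) 1 * letter x"
        by (simp add: letter_def mult_single plus_fword_def)
      with snoc right * show ?case by auto
    qed (simp add: nil assms(2))
  qed
  from assms(4)[OF * this, of "letters u" c] single show ?case
    by (simp add: fscale_simps)
qed (rule assms(3))

text \<open>The defining relations read as equations in an arbitrary graded algebra. They are needed
  in \<open>U\<close> itself and in the three targets: the tensor square, the scalars and the
  opposite algebra.\<close>

definition uq_rel where
  "uq_rel \<omega> \<xi> I d A P E F K K' \<longleftrightarrow>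
     (\<forall>i\<in>I. \<forall>j\<in>I. K i \<otimes>\<^bsub>P\<^esub> K j = K j \<otimes>\<^bsub>P\<^esub> K i) \<and>
     (\<forall>i\<in>I. K i \<otimes>\<^bsub>P\<^esub> K' i = \<one>\<^bsub>P\<^esub>) \<and>
     (\<forall>i\<in>I. K' i \<otimes>\<^bsub>P\<^esub> K i = \<one>\<^bsub>P\<^esub>) \<and>
     (\<forall>i\<in>I. \<forall>j\<in>I. K i \<otimes>\<^bsub>P\<^esub> E j \<otimes>\<^bsub>P\<^esub> K' i = (q_sub d i powi A i j) \<odot>\<^bsub>P\<^esub> E j) \<and>
     (\<forall>i\<in>I. \<forall>j\<in>I. K i \<otimes>\<^bsub>P\<^esub> F j \<otimes>\<^bsub>P\<^esub> K' i = (q_sub d i powi (- A i j)) \<odot>\<^bsub>P\<^esub> F j) \<and>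
     (\<forall>i\<in>I. \<forall>j\<in>I. E i \<otimes>\<^bsub>P\<^esub> F j \<ominus>\<^bsub>P\<^esub> cq_of (\<omega> (\<xi> j) (\<xi> i)) \<odot>\<^bsub>P\<^esub> (F j \<otimes>\<^bsub>P\<^esub> E i) =
        (if i = j then inverse (q_sub d i - inverse (q_sub d i)) \<odot>\<^bsub>P\<^esub> (K i \<ominus>\<^bsub>P\<^esub> K' i) else \<zero>\<^bsub>P\<^esub>)) \<and>
     (\<forall>i\<in>I. \<forall>j\<in>I. i \<noteq> j \<longrightarrow>
        serre_el P (cq_of (\<omega> (\<xi> i) (\<xi> j))) (q_sub d i) (nat (1 - A i j)) (E i) (E j) = \<zero>\<^bsub>P\<^esub>) \<and>
     (\<forall>i\<in>I. \<forall>j\<in>I. i \<noteq> j \<longrightarrow>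
        serre_el P (cq_of (\<omega> (\<xi> i) (\<xi> j))) (q_sub d i) (nat (1 - A i j)) (F i) (F j) = \<zero>\<^bsub>P\<^esub>)"

lemma uq_gens_simps [simp]:
  "GenE i \<in> uq_gens I \<longleftrightarrow> i \<in> I" "GenF i \<in> uq_gens I \<longleftrightarrow> i \<in> I"
  "GenK i \<in> uq_gens I \<longleftrightarrow> i \<in> I" "GenKinv i \<in> uq_gens I \<longleftrightarrow> i \<in> I"
  by (auto simp: uq_gens_def)

lemma uq_gens_cases:
  assumes "x \<in> uq_gens I"
  obtains i where "i \<in> I" "x = GenE i" | i where "i \<in> I" "x = GenF i"
    | i where "i \<in> I" "x = GenK i" | i where "i \<in> I" "x = GenKinv i"
  using assms by (auto simp: uq_gens_def)

locale uq_evaluation = evaluation P g "uq_deg \<xi>"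
  for \<xi> :: "nat \<Rightarrow> 'g::ab_group_add" and P :: "('b, 'g) graded_algebra" and g :: "uq_gen \<Rightarrow> 'b"
begin

lemma ev_serre:
  "ev (serre \<omega> \<xi> d A h i j) =
     serre_el P (cq_of (\<omega> (\<xi> i) (\<xi> j))) (q_sub d i) (nat (1 - A i j)) (g (h i)) (g (h j))"
  by (simp add: serre_def Let_def ev_sum serre_el_def atLeast0AtMost ev_mult ev_scal ev_power
      ev_letter P.smult_mult_left P.m_assoc cq_of_minus cq_of_power)

text \<open>Used in both directions: to map out of \<open>U\<close> when the images satisfy the
  relations, and to see that the generators of \<open>U\<close> satisfy them.\<close>

lemma ev_relations:
  "(\<forall>r\<in>uq_relations \<omega> \<xi> I d A. ev r = \<zero>\<^bsub>P\<^esub>) \<longleftrightarrow>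
     uq_rel \<omega> \<xi> I d A P (\<lambda>i. g (GenE i)) (\<lambda>i. g (GenF i)) (\<lambda>i. g (GenK i)) (\<lambda>i. g (GenKinv i))"
proof -
  have ball2: "(\<forall>r\<in>{f i j | i j. C i j}. R r) \<longleftrightarrow> (\<forall>i j. C i j \<longrightarrow> R (f i j))"
    for f :: "nat \<Rightarrow> nat \<Rightarrow> uq_gen free" and C R by blast
  have ball1: "(\<forall>r\<in>{f i | i. C i}. R r) \<longleftrightarrow> (\<forall>i. C i \<longrightarrow> R (f i))"
    for f :: "nat \<Rightarrow> uq_gen free" and C R by blast
  have if_ev: "ev (if b then x else 0) = (if b then ev x else \<zero>\<^bsub>P\<^esub>)" for b x
    by (simp add: ev_zero)
  show ?thesis
    unfolding uq_relations_def Let_def ball_Un ball2 ball1 uq_rel_def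
    by (simp add: ev_diff ev_mult ev_letter ev_scal ev_one if_ev ev_serre P.diff_eq_zero_iff
        P.smult_mult_left P.m_assoc Ball_def imp_conjL conj_ac)
qed

end

text \<open>The default \<open>z\<close> will be zero: \<open>evaluation\<close> asks for a
  homogeneous value at every letter, also for indices outside \<open>I\<close>, and zero has every
  degree.\<close>

definition gen_map :: "nat set \<Rightarrow> 'b \<Rightarrow> (nat \<Rightarrow> 'b) \<Rightarrow> (nat \<Rightarrow> 'b) \<Rightarrow> (nat \<Rightarrow> 'b) \<Rightarrow> (nat \<Rightarrow> 'b) \<Rightarrow> uq_gen \<Rightarrow> 'b" where
  "gen_map I z E F K K' x = (case x of
     GenE i \<Rightarrow> if i \<in> I then E i else z | GenF i \<Rightarrow> if i \<in> I then F i else z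
   | GenK i \<Rightarrow> if i \<in> I then K i else z | GenKinv i \<Rightarrow> if i \<in> I then K' i else z)"

lemma gen_map_simps [simp]:
  assumes "i \<in> I"
  shows "gen_map I z E F K K' (GenE i) = E i" "gen_map I z E F K K' (GenF i) = F i"
    "gen_map I z E F K K' (GenK i) = K i" "gen_map I z E F K K' (GenKinv i) = K' i"
  using assms by (simp_all add: gen_map_def)

lemma uq_rel_gen_map:
  "uq_rel \<omega> \<xi> I d A P (\<lambda>i. gen_map I z E F K K' (GenE i)) (\<lambda>i. gen_map I z E F K K' (GenF i))
     (\<lambda>i. gen_map I z E F K K' (GenK i)) (\<lambda>i. gen_map I z E F K K' (GenKinv i)) \<longleftrightarrow>
   uq_rel \<omega> \<xi> I d A P E F K K'"
  by (simp add: uq_rel_def cong: ball_cong)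

definition nsum :: "nat \<Rightarrow> 'g::ab_group_add \<Rightarrow> 'g" where
  "nsum n \<alpha> = (\<Sum>_<n. \<alpha>)"

lemma nsum_add: "nsum (m + n) \<alpha> = nsum m \<alpha> + nsum n \<alpha>"
  by (induction n) (simp_all add: nsum_def add_ac)

lemma free_hom_simps:
  shows free_hom_diff: "p \<in> hom_part (free_algebra X deg) \<gamma> \<Longrightarrow> q \<in> hom_part (free_algebra X deg) \<gamma> \<Longrightarrow>
      p - q \<in> hom_part (free_algebra X deg) \<gamma>"
    and free_hom_letter: "x \<in> X \<Longrightarrow> letter x \<in> hom_part (free_algebra X deg) (deg x)"
    and free_hom_scal: "scal c \<in> hom_part (free_algebra X deg) 0"
    and free_hom_mult: "p \<in> hom_part (free_algebra X deg) \<alpha> \<Longrightarrow> q \<in> hom_part (free_algebra X deg) \<beta> \<Longrightarrow>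
      \<alpha> + \<beta> = \<gamma> \<Longrightarrow> p * q \<in> hom_part (free_algebra X deg) \<gamma>"
    and free_hom_power: "p \<in> hom_part (free_algebra X deg) \<alpha> \<Longrightarrow>
      p ^ n \<in> hom_part (free_algebra X deg) (nsum n \<alpha>)"
    and free_hom_sum: "(\<And>a. a \<in> B \<Longrightarrow> f a \<in> hom_part (free_algebra X deg) \<gamma>) \<Longrightarrow>
      sum f B \<in> hom_part (free_algebra X deg) \<gamma>"
    and free_hom_zero: "0 \<in> hom_part (free_algebra X deg) \<gamma>"
    and free_hom_one: "1 \<in> hom_part (free_algebra X deg) 0"
proof -
  interpret F: gamma_algebra "free_algebra X deg" by (rule free_gamma_algebra)
  show "p \<in> hom_part (free_algebra X deg) \<gamma> \<Longrightarrow> q \<in> hom_part (free_algebra X deg) \<gamma> \<Longrightarrow>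
      p - q \<in> hom_part (free_algebra X deg) \<gamma>" for p q
    using F.hom_add[of p \<gamma> "fscale (- 1) q"] F.hom_smult[of q \<gamma> "- 1"] by (simp add: minus_eq_fscale)
  show "x \<in> X \<Longrightarrow> letter x \<in> hom_part (free_algebra X deg) (deg x)"
    by (simp add: free_hom_part) (simp add: letter_def)
  show "scal c \<in> hom_part (free_algebra X deg) 0"
    by (simp add: free_hom_part) (simp add: scal_def)
  show m: "p \<in> hom_part (free_algebra X deg) \<alpha> \<Longrightarrow> q \<in> hom_part (free_algebra X deg) \<beta> \<Longrightarrow>
      \<alpha> + \<beta> = \<gamma> \<Longrightarrow> p * q \<in> hom_part (free_algebra X deg) \<gamma>" for p q \<alpha> \<beta> \<gamma>
    using F.hom_mult[of p \<alpha> q \<beta> \<gamma>] by simp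
  show z: "0 \<in> hom_part (free_algebra X deg) \<gamma>" for \<gamma>
    using F.hom_zero[of \<gamma>] by simp
  show o: "1 \<in> hom_part (free_algebra X deg) 0"
    using F.one_hom_part by simp
  show "p \<in> hom_part (free_algebra X deg) \<alpha> \<Longrightarrow>
      p ^ n \<in> hom_part (free_algebra X deg) (nsum n \<alpha>)"
    by (induction n) (auto simp: nsum_def o intro!: m)
  show "(\<And>a. a \<in> B \<Longrightarrow> f a \<in> hom_part (free_algebra X deg) \<gamma>) \<Longrightarrow>
      sum f B \<in> hom_part (free_algebra X deg) \<gamma>"
    using F.hom_add[of _ \<gamma>] by (induction B rule: infinite_finite_induct) (simp_all add: z)
qed

text \<open>This makes the defining ideal graded. In the relation between \<open>e i\<close> and
  \<open>f j\<close> the term with \<open>k i - k' i\<close> has degree 0 and occurs for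
  \<open>i = j\<close> only, where \<open>\<xi> i - \<xi> j\<close> is 0 as well. In a Serre sum
  each monomial contains the same letters.\<close>

lemma uq_relations_homogeneous:
  assumes "r \<in> uq_relations \<omega> \<xi> I d A"
  shows "\<exists>\<gamma>. r \<in> hom_part (free_algebra (uq_gens I) (uq_deg \<xi>)) \<gamma>"
proof -
  let ?h = "hom_part (free_algebra (uq_gens I) (uq_deg \<xi>))"
  have l: "letter (GenE i) \<in> ?h (\<xi> i)" "letter (GenF i) \<in> ?h (- \<xi> i)"
    "letter (GenK i) \<in> ?h 0" "letter (GenKinv i) \<in> ?h 0" if "i \<in> I" for i
    using free_hom_letter[of "GenE i" "uq_gens I" "uq_deg \<xi>"] free_hom_letter[of "GenF i" "uq_gens I" "uq_deg \<xi>"]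
      free_hom_letter[of "GenK i" "uq_gens I" "uq_deg \<xi>"] free_hom_letter[of "GenKinv i" "uq_gens I" "uq_deg \<xi>"]
      that by simp_all
  have serre: "serre \<omega> \<xi> d A h i j \<in> ?h (nsum (nat (1 - A i j)) \<alpha> + \<beta>)"
    if "letter (h i) \<in> ?h \<alpha>" "letter (h j) \<in> ?h \<beta>" for h i j \<alpha> \<beta>
    unfolding serre_def Let_def
  proof (rule free_hom_sum)
    fix r assume "r \<in> {0..nat (1 - A i j)}"
    then have "nsum (nat (1 - A i j)) \<alpha> = nsum (nat (1 - A i j) - r) \<alpha> + nsum r \<alpha>"
      by (simp flip: nsum_add)
    then show "scal (cq_of ((- \<omega> (\<xi> i) (\<xi> j)) ^ r) * qbinom (q_sub d i) (nat (1 - A i j)) r) *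
         letter (h i) ^ (nat (1 - A i j) - r) * letter (h j) * letter (h i) ^ r
         \<in> ?h (nsum (nat (1 - A i j)) \<alpha> + \<beta>)"
      by (intro free_hom_mult[OF free_hom_mult[OF free_hom_mult[OF free_hom_scal
              free_hom_power[OF that(1)] refl] that(2) refl] free_hom_power[OF that(1)]])
        (simp add: add_ac)
  qed
  from assms show ?thesis
    unfolding uq_relations_def Let_def
  proof (elim UnE CollectE exE conjE)
    fix i j assume ij: "i \<in> I" "j \<in> I"
    show ?thesis if "r = letter (GenK i) * letter (GenK j) - letter (GenK j) * letter (GenK i)"
      unfolding that using ij by (intro exI[of _ 0] free_hom_diff free_hom_mult[OF l(3) l(3)]) auto
    show ?thesis if "r = letter (GenK i) * letter (GenE j) * letter (GenKinv i) -
        scal (q_sub d i powi A i j) * letter (GenE j)"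
      unfolding that using ij
      by (intro exI[of _ "\<xi> j"] free_hom_diff free_hom_mult[OF free_hom_mult[OF l(3) l(1) refl] l(4)]
          free_hom_mult[OF free_hom_scal l(1)]) auto
    show ?thesis if "r = letter (GenK i) * letter (GenF j) * letter (GenKinv i) -
        scal (q_sub d i powi (- A i j)) * letter (GenF j)"
      unfolding that using ij
      by (intro exI[of _ "- \<xi> j"] free_hom_diff free_hom_mult[OF free_hom_mult[OF l(3) l(2) refl] l(4)]
          free_hom_mult[OF free_hom_scal l(2)]) auto
    show ?thesis if r: "r = letter (GenE i) * letter (GenF j) -
        scal (cq_of (\<omega> (\<xi> j) (\<xi> i))) * letter (GenF j) * letter (GenE i) -
        (if i = j then scal (inverse (q_sub d i - inverse (q_sub d i))) * (letter (GenK i) - letter (GenKinv i)) else 0)"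
    proof -
      have "(if i = j then scal (inverse (q_sub d i - inverse (q_sub d i))) * (letter (GenK i) - letter (GenKinv i)) else 0)
          \<in> ?h (\<xi> i + - \<xi> j)"
        using ij by (auto intro!: free_hom_zero free_hom_mult[OF free_hom_scal] free_hom_diff l)
      moreover have "letter (GenE i) * letter (GenF j) -
        scal (cq_of (\<omega> (\<xi> j) (\<xi> i))) * letter (GenF j) * letter (GenE i) \<in> ?h (\<xi> i + - \<xi> j)"
        using ij by (intro free_hom_diff free_hom_mult[OF l(1) l(2)]
          free_hom_mult[OF free_hom_mult[OF free_hom_scal l(2) refl] l(1)]) auto
      ultimately show ?thesis unfolding r by (blast intro: free_hom_diff)
    qed
    show ?thesis if "r = serre \<omega> \<xi> d A GenE i j"
      unfolding that using serre[of GenE, OF l(1) l(1)] ij by blast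
    show ?thesis if "r = serre \<omega> \<xi> d A GenF i j"
      unfolding that using serre[of GenF, OF l(2) l(2)] ij by blast
  next
    fix i assume i: "i \<in> I"
    show ?thesis if "r = letter (GenK i) * letter (GenKinv i) - 1"
      unfolding that using i by (intro exI[of _ 0] free_hom_diff free_hom_mult[OF l(3) l(4)] free_hom_one) auto
    show ?thesis if "r = letter (GenKinv i) * letter (GenK i) - 1"
      unfolding that using i by (intro exI[of _ 0] free_hom_diff free_hom_mult[OF l(4) l(3)] free_hom_one) auto
  qed
qed

section \<open>The quotient algebra and its universal property\<close>

locale uq_presentation =
  fixes \<omega> :: "'g::ab_group_add \<Rightarrow> 'g \<Rightarrow> complex" and \<xi> :: "nat \<Rightarrow> 'g" and I :: "nat set"
    and d :: "nat \<Rightarrow> nat" and A :: "nat \<Rightarrow> nat \<Rightarrow> int"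
begin

abbreviation Fr where "Fr \<equiv> free_algebra (uq_gens I) (uq_deg \<xi>)"
abbreviation J where "J \<equiv> uq_ideal \<omega> \<xi> I d A"
abbreviation U where "U \<equiv> Uq \<omega> \<xi> I d A"
abbreviation U_mult (infixl \<open>\<cdot>\<close> 70) where "x \<cdot> y \<equiv> x \<otimes>\<^bsub>U\<^esub> y"
abbreviation gen where "gen \<equiv> uq_elem \<omega> \<xi> I d A"
abbreviation e where "e i \<equiv> gen (GenE i)"
abbreviation f where "f i \<equiv> gen (GenF i)"
abbreviation k where "k i \<equiv> gen (GenK i)"
abbreviation k' where "k' i \<equiv> gen (GenKinv i)"

lemma graded_ideal: "graded_ideal J Fr"
proof -
  interpret F: gamma_algebra Fr by (rule free_gamma_algebra)
  have R: "uq_relations \<omega> \<xi> I d A \<subseteq> carrier Fr"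
    using uq_relations_homogeneous F.hom_carrier by blast
  show ?thesis
    unfolding uq_ideal_def
    by (intro graded_ideal.intro graded_ideal_axioms.intro F.gamma_algebra_axioms
        F.genideal_ideal[OF R] F.genideal_graded uq_relations_homogeneous)
qed

sublocale GI: graded_ideal J Fr by (rule graded_ideal)

lemma U_eq: "U = quot_algebra Fr J"
  by (simp add: Uq_def)

lemma U_gamma_algebra: "gamma_algebra U"
  unfolding U_eq by (rule GI.Q_gamma_algebra)

sublocale U: gamma_algebra U by (rule U_gamma_algebra)

lemma gen_eq: "gen x = J +>\<^bsub>Fr\<^esub> letter x"
  by (simp add: uq_elem_def)

lemma relations_in_ideal: "r \<in> uq_relations \<omega> \<xi> I d A \<Longrightarrow> r \<in> J"
  unfolding uq_ideal_def
  using uq_relations_homogeneous GI.hom_carrier by (intro subsetD[OF GI.genideal_self]) blast+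

lemma gen_hom: "x \<in> uq_gens I \<Longrightarrow> gen x \<in> hom_part U (uq_deg \<xi> x)"
  unfolding gen_eq U_eq GI.Q_hom_part by (intro imageI free_hom_letter)

lemma gens_hom:
  "i \<in> I \<Longrightarrow> e i \<in> hom_part U (\<xi> i)" "i \<in> I \<Longrightarrow> f i \<in> hom_part U (- \<xi> i)"
  "i \<in> I \<Longrightarrow> k i \<in> hom_part U 0" "i \<in> I \<Longrightarrow> k' i \<in> hom_part U 0"
  using gen_hom[of "GenE i"] gen_hom[of "GenF i"] gen_hom[of "GenK i"] gen_hom[of "GenKinv i"]
  by simp_all

lemma gen_closed [simp]: "x \<in> uq_gens I \<Longrightarrow> gen x \<in> carrier U"
  by (rule U.hom_carrier[OF gen_hom])

lemma U_induct [consumes 1, case_names one add smult mult]: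
  assumes X: "X \<in> carrier U" and Q: "Q \<one>\<^bsub>U\<^esub>"
    "\<And>X Y. X \<in> carrier U \<Longrightarrow> Y \<in> carrier U \<Longrightarrow> Q X \<Longrightarrow> Q Y \<Longrightarrow> Q (X \<oplus>\<^bsub>U\<^esub> Y)"
    "\<And>c X. X \<in> carrier U \<Longrightarrow> Q X \<Longrightarrow> Q (c \<odot>\<^bsub>U\<^esub> X)"
    "(\<forall>x\<in>uq_gens I. \<forall>X\<in>carrier U. Q X \<longrightarrow> Q (gen x \<cdot> X)) \<or>
     (\<forall>x\<in>uq_gens I. \<forall>X\<in>carrier U. Q X \<longrightarrow> Q (X \<cdot> gen x))"
  shows "Q X"
proof -
  note ops = GI.coset_ops[folded U_eq, simplified] GI.coset_closed[folded U_eq, simplified]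
  obtain p where p: "p \<in> free_carrier (uq_gens I)" "X = J +>\<^bsub>Fr\<^esub> p"
    using X unfolding U_eq by (auto elim!: GI.Q_cases)
  from p(1) have "Q (J +>\<^bsub>Fr\<^esub> p)"
  proof (induction rule: free_gen_induct)
    case one
    then show ?case using Q(1) by (simp add: ops)
  next
    case (add p q)
    then show ?case using Q(2)[of "J +>\<^bsub>Fr\<^esub> p" "J +>\<^bsub>Fr\<^esub> q"] by (simp add: ops)
  next
    case (scale c p)
    then show ?case using Q(3)[of "J +>\<^bsub>Fr\<^esub> p" c] by (simp add: ops)
  next
    case mult
    have "gen x \<cdot> (J +>\<^bsub>Fr\<^esub> p) = J +>\<^bsub>Fr\<^esub> (letter x * p)"
      "(J +>\<^bsub>Fr\<^esub> p) \<cdot> gen x = J +>\<^bsub>Fr\<^esub> (p * letter x)"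
      if "x \<in> uq_gens I" "p \<in> free_carrier (uq_gens I)" for x p
      using that by (simp_all add: gen_eq ops)
    with Q(4) show ?case by (metis ops(6))
  qed
  then show ?thesis by (simp add: p)
qed

lemma U_hom_eqI:
  assumes P: "gamma_algebra P" and g: "gamma_hom U P g" and h: "gamma_hom U P h"
    and gen: "\<And>i. i \<in> I \<Longrightarrow> g (e i) = h (e i) \<and> g (f i) = h (f i) \<and> g (k i) = h (k i) \<and> g (k' i) = h (k' i)"
    and X: "X \<in> carrier U"
  shows "g X = h X"
  using X
proof (induction rule: U_induct)
  case mult
  have "g (gen x) = h (gen x)" if "x \<in> uq_gens I" for x
    using that gen by (auto elim!: uq_gens_cases)
  then show ?case by (simp add: gamma_hom_mult[OF g] gamma_hom_mult[OF h])
qed (simp_all add: gamma_hom_one[OF g] gamma_hom_one[OF h] gamma_hom_add[OF g] gamma_hom_add[OF h]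
    gamma_hom_smult[OF g] gamma_hom_smult[OF h])

lemma gen_map_evaluation:
  assumes "gamma_algebra P"
    "\<And>i. i \<in> I \<Longrightarrow> E i \<in> hom_part P (\<xi> i) \<and> F i \<in> hom_part P (- \<xi> i) \<and> K i \<in> hom_part P 0 \<and> K' i \<in> hom_part P 0"
  shows "uq_evaluation \<xi> P (gen_map I \<zero>\<^bsub>P\<^esub> E F K K')"
proof -
  interpret P: gamma_algebra P by fact
  show ?thesis
    by unfold_locales (use assms(2) in \<open>auto simp: gen_map_def split: uq_gen.splits\<close>)
qed

text \<open>The kernel of the evaluation is an ideal of the free algebra that contains the
  relations, hence contains \<open>J\<close>; the evaluation therefore factors through
  \<open>U\<close>.\<close>

lemma U_hom_exists:
  assumes P: "gamma_algebra P"
    and deg: "\<And>i. i \<in> I \<Longrightarrow> E i \<in> hom_part P (\<xi> i) \<and> F i \<in> hom_part P (- \<xi> i) \<and> K i \<in> hom_part P 0 \<and> K' i \<in> hom_part P 0"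
    and rel: "uq_rel \<omega> \<xi> I d A P E F K K'"
  shows "\<exists>h. gamma_hom U P h \<and> (\<forall>i\<in>I. h (e i) = E i \<and> h (f i) = F i \<and> h (k i) = K i \<and> h (k' i) = K' i)"
proof -
  interpret P: gamma_algebra P by fact
  interpret ev: uq_evaluation \<xi> P "gen_map I \<zero>\<^bsub>P\<^esub> E F K K'"
    by (rule gen_map_evaluation[OF P deg])
  let ?K = "{p \<in> free_carrier (uq_gens I). ev.ev p = \<zero>\<^bsub>P\<^esub>}"
  have rel0: "ev.ev r = \<zero>\<^bsub>P\<^esub>" if "r \<in> uq_relations \<omega> \<xi> I d A" for r
    using ev.ev_relations[of \<omega> I d A] rel that by (simp add: uq_rel_gen_map)
  have "ideal ?K Fr"
    by (rule GI.idealI_submodule) (auto simp: ev.ev_zero ev.ev_add ev.ev_mult)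
  moreover have "uq_relations \<omega> \<xi> I d A \<subseteq> ?K"
    using rel0 uq_relations_homogeneous GI.hom_carrier by fastforce
  ultimately have "J \<subseteq> ?K"
    unfolding uq_ideal_def by (rule GI.genideal_minimal)
  then have "ev.ev x = \<zero>\<^bsub>P\<^esub>" if "x \<in> J" for x using that by auto
  from GI.Q_hom_lift[OF P ev.ev_gamma_hom this, folded U_eq]
  obtain h where "gamma_hom U P h" "\<And>x. x \<in> free_carrier (uq_gens I) \<Longrightarrow> h (J +>\<^bsub>Fr\<^esub> x) = ev.ev x"
    by auto
  then show ?thesis by (intro exI[of _ h]) (simp add: gen_eq ev.ev_letter)
qed

text \<open>Evaluation at the classes of the generators is the canonical projection onto
  \<open>U\<close>, and this projection kills \<open>J\<close>.\<close>

lemma U_rel: "uq_rel \<omega> \<xi> I d A U e f k k'"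
proof -
  note ops = GI.coset_ops[folded U_eq, simplified] GI.coset_closed[folded U_eq, simplified]
  interpret ev: uq_evaluation \<xi> U "gen_map I \<zero>\<^bsub>U\<^esub> e f k k'"
    by (rule gen_map_evaluation[OF U_gamma_algebra]) (simp add: gens_hom)
  have "ev.ev p = J +>\<^bsub>Fr\<^esub> p" if "p \<in> free_carrier (uq_gens I)" for p
    using that
  proof (induction rule: free_gen_induct)
    case mult
    have "gen_map I \<zero>\<^bsub>U\<^esub> e f k k' x = J +>\<^bsub>Fr\<^esub> letter x" if "x \<in> uq_gens I" for x
      using that by (auto elim!: uq_gens_cases simp: gen_eq)
    then show ?case by (simp add: ops(2) ev.ev_mult ev.ev_letter)
  qed (simp_all add: ops(1-4) ev.ev_one ev.ev_add ev.ev_fscale)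
  moreover have "J +>\<^bsub>Fr\<^esub> r = \<zero>\<^bsub>U\<^esub>" if "r \<in> uq_relations \<omega> \<xi> I d A" for r
  proof -
    have "r \<in> J" by (rule relations_in_ideal[OF that])
    then have "J +>\<^bsub>Fr\<^esub> r = J +>\<^bsub>Fr\<^esub> \<zero>\<^bsub>Fr\<^esub>"
      using GI.coset_eq_iff[of r "\<zero>\<^bsub>Fr\<^esub>"] GI.J.a_Hcarr[of r]
      by (simp add: a_minus_def GI.J.a_closed del: free_algebra_simps)
    then show ?thesis by (simp add: ops)
  qed
  moreover have "r \<in> free_carrier (uq_gens I)" if "r \<in> uq_relations \<omega> \<xi> I d A" for r
    using uq_relations_homogeneous[OF that] GI.hom_carrier by fastforce
  ultimately show ?thesis
    using ev.ev_relations[of \<omega> I d A] by (simp add: uq_rel_gen_map)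
qed

end

section \<open>The defining relations under the structure maps\<close>

lemma qvar_power: "qvar ^ n = Fract ([:0, 1:] ^ n) 1"
  by (induction n) (simp_all add: qvar_def One_fract_def)

lemma qvar_generic: "n > 0 \<Longrightarrow> qvar ^ n \<noteq> 1"
proof
  assume n: "n > 0" and "qvar ^ n = 1"
  then have "[:0, 1:] ^ n = (1 :: complex poly)"
    by (simp add: qvar_power One_fract_def eq_fract)
  \<comment> \<open>Evaluation at 0 tells a positive power of the variable from 1.\<close>
  then have "poly ([:0, 1:] ^ n) 0 = poly (1 :: complex poly) 0" by simp
  with n show False by (simp add: power_0_left)
qed

lemma qvar_nonzero: "qvar \<noteq> 0"
  using qvar_generic[of 1] by (simp add: qvar_def Zero_fract_def eq_fract)

text \<open>The pattern of \<open>\<Delta>_ef\<close>: the cross terms \<open>x\<close> and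
  \<open>a2\<close> occur in both products and cancel.\<close>

lemma (in ring) sum_diff_rearrange:
  assumes "a1 \<in> carrier R" "a2 \<in> carrier R" "x \<in> carrier R" "a4 \<in> carrier R"
    "b1 \<in> carrier R" "b4 \<in> carrier R"
  shows "(a1 \<oplus> x \<oplus> (a2 \<oplus> a4)) \<ominus> (b1 \<oplus> a2 \<oplus> (x \<oplus> b4)) = (a1 \<ominus> b1) \<oplus> (a4 \<ominus> b4)"
  using assms by algebra

lemma (in ring) diff_add_diff:
  assumes "a \<in> carrier R" "b \<in> carrier R" "c \<in> carrier R"
  shows "(a \<ominus> b) \<oplus> (b \<ominus> c) = a \<ominus> c"
  using assms by algebra

lemma (in ring) diff_swap:
  assumes "a \<in> carrier R" "b \<in> carrier R"
  shows "\<ominus> (a \<ominus> b) = b \<ominus> a"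
  using assms by algebra

lemma (in gamma_algebra) serre_el_zero [simp]:
  "x \<in> carrier H \<Longrightarrow> serre_el H w p n x \<zero> = \<zero>"
  unfolding serre_el_def by (intro M.add.finprod_one_eqI) simp

lemma (in gamma_algebra) commute_inverse:
  assumes "a \<in> carrier H" "a' \<in> carrier H" "x \<in> carrier H" "a \<otimes> a' = \<one>" "a' \<otimes> a = \<one>"
    and "s \<noteq> 0" and ax: "a \<otimes> x = s \<odot> (x \<otimes> a)"
  shows "a' \<otimes> x = inverse s \<odot> (x \<otimes> a')"
proof -
  have "x \<otimes> a' = a' \<otimes> (a \<otimes> x) \<otimes> a'"
    using assms(1-5) by (simp add: m_assoc[symmetric])
  also have "\<dots> = s \<odot> (a' \<otimes> x \<otimes> (a \<otimes> a'))"
    using assms(1-3) by (simp add: ax smult_mult_left smult_mult_right m_assoc)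
  also have "\<dots> = s \<odot> (a' \<otimes> x)" using assms(1-4) by simp
  finally show ?thesis using assms by (simp add: smult_smult)
qed

context tensor_algebras
begin

lemma mult_pure_0_left:
  assumes "b \<in> hom_part N 0" "a \<in> carrier M" "c \<in> carrier M" "d \<in> carrier N"
  shows "(a \<boxtimes> b) \<otimes>\<^bsub>T\<^esub> (c \<boxtimes> d) = (a \<otimes>\<^bsub>M\<^esub> c) \<boxtimes> (b \<otimes>\<^bsub>N\<^esub> d)"
  using assms(3)
proof (induction rule: M.hom_induct)
  case (hom \<gamma> c)
  then show ?case using assms M.hom_carrier N.hom_carrier by (simp add: mult_pure)
next
  case (add c c')
  then show ?case
    using assms N.hom_carrier by (simp add: pure_add_left T.r_distr M.r_distr)
qed

lemma mult_pure_0_right: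
  assumes "c \<in> hom_part M 0" "a \<in> carrier M" "b \<in> carrier N" "d \<in> carrier N"
  shows "(a \<boxtimes> b) \<otimes>\<^bsub>T\<^esub> (c \<boxtimes> d) = (a \<otimes>\<^bsub>M\<^esub> c) \<boxtimes> (b \<otimes>\<^bsub>N\<^esub> d)"
  using assms(3)
proof (induction rule: N.hom_induct)
  case (hom \<gamma> b)
  then show ?case using assms M.hom_carrier N.hom_carrier by (simp add: mult_pure)
next
  case (add b b')
  then show ?case
    using assms M.hom_carrier by (simp add: pure_add_right T.l_distr N.l_distr)
qed

lemma one_T: "\<one>\<^bsub>T\<^esub> = \<one>\<^bsub>M\<^esub> \<boxtimes> \<one>\<^bsub>N\<^esub>"
  by (simp add: tensor_alg_simps(3))

text \<open>Together with its right-hand counterpart it transports the Serre relations of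
  \<open>U\<close> into the tensor square.\<close>

lemma left_embedding: "gamma_hom M T (\<lambda>x. x \<boxtimes> \<one>\<^bsub>N\<^esub>)"
  by (rule gamma_homI)
    (simp_all add: pure_linear_left pure_hom[OF _ N.one_hom_part] mult_pure_0_left N.one_hom_part one_T)

lemma right_embedding: "gamma_hom N T (\<lambda>x. \<one>\<^bsub>M\<^esub> \<boxtimes> x)"
  by (rule gamma_homI)
    (simp_all add: pure_linear_right pure_hom[OF M.one_hom_part] mult_pure_0_right M.one_hom_part one_T)

end

context com_factor_algebra
begin

lemma op_mult_0_left:
  assumes "x \<in> hom_part H 0" "y \<in> carrier H"
  shows "x \<diamondop> y = y \<otimes> x"
  using assms(2)
  by (induction rule: hom_induct)
    (use assms hom_carrier in \<open>simp_all add: op_mult_hom[OF assms(1)] op_r_distr l_distr\<close>)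

lemma op_mult_0_right:
  assumes "y \<in> hom_part H 0" "x \<in> carrier H"
  shows "x \<diamondop> y = y \<otimes> x"
  using assms(2)
  by (induction rule: hom_induct)
    (use assms hom_carrier in \<open>simp_all add: op_mult_hom[OF _ assms(1)] op_l_distr r_distr\<close>)

end

text \<open>Collects the facts on \<open>A\<close>, \<open>d\<close> and \<open>\<xi>\<close> on
  which the calculations with the relations rest; finite and untwisted affine type both provide
  them.\<close>

locale uq_data = com_factor \<omega> + uq_presentation \<omega> \<xi> I d A
  for \<omega> :: "'g::ab_group_add \<Rightarrow> 'g \<Rightarrow> complex" and \<xi> :: "nat \<Rightarrow> 'g" and I :: "nat set"
    and d :: "nat \<Rightarrow> nat" and A :: "nat \<Rightarrow> nat \<Rightarrow> int" +
  assumes \<xi>_self: "i \<in> I \<Longrightarrow> \<omega> (\<xi> i) (\<xi> i) = 1"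
    and d_sym: "i \<in> I \<Longrightarrow> j \<in> I \<Longrightarrow> int (d i) * A i j = int (d j) * A j i"
    and d_pos: "i \<in> I \<Longrightarrow> d i > 0" and d_even: "i \<in> I \<Longrightarrow> even (d i)"
    and A_diag: "i \<in> I \<Longrightarrow> A i i = 2"
    and A_off: "i \<in> I \<Longrightarrow> j \<in> I \<Longrightarrow> i \<noteq> j \<Longrightarrow> A i j \<le> 0"
begin

sublocale UA: com_factor_algebra \<omega> U ..
sublocale TT: tensor_algebras \<omega> U U ..

abbreviation UU where "UU \<equiv> tensor_alg \<omega> U U"
abbreviation U_pure (infixl \<open>\<boxtimes>\<close> 75) where "x \<boxtimes> y \<equiv> pure_tensor U U x y"

abbreviation q where "q \<equiv> q_sub d"
abbreviation c where "c i j \<equiv> q i powi A i j"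

lemma q_generic: "i \<in> I \<Longrightarrow> generic_parameter (q i)"
proof
  assume i: "i \<in> I"
  then have "d i div 2 > 0" using d_pos[OF i] d_even[OF i] by auto
  then show "q i ^ n \<noteq> 1" if "n > 0" for n
    using that qvar_generic[of "d i div 2 * n"] by (simp add: q_sub_def flip: power_mult)
qed (simp add: q_sub_def qvar_nonzero)

lemma q_nonzero: "q i \<noteq> 0"
  by (simp add: q_sub_def qvar_nonzero)

lemma c_nonzero: "c i j \<noteq> 0"
  using q_nonzero by simp

text \<open>Both sides are powers of \<open>qvar\<close>, with exponents half of
  \<open>d i * A i j\<close> and of \<open>d j * A j i\<close>; evenness of \<open>d\<close> allows
  the halving.\<close>

lemma c_sym: "i \<in> I \<Longrightarrow> j \<in> I \<Longrightarrow> c j i = c i j"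
proof -
  assume ij: "i \<in> I" "j \<in> I"
  have "2 * (int (d i div 2) * A i j) = 2 * (int (d j div 2) * A j i)"
  proof -
    have "int (d i) = 2 * int (d i div 2)" "int (d j) = 2 * int (d j div 2)"
      using d_even[OF ij(1)] d_even[OF ij(2)] by (auto elim!: evenE)
    then show ?thesis using d_sym[OF ij] by simp
  qed
  then have "int (d i div 2) * A i j = int (d j div 2) * A j i" by simp
  moreover have "q i powi n = qvar powi (int (d i div 2) * n)" for i n
    by (simp add: q_sub_def power_int_mult)
  ultimately show ?thesis by simp
qed

lemma c_diag: "i \<in> I \<Longrightarrow> c i i = q i ^ 2"
  by (simp add: A_diag)

text \<open>This relates the length of the Serre sum to the commutation constant
  \<open>c i j\<close>, as the side conditions of \<open>serre_el_add\<close> demand. Since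
  \<open>A i j \<le> 0\<close>, the conversion by \<open>nat\<close> loses nothing.\<close>

lemma q_power: "i \<in> I \<Longrightarrow> j \<in> I \<Longrightarrow> i \<noteq> j \<Longrightarrow> q i ^ nat (1 - A i j) = inverse (c i j) * q i"
proof -
  assume "i \<in> I" "j \<in> I" "i \<noteq> j"
  then have "A i j \<le> 0" by (rule A_off)
  then have "q i ^ nat (1 - A i j) = q i powi (1 - A i j)"
    by (simp add: power_int_def)
  also have "\<dots> = inverse (c i j) * q i"
    using q_nonzero by (simp add: power_int_diff field_simps)
  finally show ?thesis .
qed

context
  fixes i j assumes ij: "i \<in> I" "j \<in> I"
begin

lemma gens_closed [simp]: "e i \<in> carrier U" "f i \<in> carrier U" "k i \<in> carrier U" "k' i \<in> carrier U"
  "e j \<in> carrier U" "f j \<in> carrier U" "k j \<in> carrier U" "k' j \<in> carrier U"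
  using ij by simp_all

lemma kk: "k i \<cdot> k j = k j \<cdot> k i"
  and kk'_one: "k i \<cdot> k' i = \<one>\<^bsub>U\<^esub>"
  and k'k_one: "k' i \<cdot> k i = \<one>\<^bsub>U\<^esub>"
  and kek': "k i \<cdot> e j \<cdot> k' i = c i j \<odot>\<^bsub>U\<^esub> e j"
  and kfk': "k i \<cdot> f j \<cdot> k' i = inverse (c i j) \<odot>\<^bsub>U\<^esub> f j"
  and ef: "e i \<cdot> f j \<ominus>\<^bsub>U\<^esub> w (\<xi> j) (\<xi> i) \<odot>\<^bsub>U\<^esub> (f j \<cdot> e i) =
        (if i = j then inverse (q i - inverse (q i)) \<odot>\<^bsub>U\<^esub> (k i \<ominus>\<^bsub>U\<^esub> k' i) else \<zero>\<^bsub>U\<^esub>)"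
  and serre_e: "i \<noteq> j \<Longrightarrow> serre_el U (w (\<xi> i) (\<xi> j)) (q i) (nat (1 - A i j)) (e i) (e j) = \<zero>\<^bsub>U\<^esub>"
  and serre_f: "i \<noteq> j \<Longrightarrow> serre_el U (w (\<xi> i) (\<xi> j)) (q i) (nat (1 - A i j)) (f i) (f j) = \<zero>\<^bsub>U\<^esub>"
  using U_rel ij by (simp_all add: uq_rel_def power_int_minus)

lemma ke: "k i \<cdot> e j = c i j \<odot>\<^bsub>U\<^esub> (e j \<cdot> k i)"
proof -
  have "k i \<cdot> e j = k i \<cdot> e j \<cdot> k' i \<cdot> k i"
    using k'k_one by (simp add: U.m_assoc)
  then show ?thesis by (simp add: kek' U.smult_mult_left)
qed

lemma kf: "k i \<cdot> f j = inverse (c i j) \<odot>\<^bsub>U\<^esub> (f j \<cdot> k i)"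
proof -
  have "k i \<cdot> f j = k i \<cdot> f j \<cdot> k' i \<cdot> k i"
    using k'k_one by (simp add: U.m_assoc)
  then show ?thesis by (simp add: kfk' U.smult_mult_left)
qed

lemma k'e: "k' i \<cdot> e j = inverse (c i j) \<odot>\<^bsub>U\<^esub> (e j \<cdot> k' i)"
  by (rule U.commute_inverse[OF _ _ _ kk'_one k'k_one c_nonzero ke]) simp_all

lemma k'f: "k' i \<cdot> f j = c i j \<odot>\<^bsub>U\<^esub> (f j \<cdot> k' i)"
  using U.commute_inverse[OF _ _ _ kk'_one k'k_one _ kf] c_nonzero by simp

lemma k'k: "k' i \<cdot> k j = k j \<cdot> k' i"
  using U.commute_inverse[OF _ _ _ kk'_one k'k_one, of "k j" 1] kk by simp

end

lemma k'k': "i \<in> I \<Longrightarrow> j \<in> I \<Longrightarrow> k' i \<cdot> k' j = k' j \<cdot> k' i"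
  using U.commute_inverse[of "k i" "k' i" "k' j" 1] kk'_one[of i j] k'k_one[of i j] k'k[of j i]
  by simp

section \<open>The relations for the comultiplication\<close>

abbreviation \<Delta>e where "\<Delta>e i \<equiv> (e i \<boxtimes> k i) \<oplus>\<^bsub>UU\<^esub> (\<one>\<^bsub>U\<^esub> \<boxtimes> e i)"
abbreviation \<Delta>f where "\<Delta>f i \<equiv> (f i \<boxtimes> \<one>\<^bsub>U\<^esub>) \<oplus>\<^bsub>UU\<^esub> (k' i \<boxtimes> f i)"
abbreviation \<Delta>k where "\<Delta>k i \<equiv> (k i \<boxtimes> k i)"
abbreviation \<Delta>k' where "\<Delta>k' i \<equiv> (k' i \<boxtimes> k' i)"

text \<open>The cross terms agree in the two orders and cancel. What remains is
  \<open>D \<boxtimes> k i\<close> plus \<open>k' j \<boxtimes> D\<close>, where \<open>D\<close> is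
  the twisted commutator of \<open>e i\<close> and \<open>f j\<close> in \<open>U\<close>. For
  \<open>i = j\<close> this telescopes: the two terms with \<open>k' i \<boxtimes> k i\<close>
  cancel.\<close>

lemma \<Delta>_ef:
  assumes ij: "i \<in> I" "j \<in> I"
  shows "\<Delta>e i \<otimes>\<^bsub>UU\<^esub> \<Delta>f j \<ominus>\<^bsub>UU\<^esub> w (\<xi> j) (\<xi> i) \<odot>\<^bsub>UU\<^esub> (\<Delta>f j \<otimes>\<^bsub>UU\<^esub> \<Delta>e i) =
    (if i = j then inverse (q i - inverse (q i)) \<odot>\<^bsub>UU\<^esub> (\<Delta>k i \<ominus>\<^bsub>UU\<^esub> \<Delta>k' i) else \<zero>\<^bsub>UU\<^esub>)"
proof -
  let ?W = "w (\<xi> j) (\<xi> i)" and ?V = "w (\<xi> i) (\<xi> j)"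
  note [simp] = gens_closed[OF ij]
  note h = gens_hom[OF ij(1)] gens_hom[OF ij(2)] U.one_hom_part
  have WV: "?W * ?V = 1" by (rule w_inverse)
  have p11: "(e i \<boxtimes> k i) \<otimes>\<^bsub>UU\<^esub> (f j \<boxtimes> \<one>\<^bsub>U\<^esub>) = (e i \<cdot> f j) \<boxtimes> k i"
    by (simp add: TT.mult_pure_0_left h)
  have p12: "(e i \<boxtimes> k i) \<otimes>\<^bsub>UU\<^esub> (k' j \<boxtimes> f j) = (e i \<cdot> k' j) \<boxtimes> (k i \<cdot> f j)"
    by (simp add: TT.mult_pure_0_left h)
  have p21: "(\<one>\<^bsub>U\<^esub> \<boxtimes> e i) \<otimes>\<^bsub>UU\<^esub> (f j \<boxtimes> \<one>\<^bsub>U\<^esub>) = ?W \<odot>\<^bsub>UU\<^esub> (f j \<boxtimes> e i)"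
    by (simp add: TT.mult_pure[OF _ h(1) h(6)] w_minus_right)
  have p22: "(\<one>\<^bsub>U\<^esub> \<boxtimes> e i) \<otimes>\<^bsub>UU\<^esub> (k' j \<boxtimes> f j) = k' j \<boxtimes> (e i \<cdot> f j)"
    by (simp add: TT.mult_pure_0_right h)
  have r11: "(f j \<boxtimes> \<one>\<^bsub>U\<^esub>) \<otimes>\<^bsub>UU\<^esub> (e i \<boxtimes> k i) = (f j \<cdot> e i) \<boxtimes> k i"
    by (simp add: TT.mult_pure_0_left h)
  have r12: "(f j \<boxtimes> \<one>\<^bsub>U\<^esub>) \<otimes>\<^bsub>UU\<^esub> (\<one>\<^bsub>U\<^esub> \<boxtimes> e i) = f j \<boxtimes> e i"
    by (simp add: TT.mult_pure_0_left h)
  have "(k' j \<boxtimes> f j) \<otimes>\<^bsub>UU\<^esub> (e i \<boxtimes> k i)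
      = ?V \<odot>\<^bsub>UU\<^esub> ((k' j \<cdot> e i) \<boxtimes> (f j \<cdot> k i))"
    by (simp add: TT.mult_pure[OF _ h(6) h(1)] w_minus_left)
  \<comment> \<open>The constants from the two tensor factors are inverse to each other by the
    symmetry of \<open>c\<close>.\<close>
  also have "(k' j \<cdot> e i) \<boxtimes> (f j \<cdot> k i) = (e i \<cdot> k' j) \<boxtimes> (k i \<cdot> f j)"
    using kf[OF ij] k'e[OF ij(2,1)] c_sym[OF ij]
    by (simp add: TT.pure_smult_left TT.pure_smult_right)
  finally have r21: "(k' j \<boxtimes> f j) \<otimes>\<^bsub>UU\<^esub> (e i \<boxtimes> k i)
      = ?V \<odot>\<^bsub>UU\<^esub> ((e i \<cdot> k' j) \<boxtimes> (k i \<cdot> f j))" .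
  have r22: "(k' j \<boxtimes> f j) \<otimes>\<^bsub>UU\<^esub> (\<one>\<^bsub>U\<^esub> \<boxtimes> e i) = k' j \<boxtimes> (f j \<cdot> e i)"
    by (simp add: TT.mult_pure_0_right h)
  have 1: "\<Delta>e i \<otimes>\<^bsub>UU\<^esub> \<Delta>f j =
     ((e i \<cdot> f j) \<boxtimes> k i) \<oplus>\<^bsub>UU\<^esub> ?W \<odot>\<^bsub>UU\<^esub> (f j \<boxtimes> e i) \<oplus>\<^bsub>UU\<^esub>
     (((e i \<cdot> k' j) \<boxtimes> (k i \<cdot> f j)) \<oplus>\<^bsub>UU\<^esub> (k' j \<boxtimes> (e i \<cdot> f j)))"
    by (simp add: TT.T.l_distr TT.T.r_distr p11 p12 p21 p22)
  have 2: "?W \<odot>\<^bsub>UU\<^esub> (\<Delta>f j \<otimes>\<^bsub>UU\<^esub> \<Delta>e i) =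
     ((?W \<odot>\<^bsub>U\<^esub> (f j \<cdot> e i)) \<boxtimes> k i) \<oplus>\<^bsub>UU\<^esub> ((e i \<cdot> k' j) \<boxtimes> (k i \<cdot> f j)) \<oplus>\<^bsub>UU\<^esub>
     (?W \<odot>\<^bsub>UU\<^esub> (f j \<boxtimes> e i) \<oplus>\<^bsub>UU\<^esub> (k' j \<boxtimes> (?W \<odot>\<^bsub>U\<^esub> (f j \<cdot> e i))))"
    by (simp add: TT.T.l_distr TT.T.r_distr r11 r12 r21 r22 TT.T.smult_add_right TT.T.smult_smult WV
        TT.pure_smult_left TT.pure_smult_right)
  let ?D = "e i \<cdot> f j \<ominus>\<^bsub>U\<^esub> ?W \<odot>\<^bsub>U\<^esub> (f j \<cdot> e i)"
  have "\<Delta>e i \<otimes>\<^bsub>UU\<^esub> \<Delta>f j \<ominus>\<^bsub>UU\<^esub> ?W \<odot>\<^bsub>UU\<^esub> (\<Delta>f j \<otimes>\<^bsub>UU\<^esub> \<Delta>e i)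
     = (((e i \<cdot> f j) \<boxtimes> k i) \<ominus>\<^bsub>UU\<^esub> ((?W \<odot>\<^bsub>U\<^esub> (f j \<cdot> e i)) \<boxtimes> k i)) \<oplus>\<^bsub>UU\<^esub>
       ((k' j \<boxtimes> (e i \<cdot> f j)) \<ominus>\<^bsub>UU\<^esub> (k' j \<boxtimes> (?W \<odot>\<^bsub>U\<^esub> (f j \<cdot> e i))))"
    unfolding 1 2 by (rule TT.T.sum_diff_rearrange) simp_all
  also have "\<dots> = (?D \<boxtimes> k i) \<oplus>\<^bsub>UU\<^esub> (k' j \<boxtimes> ?D)"
    by (simp add: cq_linear_diff[OF U.cq_module_axioms TT.T.cq_module_axioms TT.pure_linear_left]
        cq_linear_diff[OF U.cq_module_axioms TT.T.cq_module_axioms TT.pure_linear_right])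
  also have "\<dots> = (if i = j then inverse (q i - inverse (q i)) \<odot>\<^bsub>UU\<^esub> (\<Delta>k i \<ominus>\<^bsub>UU\<^esub> \<Delta>k' i) else \<zero>\<^bsub>UU\<^esub>)"
  proof (cases "i = j")
    case True
    have "((k i \<ominus>\<^bsub>U\<^esub> k' i) \<boxtimes> k i) \<oplus>\<^bsub>UU\<^esub> (k' i \<boxtimes> (k i \<ominus>\<^bsub>U\<^esub> k' i)) = \<Delta>k i \<ominus>\<^bsub>UU\<^esub> \<Delta>k' i"
      by (simp add: cq_linear_diff[OF U.cq_module_axioms TT.T.cq_module_axioms TT.pure_linear_left]
        cq_linear_diff[OF U.cq_module_axioms TT.T.cq_module_axioms TT.pure_linear_right]
        TT.T.diff_add_diff)
    then show ?thesis
      unfolding ef[OF ij]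
      by (simp add: True[symmetric] TT.pure_smult_left TT.pure_smult_right TT.T.smult_add_right[symmetric])
  next
    case False
    then show ?thesis
      unfolding ef[OF ij]
      by (simp add: cq_linear_zero[OF U.cq_module_axioms TT.T.cq_module_axioms TT.pure_linear_left]
        cq_linear_zero[OF U.cq_module_axioms TT.T.cq_module_axioms TT.pure_linear_right])
  qed
  finally show ?thesis .
qed

text \<open>Here \<open>serre_el_add\<close> is applied with
  \<open>y = \<one> \<boxtimes> e i\<close> and \<open>x = e i \<boxtimes> k i\<close>. Passing
  \<open>y\<close> over \<open>x\<close> costs \<open>inverse (c i i)\<close>, that is
  \<open>inverse (q i) ^ 2\<close>; the constants for \<open>j\<close> are \<open>?V\<close> and
  \<open>?W\<close> times \<open>inverse (c i j)\<close>, and both side conditions reduce to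
  \<open>q_power\<close>.\<close>

lemma \<Delta>_serre_e:
  assumes ij: "i \<in> I" "j \<in> I" "i \<noteq> j"
  shows "serre_el UU (w (\<xi> i) (\<xi> j)) (q i) (nat (1 - A i j)) (\<Delta>e i) (\<Delta>e j) = \<zero>\<^bsub>UU\<^esub>"
proof -
  let ?W = "w (\<xi> j) (\<xi> i)" and ?V = "w (\<xi> i) (\<xi> j)" and ?n = "nat (1 - A i j)"
  note [simp] = gens_closed[OF ij(1,2)]
  note h = gens_hom[OF ij(1)] gens_hom[OF ij(2)] U.one_hom_part
  have VW: "?V * ?W = 1" by (rule w_inverse)
  have cc: "x * inverse (c i j) * c i j = x" for x
    using c_nonzero[of i j] by (metis mult.assoc left_inverse mult.right_neutral)
  have yx: "(\<one>\<^bsub>U\<^esub> \<boxtimes> e i) \<otimes>\<^bsub>UU\<^esub> (e i \<boxtimes> k i) =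
      (inverse (q i) ^ 2) \<odot>\<^bsub>UU\<^esub> ((e i \<boxtimes> k i) \<otimes>\<^bsub>UU\<^esub> (\<one>\<^bsub>U\<^esub> \<boxtimes> e i))"
  proof -
    have "inverse (q i) ^ 2 * c i i = 1"
      using q_nonzero by (simp add: c_diag[OF ij(1)] flip: power_mult_distrib)
    then show ?thesis
      by (simp add: TT.mult_pure[OF _ h(1) h(1)] TT.mult_pure_0_left h \<xi>_self ij ke[OF ij(1,1)]
          TT.pure_smult_right TT.T.smult_smult)
  qed
  have yu: "(\<one>\<^bsub>U\<^esub> \<boxtimes> e i) \<otimes>\<^bsub>UU\<^esub> (e j \<boxtimes> k j) =
      (?V * inverse (c i j)) \<odot>\<^bsub>UU\<^esub> ((e j \<boxtimes> k j) \<otimes>\<^bsub>UU\<^esub> (\<one>\<^bsub>U\<^esub> \<boxtimes> e i))"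
    by (simp add: cc TT.mult_pure[OF _ h(1) h(5)] TT.mult_pure_0_left h ke[OF ij(2,1)]
          TT.pure_smult_right TT.T.smult_smult c_sym[OF ij(1,2)])
  have vx: "(\<one>\<^bsub>U\<^esub> \<boxtimes> e j) \<otimes>\<^bsub>UU\<^esub> (e i \<boxtimes> k i) =
      (?W * inverse (c i j)) \<odot>\<^bsub>UU\<^esub> ((e i \<boxtimes> k i) \<otimes>\<^bsub>UU\<^esub> (\<one>\<^bsub>U\<^esub> \<boxtimes> e j))"
    by (simp add: cc TT.mult_pure[OF _ h(5) h(1)] TT.mult_pure_0_left h ke[OF ij(1,2)]
          TT.pure_smult_right TT.T.smult_smult)
  have "serre_el UU ?V (q i) ?n (\<Delta>e i) (\<Delta>e j) =
      serre_el UU ?V (q i) ?n ((e i \<boxtimes> k i)) ((e j \<boxtimes> k j)) \<oplus>\<^bsub>UU\<^esub>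
      serre_el UU ?V (q i) ?n ((\<one>\<^bsub>U\<^esub> \<boxtimes> e i)) ((\<one>\<^bsub>U\<^esub> \<boxtimes> e j))"
    by (rule TT.T.serre_el_add[OF q_generic[OF ij(1)] _ _ _ _ yx yu _ vx])
      (use VW in \<open>simp_all add: q_power[OF ij] mult.assoc[symmetric]\<close>)
  also have "serre_el UU ?V (q i) ?n ((\<one>\<^bsub>U\<^esub> \<boxtimes> e i)) ((\<one>\<^bsub>U\<^esub> \<boxtimes> e j)) = \<zero>\<^bsub>UU\<^esub>"
    using gamma_hom_serre[OF U_gamma_algebra TT.T_gamma_algebra TT.right_embedding, of "e i" "e j" ?V "q i" ?n]
    by (simp add: serre_e[OF ij] cq_linear_zero[OF U.cq_module_axioms TT.T.cq_module_axioms TT.pure_linear_right])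
  also have "serre_el UU ?V (q i) ?n ((e i \<boxtimes> k i)) ((e j \<boxtimes> k j)) = \<zero>\<^bsub>UU\<^esub>"
  \<comment> \<open>All constants are 1: \<open>e \<boxtimes> \<one>\<close> and
    \<open>\<one> \<boxtimes> k\<close> commute, since \<open>k\<close> has degree 0.\<close>
  proof (rule TT.T.serre_el_twist[where s = 1 and t = 1 and a = 1 and b = 1])
    show "serre_el UU ?V (q i) ?n ((e i \<boxtimes> \<one>\<^bsub>U\<^esub>)) ((e j \<boxtimes> \<one>\<^bsub>U\<^esub>)) = \<zero>\<^bsub>UU\<^esub>"
      using gamma_hom_serre[OF U_gamma_algebra TT.T_gamma_algebra TT.left_embedding, of "e i" "e j" ?V "q i" ?n]
      by (simp add: serre_e[OF ij] cq_linear_zero[OF U.cq_module_axioms TT.T.cq_module_axioms TT.pure_linear_left])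
    show "e i \<boxtimes> k i = 1 \<odot>\<^bsub>UU\<^esub> ((e i \<boxtimes> \<one>\<^bsub>U\<^esub>) \<otimes>\<^bsub>UU\<^esub> (\<one>\<^bsub>U\<^esub> \<boxtimes> k i))"
      "e j \<boxtimes> k j = 1 \<odot>\<^bsub>UU\<^esub> ((e j \<boxtimes> \<one>\<^bsub>U\<^esub>) \<otimes>\<^bsub>UU\<^esub> (\<one>\<^bsub>U\<^esub> \<boxtimes> k j))"
      by (simp_all add: TT.mult_pure_0_left h)
  qed (simp_all add: TT.mult_pure_0_left h kk[OF ij(1,2)])
  finally show ?thesis by simp
qed

lemma \<Delta>_serre_f:
  assumes ij: "i \<in> I" "j \<in> I" "i \<noteq> j"
  shows "serre_el UU (w (\<xi> i) (\<xi> j)) (q i) (nat (1 - A i j)) (\<Delta>f i) (\<Delta>f j) = \<zero>\<^bsub>UU\<^esub>"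
proof -
  let ?W = "w (\<xi> j) (\<xi> i)" and ?V = "w (\<xi> i) (\<xi> j)" and ?n = "nat (1 - A i j)"
  note [simp] = gens_closed[OF ij(1,2)]
  note h = gens_hom[OF ij(1)] gens_hom[OF ij(2)] U.one_hom_part
  have VW: "?V * ?W = 1" "?W * ?V = 1" by (rule w_inverse)+
  have cc: "v * inverse (c i j) * (v' * c i j) = v * v'" for v v'
    using c_nonzero[of i j] by (metis mult.assoc mult.left_commute mult.right_neutral left_inverse)
  have yx: "(f i \<boxtimes> \<one>\<^bsub>U\<^esub>) \<otimes>\<^bsub>UU\<^esub> (k' i \<boxtimes> f i) =
      (inverse (q i) ^ 2) \<odot>\<^bsub>UU\<^esub> ((k' i \<boxtimes> f i) \<otimes>\<^bsub>UU\<^esub> (f i \<boxtimes> \<one>\<^bsub>U\<^esub>))"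
  proof -
    have "inverse (q i) ^ 2 * c i i = 1"
      using q_nonzero by (simp add: c_diag[OF ij(1)] flip: power_mult_distrib)
    then show ?thesis
      by (simp add: TT.mult_pure[OF _ h(2) h(2)] TT.mult_pure_0_left h \<xi>_self ij k'f[OF ij(1,1)]
          TT.pure_smult_left TT.T.smult_smult w_minus_left w_minus_right)
  qed
  have yu: "(f i \<boxtimes> \<one>\<^bsub>U\<^esub>) \<otimes>\<^bsub>UU\<^esub> (k' j \<boxtimes> f j) =
      (?V * inverse (c i j)) \<odot>\<^bsub>UU\<^esub> ((k' j \<boxtimes> f j) \<otimes>\<^bsub>UU\<^esub> (f i \<boxtimes> \<one>\<^bsub>U\<^esub>))"
    by (simp add: cc VW TT.mult_pure[OF _ h(6) h(2)] TT.mult_pure_0_left h k'f[OF ij(2,1)]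
          TT.pure_smult_left TT.T.smult_smult w_minus_left w_minus_right c_sym[OF ij(1,2)])
  have vx: "(f j \<boxtimes> \<one>\<^bsub>U\<^esub>) \<otimes>\<^bsub>UU\<^esub> (k' i \<boxtimes> f i) =
      (?W * inverse (c i j)) \<odot>\<^bsub>UU\<^esub> ((k' i \<boxtimes> f i) \<otimes>\<^bsub>UU\<^esub> (f j \<boxtimes> \<one>\<^bsub>U\<^esub>))"
    by (simp add: cc VW TT.mult_pure[OF _ h(2) h(6)] TT.mult_pure_0_left h k'f[OF ij(1,2)]
          TT.pure_smult_left TT.T.smult_smult w_minus_left w_minus_right)
  \<comment> \<open>The summands are exchanged because it is now \<open>f \<boxtimes> \<one>\<close>
    that passes the other summand at the cost of \<open>inverse (q i) ^ 2\<close>, and so takes the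
    part of \<open>y\<close>.\<close>
  have "serre_el UU ?V (q i) ?n (\<Delta>f i) (\<Delta>f j) =
      serre_el UU ?V (q i) ?n ((k' i \<boxtimes> f i) \<oplus>\<^bsub>UU\<^esub> (f i \<boxtimes> \<one>\<^bsub>U\<^esub>))
        ((k' j \<boxtimes> f j) \<oplus>\<^bsub>UU\<^esub> (f j \<boxtimes> \<one>\<^bsub>U\<^esub>))"
    by (simp add: TT.T.M.a_comm)
  also have "\<dots> = serre_el UU ?V (q i) ?n ((k' i \<boxtimes> f i)) ((k' j \<boxtimes> f j)) \<oplus>\<^bsub>UU\<^esub>
      serre_el UU ?V (q i) ?n ((f i \<boxtimes> \<one>\<^bsub>U\<^esub>)) ((f j \<boxtimes> \<one>\<^bsub>U\<^esub>))"
    by (rule TT.T.serre_el_add[OF q_generic[OF ij(1)] _ _ _ _ yx yu _ vx])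
      (use VW in \<open>simp_all add: q_power[OF ij] mult.assoc[symmetric]\<close>)
  also have "serre_el UU ?V (q i) ?n ((f i \<boxtimes> \<one>\<^bsub>U\<^esub>)) ((f j \<boxtimes> \<one>\<^bsub>U\<^esub>)) = \<zero>\<^bsub>UU\<^esub>"
    using gamma_hom_serre[OF U_gamma_algebra TT.T_gamma_algebra TT.left_embedding, of "f i" "f j" ?V "q i" ?n]
    by (simp add: serre_f[OF ij] cq_linear_zero[OF U.cq_module_axioms TT.T.cq_module_axioms TT.pure_linear_left])
  also have "serre_el UU ?V (q i) ?n ((k' i \<boxtimes> f i)) ((k' j \<boxtimes> f j)) = \<zero>\<^bsub>UU\<^esub>"
  proof (rule TT.T.serre_el_twist[where s = 1 and t = 1 and a = 1 and b = 1])
    show "serre_el UU ?V (q i) ?n ((\<one>\<^bsub>U\<^esub> \<boxtimes> f i)) ((\<one>\<^bsub>U\<^esub> \<boxtimes> f j)) = \<zero>\<^bsub>UU\<^esub>"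
      using gamma_hom_serre[OF U_gamma_algebra TT.T_gamma_algebra TT.right_embedding, of "f i" "f j" ?V "q i" ?n]
      by (simp add: serre_f[OF ij] cq_linear_zero[OF U.cq_module_axioms TT.T.cq_module_axioms TT.pure_linear_right])
    show "k' i \<boxtimes> f i = 1 \<odot>\<^bsub>UU\<^esub> ((\<one>\<^bsub>U\<^esub> \<boxtimes> f i) \<otimes>\<^bsub>UU\<^esub> (k' i \<boxtimes> \<one>\<^bsub>U\<^esub>))"
      "k' j \<boxtimes> f j = 1 \<odot>\<^bsub>UU\<^esub> ((\<one>\<^bsub>U\<^esub> \<boxtimes> f j) \<otimes>\<^bsub>UU\<^esub> (k' j \<boxtimes> \<one>\<^bsub>U\<^esub>))"
      by (simp_all add: TT.mult_pure_0_right h)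
  qed (simp_all add: TT.mult_pure_0_right h k'k'[OF ij(1,2)])
  finally show ?thesis by simp
qed

lemma \<Delta>_rel: "uq_rel \<omega> \<xi> I d A UU \<Delta>e \<Delta>f \<Delta>k \<Delta>k'"
  unfolding uq_rel_def
proof (intro conjI ballI impI)
  fix i j assume ij: "i \<in> I" "j \<in> I"
  note [simp] = gens_closed[OF ij]
  note h = gens_hom[OF ij(1)] gens_hom[OF ij(2)] U.one_hom_part
  have kkk': "k i \<cdot> (k j \<cdot> k' i) = k j" "k i \<cdot> (k' j \<cdot> k' i) = k' j"
    by (simp_all add: k'k[OF ij, symmetric] k'k'[OF ij(2,1)] kk'_one[OF ij] flip: U.m_assoc)
  have kek: "k i \<cdot> (e j \<cdot> k' i) = c i j \<odot>\<^bsub>U\<^esub> e j"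
    "k i \<cdot> (f j \<cdot> k' i) = inverse (c i j) \<odot>\<^bsub>U\<^esub> f j"
    using kek'[OF ij] kfk'[OF ij] by (simp_all add: U.m_assoc)
  show "\<Delta>k i \<otimes>\<^bsub>UU\<^esub> \<Delta>k j = \<Delta>k j \<otimes>\<^bsub>UU\<^esub> \<Delta>k i"
    by (simp add: TT.mult_pure_0_left h kk[OF ij])
  show "\<Delta>k i \<otimes>\<^bsub>UU\<^esub> \<Delta>e j \<otimes>\<^bsub>UU\<^esub> \<Delta>k' i = c i j \<odot>\<^bsub>UU\<^esub> \<Delta>e j"
    by (simp add: TT.T.l_distr TT.T.r_distr TT.mult_pure_0_left TT.mult_pure_0_right h U.m_assoc
        kkk' kek kk'_one[OF ij] TT.pure_smult_left TT.pure_smult_right TT.T.smult_add_right)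
  show "\<Delta>k i \<otimes>\<^bsub>UU\<^esub> \<Delta>f j \<otimes>\<^bsub>UU\<^esub> \<Delta>k' i = q i powi (- A i j) \<odot>\<^bsub>UU\<^esub> \<Delta>f j"
    by (simp add: TT.T.l_distr TT.T.r_distr TT.mult_pure_0_left TT.mult_pure_0_right h U.m_assoc
        kkk' kek kk'_one[OF ij] TT.pure_smult_left TT.pure_smult_right TT.T.smult_add_right power_int_minus)
qed (simp_all add: TT.mult_pure_0_left gens_hom kk'_one k'k_one TT.one_T \<Delta>_ef \<Delta>_serre_e \<Delta>_serre_f)

lemma \<epsilon>_rel: "uq_rel \<omega> \<xi> I d A (Cq_alg :: (cq, 'g) graded_algebra) (\<lambda>_. 0) (\<lambda>_. 0) (\<lambda>_. 1) (\<lambda>_. 1)"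
proof -
  interpret C: gamma_algebra "Cq_alg :: (cq, 'g) graded_algebra" by (rule Cq_alg_gamma_algebra)
  have [simp]: "x \<ominus>\<^bsub>(Cq_alg :: (cq, 'g) graded_algebra)\<^esub> x = 0" for x
    using C.M.r_neg[of x] by (simp add: a_minus_def)
  have "serre_el (Cq_alg :: (cq, 'g) graded_algebra) v p n 0 0 = 0" for v p n
    using C.serre_el_zero[of 0] by simp
  then show ?thesis by (simp add: uq_rel_def)
qed

section \<open>The relations for the antipode\<close>

abbreviation Se where "Se i \<equiv> \<ominus>\<^bsub>U\<^esub> (e i \<cdot> k' i)"
abbreviation Sf where "Sf i \<equiv> \<ominus>\<^bsub>U\<^esub> (k i \<cdot> f i)"

lemma S_hom: "i \<in> I \<Longrightarrow> Se i \<in> hom_part U (\<xi> i)" "i \<in> I \<Longrightarrow> Sf i \<in> hom_part U (- \<xi> i)"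
  by (auto intro!: U.hom_uminus U.hom_mult gens_hom)

text \<open>The opposite commutator of the images is minus the product of \<open>k j\<close>,
  \<open>D\<close> and \<open>k' i\<close>, where \<open>D\<close> is the twisted commutator of
  \<open>e i\<close> and \<open>f j\<close>. The sign accounts for the exchange of \<open>k\<close>
  and \<open>k'\<close>.\<close>

lemma S_ef:
  assumes ij: "i \<in> I" "j \<in> I"
  shows "UA.op_mult (Se i) (Sf j) \<ominus>\<^bsub>U\<^esub> w (\<xi> j) (\<xi> i) \<odot>\<^bsub>U\<^esub> UA.op_mult (Sf j) (Se i) =
    (if i = j then inverse (q i - inverse (q i)) \<odot>\<^bsub>U\<^esub> (k' i \<ominus>\<^bsub>U\<^esub> k i) else \<zero>\<^bsub>U\<^esub>)"
proof -
  let ?W = "w (\<xi> j) (\<xi> i)" and ?V = "w (\<xi> i) (\<xi> j)"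
  note [simp] = gens_closed[OF ij]
  have WV: "?W * ?V = 1" by (rule w_inverse)
  let ?D = "e i \<cdot> f j \<ominus>\<^bsub>U\<^esub> ?W \<odot>\<^bsub>U\<^esub> (f j \<cdot> e i)"
  have 1: "UA.op_mult (Se i) (Sf j) = ?W \<odot>\<^bsub>U\<^esub> (k j \<cdot> (f j \<cdot> e i) \<cdot> k' i)"
    by (simp add: UA.op_mult_hom[OF S_hom(1)[OF ij(1)] S_hom(2)[OF ij(2)]] w_minus_right
        U.l_minus U.r_minus U.m_assoc)
  have "?W \<odot>\<^bsub>U\<^esub> UA.op_mult (Sf j) (Se i) = e i \<cdot> (k' i \<cdot> k j) \<cdot> f j"
    by (simp add: UA.op_mult_hom[OF S_hom(2)[OF ij(2)] S_hom(1)[OF ij(1)]] w_minus_left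
        U.l_minus U.r_minus U.m_assoc U.smult_smult WV)
  also have "\<dots> = (e i \<cdot> k j) \<cdot> (k' i \<cdot> f j)"
    by (simp add: k'k[OF ij] U.m_assoc)
  also have "\<dots> = (c i j \<odot>\<^bsub>U\<^esub> (e i \<cdot> k j)) \<cdot> (f j \<cdot> k' i)"
    by (simp add: k'f[OF ij] U.smult_mult_left U.smult_mult_right)
  also have "c i j \<odot>\<^bsub>U\<^esub> (e i \<cdot> k j) = k j \<cdot> e i"
    by (simp add: ke[OF ij(2,1)] c_sym[OF ij])
  also have "k j \<cdot> e i \<cdot> (f j \<cdot> k' i) = k j \<cdot> (e i \<cdot> f j) \<cdot> k' i"
    by (simp add: U.m_assoc)
  finally have 2: "?W \<odot>\<^bsub>U\<^esub> UA.op_mult (Sf j) (Se i) = k j \<cdot> (e i \<cdot> f j) \<cdot> k' i" .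
  have "k j \<cdot> ?D \<cdot> k' i = k j \<cdot> (e i \<cdot> f j) \<cdot> k' i \<ominus>\<^bsub>U\<^esub>
      ?W \<odot>\<^bsub>U\<^esub> (k j \<cdot> (f j \<cdot> e i) \<cdot> k' i)"
    by (simp add: a_minus_def U.l_distr U.r_distr U.l_minus U.r_minus U.smult_mult_left U.smult_mult_right)
  then have "UA.op_mult (Se i) (Sf j) \<ominus>\<^bsub>U\<^esub> ?W \<odot>\<^bsub>U\<^esub> UA.op_mult (Sf j) (Se i) =
      \<ominus>\<^bsub>U\<^esub> (k j \<cdot> ?D \<cdot> k' i)"
    unfolding 1 2 by (simp add: U.diff_swap)
  also have "\<dots> = (if i = j then inverse (q i - inverse (q i)) \<odot>\<^bsub>U\<^esub> (k' i \<ominus>\<^bsub>U\<^esub> k i) else \<zero>\<^bsub>U\<^esub>)"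
  proof (cases "i = j")
    case True
    have "k i \<cdot> (k' i \<cdot> k' i) = k' i"
      by (simp add: kk'_one[OF ij] flip: U.m_assoc)
    then have "k i \<cdot> (k i \<ominus>\<^bsub>U\<^esub> k' i) \<cdot> k' i = k i \<ominus>\<^bsub>U\<^esub> k' i"
      by (simp add: a_minus_def U.l_distr U.r_distr U.l_minus U.r_minus U.m_assoc kk'_one[OF ij])
    then show ?thesis
      unfolding ef[OF ij]
      by (simp add: True[symmetric] U.smult_mult_left U.smult_mult_right U.diff_swap
          flip: U.smult_minus_right)
  next
    case False
    then show ?thesis unfolding ef[OF ij] by simp
  qed
  finally show ?thesis .
qed

text \<open>\<open>op_serre\<close> removes the opposite product. In \<open>U\<close> the elements
  \<open>Se\<close> are twists of the \<open>e\<close>'s by the \<open>k'\<close>'s, and the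
  symmetry of \<open>c\<close> makes the constant for \<open>k' j\<close> and \<open>e i\<close> the
  same as that for \<open>k' i\<close> and \<open>e j\<close>.\<close>

lemma S_serre_e:
  assumes ij: "i \<in> I" "j \<in> I" "i \<noteq> j"
  shows "serre_el UA.opH (w (\<xi> i) (\<xi> j)) (q i) (nat (1 - A i j)) (Se i) (Se j) = \<zero>\<^bsub>U\<^esub>"
proof (rule UA.op_serre[OF q_generic[OF ij(1)] S_hom(1)[OF ij(1)] _ S_hom(1)[OF ij(2)]])
  note [simp] = gens_closed[OF ij(1,2)]
  show "serre_el U (w (\<xi> i) (\<xi> j)) (q i) (nat (1 - A i j)) (Se i) (Se j) = \<zero>\<^bsub>U\<^esub>"
    by (rule U.serre_el_twist[where s = "- 1" and t = "- 1" and e = "e i" and v = "e j"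
          and g = "k' i" and h = "k' j", OF _ _ _ _ _ _ k'e[OF ij(1,1)] k'e[OF ij(1,2)] _ _ serre_e[OF ij]])
      (simp_all add: U.smult_minus_one k'e[OF ij(2,1)] c_sym[OF ij(1,2)] k'k'[OF ij(1,2)])
qed (simp add: \<xi>_self ij)

lemma S_serre_f:
  assumes ij: "i \<in> I" "j \<in> I" "i \<noteq> j"
  shows "serre_el UA.opH (w (\<xi> i) (\<xi> j)) (q i) (nat (1 - A i j)) (Sf i) (Sf j) = \<zero>\<^bsub>U\<^esub>"
proof -
  note [simp] = gens_closed[OF ij(1,2)]
  have ww: "w (- \<xi> i) (- \<xi> j) = w (\<xi> i) (\<xi> j)" "w (- \<xi> i) (- \<xi> i) = 1"
    by (simp_all add: w_minus_left w_minus_right \<xi>_self ij)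
  have "serre_el U (w (- \<xi> i) (- \<xi> j)) (q i) (nat (1 - A i j)) (Sf i) (Sf j) = \<zero>\<^bsub>U\<^esub>"
    unfolding ww
    \<comment> \<open>\<open>serre_el_twist\<close> wants the twisting element on the right;
      bringing \<open>k\<close> there in \<open>- k f\<close> produces the inverse of
      \<open>c i i\<close>, respectively of \<open>c j j\<close>.\<close>
    by (rule U.serre_el_twist[where s = "- inverse (c i i)" and t = "- inverse (c j j)" and e = "f i" and v = "f j"
          and g = "k i" and h = "k j", OF _ _ _ _ _ _ kf[OF ij(1,1)] kf[OF ij(1,2)] _ _ serre_f[OF ij]])
      (simp_all add: U.smult_minus_left kf[OF ij(2,1)] kf[OF ij(1,1)] kf[OF ij(2,2)] c_sym[OF ij(1,2)] kk[OF ij(1,2)])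
  from UA.op_serre[OF q_generic[OF ij(1)] S_hom(2)[OF ij(1)] ww(2) S_hom(2)[OF ij(2)] this]
  show ?thesis unfolding ww .
qed

lemma S_rel: "uq_rel \<omega> \<xi> I d A UA.opH Se Sf k' k"
  unfolding uq_rel_def
proof (intro conjI ballI impI)
  fix i j assume ij: "i \<in> I" "j \<in> I"
  note [simp] = gens_closed[OF ij]
  note h = gens_hom[OF ij(1)] gens_hom[OF ij(2)]
  show "UA.op_mult (k' i) (k' j) = UA.op_mult (k' j) (k' i)"
    by (simp add: UA.op_mult_0_left h k'k'[OF ij])
  have "k i \<cdot> (e j \<cdot> k' j) \<cdot> k' i = (k i \<cdot> e j \<cdot> k' i) \<cdot> k' j"
    by (simp add: U.m_assoc k'k'[OF ij])
  also have "\<dots> = c i j \<odot>\<^bsub>U\<^esub> (e j \<cdot> k' j)"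
    unfolding kek'[OF ij] by (simp add: U.smult_mult_left)
  finally have 1: "k i \<cdot> (e j \<cdot> k' j) \<cdot> k' i = c i j \<odot>\<^bsub>U\<^esub> (e j \<cdot> k' j)" .
  then show "UA.op_mult (UA.op_mult (k' i) (Se j)) (k i) = c i j \<odot>\<^bsub>UA.opH\<^esub> Se j"
    by (simp add: UA.op_mult_0_left UA.op_mult_0_right h U.l_minus U.r_minus U.smult_minus_right U.m_assoc)
  have "k i \<cdot> (k j \<cdot> f j) \<cdot> k' i = (k i \<cdot> k j) \<cdot> (f j \<cdot> k' i)"
    by (simp add: U.m_assoc)
  also have "\<dots> = k j \<cdot> (k i \<cdot> f j \<cdot> k' i)"
    by (simp add: kk[OF ij] U.m_assoc)
  also have "\<dots> = inverse (c i j) \<odot>\<^bsub>U\<^esub> (k j \<cdot> f j)"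
    unfolding kfk'[OF ij] by (simp add: U.smult_mult_right)
  finally have 2: "k i \<cdot> (k j \<cdot> f j) \<cdot> k' i = inverse (c i j) \<odot>\<^bsub>U\<^esub> (k j \<cdot> f j)" .
  then show "UA.op_mult (UA.op_mult (k' i) (Sf j)) (k i) = q i powi (- A i j) \<odot>\<^bsub>UA.opH\<^esub> Sf j"
    by (simp add: UA.op_mult_0_left UA.op_mult_0_right h U.l_minus U.r_minus U.smult_minus_right U.m_assoc power_int_minus)
  have op_minus: "x \<ominus>\<^bsub>UA.opH\<^esub> y = x \<ominus>\<^bsub>U\<^esub> y" for x y by (simp add: a_minus_def)
  show "UA.op_mult (Se i) (Sf j) \<ominus>\<^bsub>UA.opH\<^esub> w (\<xi> j) (\<xi> i) \<odot>\<^bsub>UA.opH\<^esub> UA.op_mult (Sf j) (Se i) =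
    (if i = j then inverse (q i - inverse (q i)) \<odot>\<^bsub>UA.opH\<^esub> (k' i \<ominus>\<^bsub>UA.opH\<^esub> k i) else \<zero>\<^bsub>UA.opH\<^esub>)"
    using S_ef[OF ij] by (simp add: op_minus)
qed (simp_all add: UA.op_mult_0_left gens_hom kk'_one k'k_one S_serre_e S_serre_f)

end

section \<open>The Hopf structure\<close>

text \<open>Uniqueness is claimed among maps that are undefined off the carrier, so the
  homomorphisms from the universal property have to be restricted.\<close>

lemma gamma_hom_restrict:
  assumes "gamma_algebra M" "gamma_hom M P h"
  shows "gamma_hom M P (restrict h (carrier M))"
proof -
  interpret M: gamma_algebra M by fact
  show ?thesis
    using assms(2) by (auto simp: gamma_hom_def gamma_linear_def M.hom_carrier)
qed

section \<open>The convolution of the antipode with the identity\<close>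

locale antipode_map = com_factor_algebra \<omega> H
  for \<omega> :: "'g::ab_group_add \<Rightarrow> 'g \<Rightarrow> complex" and H :: "('a, 'g) graded_algebra" (structure) +
  fixes S :: "'a \<Rightarrow> 'a"
  assumes S_op_hom: "gamma_hom H opH S"
begin

sublocale HH: tensor_algebras \<omega> H H ..

lemma S_closed [simp]: "x \<in> carrier H \<Longrightarrow> S x \<in> carrier H"
  using gamma_hom_closed[OF S_op_hom] by simp

lemma S_gamma_linear: "gamma_linear H H S"
  using S_op_hom by (simp add: gamma_hom_def gamma_linear_def)

lemma S_linear: "cq_linear H H S"
  using S_gamma_linear by (simp add: gamma_linear_iff)

lemma S_mult:
  "x \<in> hom_part H \<alpha> \<Longrightarrow> y \<in> hom_part H \<beta> \<Longrightarrow> S (x \<otimes> y) = w \<alpha> \<beta> \<odot> (S y \<otimes> S x)"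
  using gamma_hom_mult[OF S_op_hom] gamma_hom_degree[OF S_op_hom] hom_carrier
  by (simp add: op_mult_hom)

lemma S_one: "S \<one> = \<one>"
  using gamma_hom_one[OF S_op_hom] by simp

lemma mult_bilinear: "cq_bilinear H H H (\<otimes>)"
  by (simp add: cq_bilinear_def mult_linear_left mult_linear_right)

text \<open>The multiplication applied after \<open>S \<otimes> id\<close>; composed with the
  comultiplication this is the convolution product of \<open>S\<close> and the identity.\<close>

definition conv_left where
  "conv_left X = tensor_lift H (\<lambda>y z. y \<otimes> z) (tensor_map \<omega> H H S id X)"

definition conv_right where
  "conv_right X = tensor_lift H (\<lambda>y z. y \<otimes> z) (tensor_map \<omega> H H id S X)"

lemmas id_linear = gamma_hom_linear[OF gamma_hom_id[of H]]

lemma conv_left_linear: "cq_linear HH.T H conv_left"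
  unfolding conv_left_def
  by (rule cq_linear_comp[OF tensor_map_linear[OF HH.tensor_modules_axioms HH.tensor_modules_axioms
        S_linear id_linear] HH.tensor_lift_linear[OF cq_module_axioms mult_bilinear]])

lemma conv_right_linear: "cq_linear HH.T H conv_right"
  unfolding conv_right_def
  by (rule cq_linear_comp[OF tensor_map_linear[OF HH.tensor_modules_axioms HH.tensor_modules_axioms
        id_linear S_linear] HH.tensor_lift_linear[OF cq_module_axioms mult_bilinear]])

lemma conv_left_pure:
  "x \<in> carrier H \<Longrightarrow> y \<in> carrier H \<Longrightarrow> conv_left (HH.pure x y) = S x \<otimes> y"
  by (simp add: conv_left_def HH.tensor_lift_pure[OF cq_module_axioms mult_bilinear]
      tensor_map_pure[OF HH.tensor_modules_axioms HH.tensor_modules_axioms S_linear id_linear])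

lemma conv_right_pure:
  "x \<in> carrier H \<Longrightarrow> y \<in> carrier H \<Longrightarrow> conv_right (HH.pure x y) = x \<otimes> S y"
  by (simp add: conv_right_def HH.tensor_lift_pure[OF cq_module_axioms mult_bilinear]
      tensor_map_pure[OF HH.tensor_modules_axioms HH.tensor_modules_axioms id_linear S_linear])

text \<open>As \<open>S\<close> reverses products, \<open>S y\<close> moves to the outside. The
  factor is \<open>w \<delta> \<beta>\<close> from the tensor product times
  \<open>w \<gamma> \<beta>\<close> from \<open>S\<close>, which depends only on the total degree of
  \<open>X\<close>.\<close>

lemma conv_left_mult_pure:
  assumes X: "X \<in> hom_part HH.T \<alpha>" and y: "y \<in> hom_part H \<beta>" "z \<in> carrier H"
  shows "conv_left (X \<otimes>\<^bsub>HH.T\<^esub> HH.pure y z) = w \<alpha> \<beta> \<odot> (S y \<otimes> conv_left X \<otimes> z)"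
  using X
proof (induction rule: HH.T_hom_induct)
  case (add X X')
  then show ?case
    using y hom_carrier[OF y(1)]
    by (simp add: HH.T.l_distr cq_linear_add[OF conv_left_linear] cq_linear_closed[OF conv_left_linear]
        r_distr l_distr smult_add_right)
next
  case (pure \<gamma> \<delta> a b)
  note c = hom_carrier[OF pure(1)] hom_carrier[OF pure(2)] hom_carrier[OF y(1)]
  show ?case
    using c y pure(3)[symmetric]
    by (simp add: HH.mult_pure[OF _ pure(2) y(1)] cq_linear_smult[OF conv_left_linear] conv_left_pure
        S_mult[OF pure(1) y(1)] smult_mult_left smult_smult m_assoc w_add_left mult.commute)
qed

lemma conv_right_mult_pure:
  assumes Y: "Y \<in> hom_part HH.T \<beta>" and x: "x \<in> carrier H" "z \<in> hom_part H \<alpha>"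
  shows "conv_right (HH.pure x z \<otimes>\<^bsub>HH.T\<^esub> Y) = w \<alpha> \<beta> \<odot> (x \<otimes> conv_right Y \<otimes> S z)"
  using Y
proof (induction rule: HH.T_hom_induct)
  case (add Y Y')
  then show ?case
    using x hom_carrier[OF x(2)]
    by (simp add: HH.T.r_distr cq_linear_add[OF conv_right_linear] cq_linear_closed[OF conv_right_linear]
        r_distr l_distr smult_add_right)
next
  case (pure \<gamma> \<delta> a b)
  note c = hom_carrier[OF pure(1)] hom_carrier[OF pure(2)] hom_carrier[OF x(2)]
  show ?case
    using c x pure(3)[symmetric]
    by (simp add: HH.mult_pure[OF _ x(2) pure(1)] cq_linear_smult[OF conv_right_linear] conv_right_pure
        S_mult[OF x(2) pure(2)] smult_mult_right smult_smult m_assoc w_add_right)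
qed

text \<open>The antipode axiom propagates along products: the factor \<open>w \<alpha> \<beta>\<close> is harmless because a
  homogeneous element has counit \<open>0\<close> unless its degree is \<open>0\<close>.\<close>

lemma conv_left_mult:
  assumes X: "X \<in> hom_part HH.T \<alpha>" "conv_left X = r \<odot> \<one>" "r = 0 \<or> \<alpha> = 0"
    and Y: "Y \<in> carrier HH.T"
  shows "conv_left (X \<otimes>\<^bsub>HH.T\<^esub> Y) = r \<odot> conv_left Y"
  using Y
proof (induction rule: HH.homogeneous_induct)
  case (pure \<beta> \<gamma> y z)
  have wr: "w \<alpha> \<beta> * r = r" using X(3) by auto
  show ?case
    using hom_carrier[OF pure(1)] hom_carrier[OF pure(2)]
    by (simp add: conv_left_mult_pure[OF X(1) pure(1)] X(2) conv_left_pure smult_mult_left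
        smult_mult_right smult_smult wr)
next
  case (add Y Y')
  then show ?case
    using HH.T_hom_carrier[OF X(1)]
    by (simp add: HH.T.r_distr cq_linear_add[OF conv_left_linear] cq_linear_closed[OF conv_left_linear]
        smult_add_right)
qed

lemma conv_right_mult:
  assumes Y: "Y \<in> hom_part HH.T \<beta>" "conv_right Y = r \<odot> \<one>" "r = 0 \<or> \<beta> = 0"
    and X: "X \<in> carrier HH.T"
  shows "conv_right (X \<otimes>\<^bsub>HH.T\<^esub> Y) = r \<odot> conv_right X"
  using X
proof (induction rule: HH.homogeneous_induct)
  case (pure \<gamma> \<alpha> x z)
  have wr: "w \<alpha> \<beta> * r = r" using Y(3) by auto
  show ?case
    using hom_carrier[OF pure(1)] hom_carrier[OF pure(2)]
    by (simp add: conv_right_mult_pure[OF Y(1) _ pure(2)] Y(2) conv_right_pure smult_mult_left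
        smult_mult_right smult_smult wr)
next
  case (add X X')
  then show ?case
    using HH.T_hom_carrier[OF Y(1)]
    by (simp add: HH.T.l_distr cq_linear_add[OF conv_right_linear] cq_linear_closed[OF conv_right_linear]
        smult_add_right)
qed

end

context com_factor_algebra
begin

text \<open>For uniqueness: a homomorphism into the opposite algebra is determined by its values on
  generators. That \<open>S\<close> preserves the unit is obtained from the antipode identity at
  \<open>\<one>\<close>, where the comultiplication gives \<open>\<one> \<otimes> \<one>\<close> and
  the counit gives 1.\<close>

lemma antipode_op_hom:
  assumes "hopf_gamma_algebra \<omega> H \<Delta> \<epsilon> S"
  shows "gamma_hom H opH S"
proof -
  interpret hopf_gamma_algebra \<omega> H \<Delta> \<epsilon> S by fact
  interpret HH: tensor_algebras \<omega> H H ..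
  have lin: "cq_linear H H S" using antipode_linear by (simp add: gamma_linear_iff)
  note [simp] = cq_linear_closed[OF lin] cq_linear_add[OF lin]
  have bil: "cq_bilinear H H H (\<otimes>)"
    by (simp add: cq_bilinear_def mult_linear_left mult_linear_right)
  have "\<Delta> \<one> = HH.pure \<one> \<one>"
    using gamma_hom_one[OF comult_hom] by (simp add: HH.one_T)
  then have "S \<one> = \<epsilon> \<one> \<odot> \<one>"
    using antipode_left[of \<one>]
    by (simp add: HH.tensor_lift_pure[OF cq_module_axioms bil] tensor_map_pure[OF HH.tensor_modules_axioms
          HH.tensor_modules_axioms lin gamma_hom_linear[OF gamma_hom_id]])
  then have one: "S \<one> = \<one>"
    using gamma_hom_one[OF counit_hom] by simp
  show ?thesis
  proof (rule gamma_homI)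
    show "cq_linear H opH S" using lin by (simp add: cq_linear_def)
    show "S x \<in> hom_part opH \<gamma>" if "x \<in> hom_part H \<gamma>" for x \<gamma>
      using that antipode_linear by (simp add: gamma_linear_iff)
    show "S \<one> = \<one>\<^bsub>opH\<^esub>" using one by simp
    fix x y assume x: "x \<in> carrier H" and y: "y \<in> carrier H"
    from x show "S (x \<otimes> y) = S x \<diamondop> S y"
    proof (induction rule: hom_induct)
      case x: (hom \<alpha> x)
      from y show ?case
      proof (induction rule: hom_induct)
        case y: (hom \<beta> y)
        have "S x \<in> hom_part H \<alpha>" "S y \<in> hom_part H \<beta>"
          using x y antipode_linear by (simp_all add: gamma_linear_iff)
        then show ?case by (simp add: op_mult_hom antipode_mult[OF x y])
      qed (use hom_carrier[OF x] in \<open>simp add: r_distr op_r_distr\<close>)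
    qed (use y in \<open>simp add: l_distr op_l_distr\<close>)
  qed
qed

end

section \<open>The scalars as a tensor factor\<close>

context com_factor_algebra
begin

interpretation C: gamma_algebra "Cq_alg :: (cq, 'g) graded_algebra" by (rule Cq_alg_gamma_algebra)
interpretation CH: tensor_algebras \<omega> "Cq_alg :: (cq, 'g) graded_algebra" H ..
interpretation HC: tensor_algebras \<omega> H "Cq_alg :: (cq, 'g) graded_algebra" ..

lemma left_scalar_tensor: "tensor_algebras \<omega> (Cq_alg :: (cq, 'g) graded_algebra) H"
  and right_scalar_tensor: "tensor_algebras \<omega> H (Cq_alg :: (cq, 'g) graded_algebra)"
  by unfold_locales

lemma scalar_bilinear_left: "cq_bilinear (Cq_alg :: (cq, 'g) graded_algebra) H H (\<lambda>c y. c \<odot> y)"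
  unfolding cq_bilinear_def
  by (auto intro!: cq_linearI simp: smult_add smult_add_right smult_smult mult.commute)

lemma scalar_bilinear_right: "cq_bilinear H (Cq_alg :: (cq, 'g) graded_algebra) H (\<lambda>y c. c \<odot> y)"
  unfolding cq_bilinear_def
  by (auto intro!: cq_linearI simp: smult_add smult_add_right smult_smult mult.commute)

lemma scalar_left_pure: "y \<in> carrier H \<Longrightarrow> tensor_lift H (\<lambda>c y. c \<odot> y) (CH.pure c y) = c \<odot> y"
  using CH.tensor_lift_pure[OF cq_module_axioms scalar_bilinear_left] by simp

lemma scalar_right_pure: "y \<in> carrier H \<Longrightarrow> tensor_lift H (\<lambda>y c. c \<odot> y) (HC.pure y c) = c \<odot> y"
  using HC.tensor_lift_pure[OF cq_module_axioms scalar_bilinear_right] by simp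

text \<open>With this the left counit identity becomes an equation between homomorphisms and can be
  tested on generators.\<close>

lemma scalar_left_hom: "gamma_hom CH.T H (tensor_lift H (\<lambda>c y. c \<odot> y))"
proof (rule CH.tensor_gamma_homI[OF gamma_algebra_axioms CH.tensor_lift_linear[OF cq_module_axioms scalar_bilinear_left]])
  fix \<alpha> \<beta> \<gamma> \<delta> :: 'g and a c :: cq and b d
  assume h: "a \<in> hom_part Cq_alg \<alpha>" "b \<in> hom_part H \<beta>" "c \<in> hom_part Cq_alg \<gamma>" "d \<in> hom_part H \<delta>"
  \<comment> \<open>A scalar of non-zero degree is 0, and in degree 0 the factor
    \<open>w \<beta> \<gamma>\<close> is 1.\<close>
  show "w \<beta> \<gamma> \<odot> tensor_lift H (\<lambda>c y. c \<odot> y) (CH.pure (a \<otimes>\<^bsub>Cq_alg\<^esub> c) (b \<otimes> d)) =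
    tensor_lift H (\<lambda>c y. c \<odot> y) (CH.pure a b) \<otimes> tensor_lift H (\<lambda>c y. c \<odot> y) (CH.pure c d)"
    using hom_carrier[OF h(2)] hom_carrier[OF h(4)] h(3)
    by (cases "\<gamma> = 0")
      (simp_all add: scalar_left_pure smult_mult_left smult_mult_right smult_smult mult.commute)
qed (auto simp: scalar_left_pure hom_carrier hom_smult split: if_splits)

lemma scalar_right_hom: "gamma_hom HC.T H (tensor_lift H (\<lambda>y c. c \<odot> y))"
proof (rule HC.tensor_gamma_homI[OF gamma_algebra_axioms HC.tensor_lift_linear[OF cq_module_axioms scalar_bilinear_right]])
  fix \<alpha> \<beta> \<gamma> \<delta> :: 'g and b d :: cq and a c
  assume h: "a \<in> hom_part H \<alpha>" "b \<in> hom_part Cq_alg \<beta>" "c \<in> hom_part H \<gamma>" "d \<in> hom_part Cq_alg \<delta>"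
  show "w \<beta> \<gamma> \<odot> tensor_lift H (\<lambda>y c. c \<odot> y) (HC.pure (a \<otimes> c) (b \<otimes>\<^bsub>Cq_alg\<^esub> d)) =
    tensor_lift H (\<lambda>y c. c \<odot> y) (HC.pure a b) \<otimes> tensor_lift H (\<lambda>y c. c \<odot> y) (HC.pure c d)"
    using hom_carrier[OF h(1)] hom_carrier[OF h(3)] h(2)
    by (cases "\<beta> = 0")
      (simp_all add: scalar_right_pure smult_mult_left smult_mult_right smult_smult mult.commute)
qed (auto simp: scalar_right_pure hom_carrier hom_smult split: if_splits)

end

text \<open>Homomorphisms with the prescribed values on generators, \<open>S\<close> being one into
  the opposite algebra. The Hopf axioms are derived from these properties; existence is settled
  afterwards by the universal property.\<close>

locale uq_structure_maps = uq_data \<omega> \<xi> I d A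
  for \<omega> :: "'g::ab_group_add \<Rightarrow> 'g \<Rightarrow> complex" and \<xi> :: "nat \<Rightarrow> 'g" and I :: "nat set"
    and d :: "nat \<Rightarrow> nat" and A :: "nat \<Rightarrow> nat \<Rightarrow> int" +
  fixes \<Delta> and \<epsilon> and S
  assumes \<Delta>_hom: "gamma_hom U UU \<Delta>" and \<epsilon>_hom: "gamma_hom U Cq_alg \<epsilon>"
    and S_op_hom: "gamma_hom U UA.opH S"
    and \<Delta>_gen: "i \<in> I \<Longrightarrow> \<Delta> (e i) = \<Delta>e i" "i \<in> I \<Longrightarrow> \<Delta> (f i) = \<Delta>f i"
      "i \<in> I \<Longrightarrow> \<Delta> (k i) = \<Delta>k i" "i \<in> I \<Longrightarrow> \<Delta> (k' i) = \<Delta>k' i"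
    and \<epsilon>_gen: "i \<in> I \<Longrightarrow> \<epsilon> (e i) = 0" "i \<in> I \<Longrightarrow> \<epsilon> (f i) = 0"
      "i \<in> I \<Longrightarrow> \<epsilon> (k i) = 1" "i \<in> I \<Longrightarrow> \<epsilon> (k' i) = 1"
    and S_gen: "i \<in> I \<Longrightarrow> S (e i) = Se i" "i \<in> I \<Longrightarrow> S (f i) = Sf i"
      "i \<in> I \<Longrightarrow> S (k i) = k' i" "i \<in> I \<Longrightarrow> S (k' i) = k i"
begin

sublocale S: antipode_map \<omega> U S
  by unfold_locales (rule S_op_hom)
sublocale UUU: three_algebras \<omega> U U U ..

lemma \<Delta>_one: "\<Delta> \<one>\<^bsub>U\<^esub> = \<one>\<^bsub>U\<^esub> \<boxtimes> \<one>\<^bsub>U\<^esub>"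
  using gamma_hom_one[OF \<Delta>_hom] by (simp add: TT.one_T)

lemma \<epsilon>_one: "\<epsilon> \<one>\<^bsub>U\<^esub> = 1"
  using gamma_hom_one[OF \<epsilon>_hom] by simp

lemma \<Delta>_closed [simp]: "x \<in> carrier U \<Longrightarrow> \<Delta> x \<in> carrier TT.T"
  by (rule gamma_hom_closed[OF \<Delta>_hom])

section \<open>The Hopf axioms for the structure maps\<close>

lemma coassociative:
  assumes "x \<in> carrier U"
  shows "tensor_assoc \<omega> U U U (tensor_map \<omega> UU U \<Delta> id (\<Delta> x)) = tensor_map \<omega> U UU id \<Delta> (\<Delta> x)"
proof -
  note ids = gamma_hom_id[of U]
  note hl = tensor_map_gamma_hom[OF TT.tensor_algebras_axioms UUU.MN_P.tensor_algebras_axioms \<Delta>_hom ids]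
  note hr = tensor_map_gamma_hom[OF TT.tensor_algebras_axioms UUU.M_NP.tensor_algebras_axioms ids \<Delta>_hom]
  note ha = UUU.tensor_assoc_gamma_hom
  note pl = tensor_map_pure[OF TT.tensor_modules_axioms UUU.MN_P.tensor_modules_axioms
      gamma_hom_linear[OF \<Delta>_hom] gamma_hom_linear[OF ids]]
  note pr = tensor_map_pure[OF TT.tensor_modules_axioms UUU.M_NP.tensor_modules_axioms
      gamma_hom_linear[OF ids] gamma_hom_linear[OF \<Delta>_hom]]
  show ?thesis
  proof (rule U_hom_eqI[OF UUU.M_NP.T_gamma_algebra gamma_hom_comp[OF gamma_hom_comp[OF \<Delta>_hom hl] ha]
        gamma_hom_comp[OF \<Delta>_hom hr] _ assms])
    fix i assume i: "i \<in> I"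
    note [simp] = gens_closed[OF i i] \<Delta>_gen[OF i] \<Delta>_one
    note rules = gamma_hom_add[OF hl] gamma_hom_add[OF hr] gamma_hom_add[OF ha] pl pr
      UUU.MN_P.pure_add_left UUU.M_NP.pure_add_right UUU.tensor_assoc_pure UUU.M_NP.T.M.a_assoc
    show "tensor_assoc \<omega> U U U (tensor_map \<omega> UU U \<Delta> id (\<Delta> (e i))) = tensor_map \<omega> U UU id \<Delta> (\<Delta> (e i)) \<and>
      tensor_assoc \<omega> U U U (tensor_map \<omega> UU U \<Delta> id (\<Delta> (f i))) = tensor_map \<omega> U UU id \<Delta> (\<Delta> (f i)) \<and>
      tensor_assoc \<omega> U U U (tensor_map \<omega> UU U \<Delta> id (\<Delta> (k i))) = tensor_map \<omega> U UU id \<Delta> (\<Delta> (k i)) \<and>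
      tensor_assoc \<omega> U U U (tensor_map \<omega> UU U \<Delta> id (\<Delta> (k' i))) = tensor_map \<omega> U UU id \<Delta> (\<Delta> (k' i))"
      by (simp add: rules)
  qed
qed

lemma counital_left:
  assumes "x \<in> carrier U"
  shows "tensor_lift U (\<lambda>c y. c \<odot>\<^bsub>U\<^esub> y) (tensor_map \<omega> Cq_alg U \<epsilon> id (\<Delta> x)) = x"
proof -
  note ids = gamma_hom_id[of U]
  interpret CU: tensor_algebras \<omega> "Cq_alg :: (cq, 'g) graded_algebra" U by (rule UA.left_scalar_tensor)
  note h = tensor_map_gamma_hom[OF TT.tensor_algebras_axioms CU.tensor_algebras_axioms \<epsilon>_hom ids]
  note p = tensor_map_pure[OF TT.tensor_modules_axioms CU.tensor_modules_axioms
      gamma_hom_linear[OF \<epsilon>_hom] gamma_hom_linear[OF ids]]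
  have "tensor_lift U (\<lambda>c y. c \<odot>\<^bsub>U\<^esub> y) (tensor_map \<omega> Cq_alg U \<epsilon> id (\<Delta> x)) = id x"
  proof (rule U_hom_eqI[OF U_gamma_algebra gamma_hom_comp[OF gamma_hom_comp[OF \<Delta>_hom h] UA.scalar_left_hom] ids _ assms])
    fix i assume i: "i \<in> I"
    note [simp] = gens_closed[OF i i] \<Delta>_gen[OF i] \<epsilon>_gen[OF i] \<epsilon>_one
    let ?L = "\<lambda>x. tensor_lift U (\<lambda>c y. c \<odot>\<^bsub>U\<^esub> y) (tensor_map \<omega> Cq_alg U \<epsilon> id (\<Delta> x))"
    show "?L (e i) = id (e i) \<and> ?L (f i) = id (f i) \<and> ?L (k i) = id (k i) \<and> ?L (k' i) = id (k' i)"
      by (simp add: gamma_hom_add[OF h] gamma_hom_add[OF UA.scalar_left_hom] p UA.scalar_left_pure)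
  qed
  then show ?thesis by simp
qed

lemma counital_right:
  assumes "x \<in> carrier U"
  shows "tensor_lift U (\<lambda>y c. c \<odot>\<^bsub>U\<^esub> y) (tensor_map \<omega> U Cq_alg id \<epsilon> (\<Delta> x)) = x"
proof -
  note ids = gamma_hom_id[of U]
  interpret UC: tensor_algebras \<omega> U "Cq_alg :: (cq, 'g) graded_algebra" by (rule UA.right_scalar_tensor)
  note h = tensor_map_gamma_hom[OF TT.tensor_algebras_axioms UC.tensor_algebras_axioms ids \<epsilon>_hom]
  note p = tensor_map_pure[OF TT.tensor_modules_axioms UC.tensor_modules_axioms
      gamma_hom_linear[OF ids] gamma_hom_linear[OF \<epsilon>_hom]]
  have "tensor_lift U (\<lambda>y c. c \<odot>\<^bsub>U\<^esub> y) (tensor_map \<omega> U Cq_alg id \<epsilon> (\<Delta> x)) = id x"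
  proof (rule U_hom_eqI[OF U_gamma_algebra gamma_hom_comp[OF gamma_hom_comp[OF \<Delta>_hom h] UA.scalar_right_hom] ids _ assms])
    fix i assume i: "i \<in> I"
    note [simp] = gens_closed[OF i i] \<Delta>_gen[OF i] \<epsilon>_gen[OF i] \<epsilon>_one
    let ?L = "\<lambda>x. tensor_lift U (\<lambda>y c. c \<odot>\<^bsub>U\<^esub> y) (tensor_map \<omega> U Cq_alg id \<epsilon> (\<Delta> x))"
    show "?L (e i) = id (e i) \<and> ?L (f i) = id (f i) \<and> ?L (k i) = id (k i) \<and> ?L (k' i) = id (k' i)"
      by (simp add: gamma_hom_add[OF h] gamma_hom_add[OF UA.scalar_right_hom] p UA.scalar_right_pure)
  qed
  then show ?thesis by simp
qed

text \<open>The third claim is the degree condition of \<open>conv_left_mult\<close> and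
  \<open>conv_right_mult\<close>: the counit is non-zero only on \<open>k\<close> and
  \<open>k'\<close>, which have degree 0.\<close>

lemma conv_gen:
  assumes "x \<in> uq_gens I"
  shows "S.conv_left (\<Delta> (gen x)) = \<epsilon> (gen x) \<odot>\<^bsub>U\<^esub> \<one>\<^bsub>U\<^esub>"
    and "S.conv_right (\<Delta> (gen x)) = \<epsilon> (gen x) \<odot>\<^bsub>U\<^esub> \<one>\<^bsub>U\<^esub>"
    and "\<epsilon> (gen x) = 0 \<or> uq_deg \<xi> x = 0"
proof -
  note rules = S.conv_left_pure S.conv_right_pure cq_linear_add[OF S.conv_left_linear]
    cq_linear_add[OF S.conv_right_linear] \<Delta>_gen \<epsilon>_gen S_gen S.S_one U.l_minus U.r_minus U.m_assoc
    kk'_one k'k_one U.M.l_neg U.M.r_neg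
  have k'kf: "k' i \<cdot> (k i \<cdot> f i) = f i" if i: "i \<in> I" for i
    using gens_closed[OF i i] by (simp add: k'k_one[OF i i] flip: U.m_assoc)
  show "S.conv_left (\<Delta> (gen x)) = \<epsilon> (gen x) \<odot>\<^bsub>U\<^esub> \<one>\<^bsub>U\<^esub>"
    using assms by (auto elim!: uq_gens_cases simp: rules)
  show "S.conv_right (\<Delta> (gen x)) = \<epsilon> (gen x) \<odot>\<^bsub>U\<^esub> \<one>\<^bsub>U\<^esub>"
    using assms by (auto elim!: uq_gens_cases simp: rules k'kf)
  show "\<epsilon> (gen x) = 0 \<or> uq_deg \<xi> x = 0"
    using assms by (auto elim!: uq_gens_cases simp: \<epsilon>_gen)
qed

text \<open>Words grow on the left: in the convolution of \<open>S\<close> and the identity at a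
  product, the pair coming from the left factor stands innermost. For a generator it collapses to a
  scalar, and the induction hypothesis treats the rest.\<close>

lemma conv_left_\<Delta>: "x \<in> carrier U \<Longrightarrow> S.conv_left (\<Delta> x) = \<epsilon> x \<odot>\<^bsub>U\<^esub> \<one>\<^bsub>U\<^esub>"
proof (induction rule: U_induct)
  case one
  then show ?case by (simp add: \<Delta>_one \<epsilon>_one S.conv_left_pure S.S_one)
next
  case (add x y)
  then show ?case
    by (simp add: gamma_hom_add[OF \<Delta>_hom] gamma_hom_add[OF \<epsilon>_hom] cq_linear_add[OF S.conv_left_linear]
        U.smult_add)
next
  case (smult c x)
  then show ?case
    by (simp add: gamma_hom_smult[OF \<Delta>_hom] gamma_hom_smult[OF \<epsilon>_hom] cq_linear_smult[OF S.conv_left_linear]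
        U.smult_smult)
next
  case mult
  show ?case
  proof (intro disjI1 ballI impI)
    fix x X assume x: "x \<in> uq_gens I" and X: "X \<in> carrier U"
      and IH: "S.conv_left (\<Delta> X) = \<epsilon> X \<odot>\<^bsub>U\<^esub> \<one>\<^bsub>U\<^esub>"
    have "S.conv_left (\<Delta> (gen x) \<otimes>\<^bsub>UU\<^esub> \<Delta> X) = \<epsilon> (gen x) \<odot>\<^bsub>U\<^esub> S.conv_left (\<Delta> X)"
      by (rule S.conv_left_mult[OF gamma_hom_degree[OF \<Delta>_hom gen_hom[OF x]] conv_gen(1,3)[OF x]])
        (simp add: X)
    then show "S.conv_left (\<Delta> (gen x \<cdot> X)) = \<epsilon> (gen x \<cdot> X) \<odot>\<^bsub>U\<^esub> \<one>\<^bsub>U\<^esub>"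
      using x X by (simp add: IH gamma_hom_mult[OF \<Delta>_hom] gamma_hom_mult[OF \<epsilon>_hom] U.smult_smult)
  qed
qed

lemma conv_right_\<Delta>: "x \<in> carrier U \<Longrightarrow> S.conv_right (\<Delta> x) = \<epsilon> x \<odot>\<^bsub>U\<^esub> \<one>\<^bsub>U\<^esub>"
proof (induction rule: U_induct)
  case one
  then show ?case by (simp add: \<Delta>_one \<epsilon>_one S.conv_right_pure S.S_one)
next
  case (add x y)
  then show ?case
    by (simp add: gamma_hom_add[OF \<Delta>_hom] gamma_hom_add[OF \<epsilon>_hom] cq_linear_add[OF S.conv_right_linear]
        U.smult_add)
next
  case (smult c x)
  then show ?case
    by (simp add: gamma_hom_smult[OF \<Delta>_hom] gamma_hom_smult[OF \<epsilon>_hom] cq_linear_smult[OF S.conv_right_linear]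
        U.smult_smult)
next
  case mult
  show ?case
  \<comment> \<open>With \<open>S\<close> on the second factor the innermost pair comes from the
    right factor, so words grow on the right.\<close>
  proof (intro disjI2 ballI impI)
    fix x X assume x: "x \<in> uq_gens I" and X: "X \<in> carrier U"
      and IH: "S.conv_right (\<Delta> X) = \<epsilon> X \<odot>\<^bsub>U\<^esub> \<one>\<^bsub>U\<^esub>"
    have "S.conv_right (\<Delta> X \<otimes>\<^bsub>UU\<^esub> \<Delta> (gen x)) = \<epsilon> (gen x) \<odot>\<^bsub>U\<^esub> S.conv_right (\<Delta> X)"
      by (rule S.conv_right_mult[OF gamma_hom_degree[OF \<Delta>_hom gen_hom[OF x]] conv_gen(2,3)[OF x]])
        (simp add: X)
    then show "S.conv_right (\<Delta> (X \<cdot> gen x)) = \<epsilon> (X \<cdot> gen x) \<odot>\<^bsub>U\<^esub> \<one>\<^bsub>U\<^esub>"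
      using x X by (simp add: IH gamma_hom_mult[OF \<Delta>_hom] gamma_hom_mult[OF \<epsilon>_hom] U.smult_smult mult.commute)
  qed
qed

lemma hopf: "hopf_gamma_algebra \<omega> U \<Delta> \<epsilon> S"
  by (intro hopf_gamma_algebra.intro hopf_gamma_algebra_axioms.intro U_gamma_algebra)
    (use \<Delta>_hom \<epsilon>_hom coassociative counital_left counital_right S.S_gamma_linear S.S_mult
      conv_left_\<Delta> conv_right_\<Delta> in \<open>simp_all add: S.conv_left_def S.conv_right_def\<close>)

end

section \<open>Existence and uniqueness of the structure maps\<close>

context uq_data
begin

lemma structure_maps_exist:
  "\<exists>\<Delta> \<epsilon> S. \<Delta> \<in> extensional (carrier U) \<and> \<epsilon> \<in> extensional (carrier U) \<and> S \<in> extensional (carrier U) \<and>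
     uq_structure_maps \<omega> \<xi> I d A \<Delta> \<epsilon> S"
proof -
  have "\<Delta>e i \<in> hom_part UU (\<xi> i)" "\<Delta>f i \<in> hom_part UU (- \<xi> i)"
    "\<Delta>k i \<in> hom_part UU 0" "\<Delta>k' i \<in> hom_part UU 0" if "i \<in> I" for i
    using gens_hom[OF that] U.one_hom_part
    by (simp_all add: TT.T.hom_add TT.pure_hom[where \<alpha> = "\<xi> i" and \<beta> = 0]
        TT.pure_hom[where \<alpha> = "- \<xi> i" and \<beta> = 0] TT.pure_hom[where \<alpha> = 0])
  then have "\<exists>h. gamma_hom U UU h \<and>
      (\<forall>i\<in>I. h (e i) = \<Delta>e i \<and> h (f i) = \<Delta>f i \<and> h (k i) = \<Delta>k i \<and> h (k' i) = \<Delta>k' i)"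
    by (intro U_hom_exists[OF TT.T_gamma_algebra _ \<Delta>_rel] conjI)
  then obtain \<Delta> where \<Delta>: "gamma_hom U UU \<Delta>"
    "\<forall>i\<in>I. \<Delta> (e i) = \<Delta>e i \<and> \<Delta> (f i) = \<Delta>f i \<and> \<Delta> (k i) = \<Delta>k i \<and> \<Delta> (k' i) = \<Delta>k' i"
    by blast
  have "\<exists>h. gamma_hom U Cq_alg h \<and> (\<forall>i\<in>I. h (e i) = 0 \<and> h (f i) = 0 \<and> h (k i) = 1 \<and> h (k' i) = 1)"
    by (rule U_hom_exists[OF Cq_alg_gamma_algebra _ \<epsilon>_rel]) simp
  then obtain \<epsilon> where \<epsilon>: "gamma_hom U Cq_alg \<epsilon>"
    "\<forall>i\<in>I. \<epsilon> (e i) = 0 \<and> \<epsilon> (f i) = 0 \<and> \<epsilon> (k i) = 1 \<and> \<epsilon> (k' i) = 1"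
    by blast
  have "\<exists>h. gamma_hom U UA.opH h \<and>
      (\<forall>i\<in>I. h (e i) = Se i \<and> h (f i) = Sf i \<and> h (k i) = k' i \<and> h (k' i) = k i)"
    by (rule U_hom_exists[OF UA.op_gamma_algebra _ S_rel]) (simp add: S_hom gens_hom)
  then obtain S where S: "gamma_hom U UA.opH S"
    "\<forall>i\<in>I. S (e i) = Se i \<and> S (f i) = Sf i \<and> S (k i) = k' i \<and> S (k' i) = k i"
    by blast
  have "uq_structure_maps \<omega> \<xi> I d A (restrict \<Delta> (carrier U)) (restrict \<epsilon> (carrier U)) (restrict S (carrier U))"
    by unfold_locales
      (use \<Delta> \<epsilon> S in \<open>simp_all add: gamma_hom_restrict[OF U_gamma_algebra]\<close>)
  then show ?thesis using restrict_extensional by blast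
qed

end

theorem theorem4p5:
  fixes \<omega> :: "'g::ab_group_add \<Rightarrow> 'g \<Rightarrow> complex"
    and \<xi> :: "nat \<Rightarrow> 'g"
    and A :: "nat \<Rightarrow> nat \<Rightarrow> int"
    and l :: nat and I :: "nat set" and d :: "nat \<Rightarrow> nat"
  assumes "commutative_factor \<omega>"
    and "l \<ge> 1"
    and "(I = {1..l} \<and> cartan_matrix_finite I A) \<or>
         (\<exists>k. I = {0..l} \<and> cartan_matrix_untwisted_affine l A k \<and>
              \<xi> 0 = - (\<Sum>i=1..l. \<Sum>_<nat (k i). \<xi> i))"
    and "\<forall>i \<in> I. \<omega> (\<xi> i) (\<xi> i) = 1"
    and "least_even_symmetrizer I A d"
  shows "let U = Uq \<omega> \<xi> I d A; T = tensor_alg \<omega> U U; t = pure_tensor U U;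
             e = (\<lambda>i. uq_elem \<omega> \<xi> I d A (GenE i)); f = (\<lambda>i. uq_elem \<omega> \<xi> I d A (GenF i));
             k = (\<lambda>i. uq_elem \<omega> \<xi> I d A (GenK i)); k' = (\<lambda>i. uq_elem \<omega> \<xi> I d A (GenKinv i))
         in \<exists>!(\<Delta>, \<epsilon>, S).
              \<Delta> \<in> carrier U \<rightarrow>\<^sub>E carrier T \<and> \<epsilon> \<in> carrier U \<rightarrow>\<^sub>E UNIV \<and> S \<in> carrier U \<rightarrow>\<^sub>E carrier U \<and>
              hopf_gamma_algebra \<omega> U \<Delta> \<epsilon> S \<and>
              (\<forall>i \<in> I.
                 \<Delta> (e i) = t (e i) (k i) \<oplus>\<^bsub>T\<^esub> t \<one>\<^bsub>U\<^esub> (e i) \<and>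
                 \<Delta> (f i) = t (f i) \<one>\<^bsub>U\<^esub> \<oplus>\<^bsub>T\<^esub> t (k' i) (f i) \<and>
                 \<Delta> (k i) = t (k i) (k i) \<and> \<Delta> (k' i) = t (k' i) (k' i) \<and>
                 \<epsilon> (e i) = 0 \<and> \<epsilon> (f i) = 0 \<and> \<epsilon> (k i) = 1 \<and> \<epsilon> (k' i) = 1 \<and>
                 S (e i) = \<ominus>\<^bsub>U\<^esub> (e i \<otimes>\<^bsub>U\<^esub> k' i) \<and>
                 S (f i) = \<ominus>\<^bsub>U\<^esub> (k i \<otimes>\<^bsub>U\<^esub> f i) \<and>
                 S (k i) = k' i \<and> S (k' i) = k i)"
proof -
  have cartan: "gen_cartan_matrix I A"
    using assms(3) by (auto simp: cartan_matrix_finite_def cartan_matrix_untwisted_affine_def)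
  interpret uq_data \<omega> \<xi> I d A
    by unfold_locales
      (use assms(1,4,5) cartan in \<open>auto simp: gen_cartan_matrix_def least_even_symmetrizer_def symmetrizes_def\<close>)
  obtain \<Delta> \<epsilon> S where ext: "\<Delta> \<in> extensional (carrier U)" "\<epsilon> \<in> extensional (carrier U)" "S \<in> extensional (carrier U)"
    and maps: "uq_structure_maps \<omega> \<xi> I d A \<Delta> \<epsilon> S"
    using structure_maps_exist by blast
  interpret M: uq_structure_maps \<omega> \<xi> I d A \<Delta> \<epsilon> S by (rule maps)
  show ?thesis
    unfolding Let_def
  proof (rule ex1I[of _ "(\<Delta>, \<epsilon>, S)"], goal_cases)
    case 1
    then show ?case
      using ext M.hopf gamma_hom_closed[OF M.\<Delta>_hom]
      by (simp add: PiE_def Pi_iff M.\<Delta>_gen M.\<epsilon>_gen M.S_gen)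
  next
    case (2 x)
    obtain \<Delta>' \<epsilon>' S' where x: "x = (\<Delta>', \<epsilon>', S')" by (cases x)
    note 2 = 2[unfolded x prod.case]
    then interpret H: hopf_gamma_algebra \<omega> U \<Delta>' \<epsilon>' S' by blast
    have ext': "\<Delta>' \<in> extensional (carrier U)" "\<epsilon>' \<in> extensional (carrier U)" "S' \<in> extensional (carrier U)"
      using 2 unfolding PiE_def by blast+
    have "\<Delta>' X = \<Delta> X" if "X \<in> carrier U" for X
      by (rule U_hom_eqI[OF TT.T_gamma_algebra H.comult_hom M.\<Delta>_hom _ that])
        (use 2 in \<open>simp add: M.\<Delta>_gen\<close>)
    moreover have "\<epsilon>' X = \<epsilon> X" if "X \<in> carrier U" for X
      by (rule U_hom_eqI[OF Cq_alg_gamma_algebra H.counit_hom M.\<epsilon>_hom _ that])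
        (use 2 in \<open>simp add: M.\<epsilon>_gen\<close>)
    \<comment> \<open>Both antipodes are compared as homomorphisms into the opposite
      algebra.\<close>
    moreover have "S' X = S X" if "X \<in> carrier U" for X
      by (rule U_hom_eqI[OF UA.op_gamma_algebra UA.antipode_op_hom[OF H.hopf_gamma_algebra_axioms]
            M.S_op_hom _ that])
        (use 2 in \<open>simp add: M.S_gen\<close>)
    \<comment> \<open>Agreement on the carrier is enough, since all six maps are
      extensional.\<close>
    ultimately show ?case
      unfolding x using ext ext' by (auto intro: extensionalityI)
  qed
qed

end
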